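(* Let $n\ge2$, $k\ge1$. The Loewner ellipsoid (minimum-volume ellipsoid containing) of $\overline{L\!f}$, as a convex body in the affine hyperplane $M$, is \[ \Big\{f\in M:\ \sum_{i=1}^{k}\left(\frac{(k-i)!\,\Gamma\!\left(\frac{2k+2i+n}{2}\right)}{k!\,\Gamma\!\left(\frac{2k+n}{2}\right)}\right)^{2}\|l_{2i}(f)\|^2\ \le\ D(n,2k)-1\Big\}, \] and the coefficient of symmetry of $\overline{L\!f}$ with respect to $r^{2k}$ is \[ \frac{1}{D(n,k)-1}=\frac{1}{\binom{n+k-1}{k}-1}. \]
   Context: $P_{n,d}$ is the space of real forms of degree $d$ in $n$ variables, $r^2=x_1^2+\dots+x_n^2$, $\sigma$ the rotation-invariant probability measure on $S^{n-1}$, $\langle f,g\rangle=\int_{S^{n-1}}fg\,d\sigma$, $\|f\|=\langle f,f\rangle^{1/2}$. $D(n,d)=\binom{n+d-1}{d}=\dim P_{n,d}$. $H_{n,d}=\{f\in P_{n,d}:\Delta f=0\}$ (harmonic forms), and $P_{n,2k}=\bigoplus_{i=0}^{k} r^{2k-2i}H_{n,2i}$ is an orthogonal decomposition; $l_{2i}(f)$ denotes the orthogonal projection of $f$ onto $r^{2k-2i}H_{n,2i}$. $M=\{f\in P_{n,2k}:\int f\,d\sigma=1\}$. $L\!f$ is the cone of finite sums of $2k$-th powers of real linear forms in $P_{n,2k}$, and $\overline{L\!f}=L\!f\cap M$. The coefficient of symmetry of a convex body $K$ about an interior point $v$ is the largest $\beta\in\mathbb R$ with $-\beta(K-v)\subseteq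 K-v$. *)

theory Defs
  imports "HOL-Analysis.Analysis"
begin

definition monomial :: "('n::finite \<Rightarrow> nat) \<Rightarrow> real^'n \<Rightarrow> real" where
  "monomial \<alpha> x = (\<Prod>i\<in>UNIV. (x $ i) ^ (\<alpha> i))"

definition exps :: "nat \<Rightarrow> ('n::finite \<Rightarrow> nat) set" where
  "exps d = {\<alpha>. sum \<alpha> UNIV = d}"

definition forms :: "nat \<Rightarrow> (real^'n::finite \<Rightarrow> real) set" where
  "forms d = {f. \<exists>c. f = (\<lambda>x. \<Sum>\<alpha>\<in>exps d. c \<alpha> * monomial \<alpha> x)}"

text \<open>D(n,d) = dim P_{n,d}\<close>
definition Ddim :: "nat \<Rightarrow> nat \<Rightarrow> nat" where
  "Ddim n d = (n + d - 1) choose d"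

text \<open>Integral against the rotation-invariant probability measure on the unit sphere,
  realised as the normalised cone measure: sigma(A) = vol{t a : a in A, 0 < t <= 1} / vol(ball).\<close>
definition sph_int :: "(real^'n::finite \<Rightarrow> real) \<Rightarrow> real" where
  "sph_int f = (LINT x:ball 0 1|lborel. f (x /\<^sub>R norm x)) / measure lborel (ball (0::real^'n) 1)"

definition ip :: "(real^'n::finite \<Rightarrow> real) \<Rightarrow> (real^'n \<Rightarrow> real) \<Rightarrow> real" where
  "ip f g = sph_int (\<lambda>x. f x * g x)"

definition fnorm :: "(real^'n::finite \<Rightarrow> real) \<Rightarrow> real" where
  "fnorm f = sqrt (ip f f)"

definition laplacian :: "(real^'n::finite \<Rightarrow> real) \<Rightarrow> real^'n \<Rightarrow> real" where
  "laplacian f x = (\<Sum>i\<in>UNIV. deriv (deriv (\<lambda>t. f (x + t *\<^sub>R axis i 1))) 0)"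

definition harmonic_forms :: "nat \<Rightarrow> (real^'n::finite \<Rightarrow> real) set" where
  "harmonic_forms d = {f \<in> forms d. \<forall>x. laplacian f x = 0}"

definition rH :: "nat \<Rightarrow> nat \<Rightarrow> (real^'n::finite \<Rightarrow> real) set" where
  "rH k i = {(\<lambda>x. norm x ^ (2*k - 2*i) * h x) | h. h \<in> harmonic_forms (2*i)}"

definition oproj :: "(real^'n::finite \<Rightarrow> real) set \<Rightarrow> (real^'n \<Rightarrow> real) \<Rightarrow> (real^'n \<Rightarrow> real)" where
  "oproj V f = (THE g. g \<in> V \<and> (\<forall>h\<in>V. ip (\<lambda>x. f x - g x) h = 0))"

definition lproj :: "nat \<Rightarrow> nat \<Rightarrow> (real^'n::finite \<Rightarrow> real) \<Rightarrow> (real^'n \<Rightarrow> real)" where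
  "lproj k i f = oproj (rH k i) f"

definition Mset :: "nat \<Rightarrow> (real^'n::finite \<Rightarrow> real) set" where
  "Mset k = {f \<in> forms (2*k). sph_int f = 1}"

definition Lf :: "nat \<Rightarrow> (real^'n::finite \<Rightarrow> real) set" where
  "Lf k = {f. \<exists>vs :: (real^'n) list. f = (\<lambda>x. \<Sum>v\<leftarrow>vs. (v \<bullet> x) ^ (2*k))}"

definition Lfbar :: "nat \<Rightarrow> (real^'n::finite \<Rightarrow> real) set" where
  "Lfbar k = Lf k \<inter> Mset k"

definition aff_param :: "('a \<Rightarrow> real) \<Rightarrow> (nat \<Rightarrow> 'a \<Rightarrow> real) \<Rightarrow> nat \<Rightarrow> (nat \<Rightarrow> real) \<Rightarrow> ('a \<Rightarrow> real)" where
  "aff_param c w m u = (\<lambda>x. c x + (\<Sum>j<m. u j * w j x))"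

definition Rm :: "nat \<Rightarrow> (nat \<Rightarrow> real) set" where
  "Rm m = PiE {..<m} (\<lambda>_. UNIV)"

definition affine_chart :: "('a \<Rightarrow> real) set \<Rightarrow> nat \<Rightarrow> ('a \<Rightarrow> real) \<Rightarrow> (nat \<Rightarrow> 'a \<Rightarrow> real) \<Rightarrow> bool" where
  "affine_chart A m c w \<longleftrightarrow> bij_betw (aff_param c w m) (Rm m) A"

definition ellipsoid_in :: "('a \<Rightarrow> real) set \<Rightarrow> nat \<Rightarrow> ('a \<Rightarrow> real) set \<Rightarrow> bool" where
  "ellipsoid_in A m E \<longleftrightarrow> (\<exists>c w. affine_chart A m c w \<and>
      E = aff_param c w m ` {u \<in> Rm m. (\<Sum>j<m. (u j)\<^sup>2) \<le> 1})"

text \<open>Volume inside A, computed in a fixed affine chart (determined up to a constant factor).\<close>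
definition vol_in :: "('a \<Rightarrow> real) set \<Rightarrow> nat \<Rightarrow> ('a \<Rightarrow> real) set \<Rightarrow> ennreal" where
  "vol_in A m S = (let (c, w) = (SOME p. affine_chart A m (fst p) (snd p)) in
      emeasure (PiM {..<m} (\<lambda>_. lborel)) {u \<in> Rm m. aff_param c w m u \<in> S})"

definition is_loewner :: "('a \<Rightarrow> real) set \<Rightarrow> nat \<Rightarrow> ('a \<Rightarrow> real) set \<Rightarrow> ('a \<Rightarrow> real) set \<Rightarrow> bool" where
  "is_loewner A m K E \<longleftrightarrow> ellipsoid_in A m E \<and> K \<subseteq> E \<and>
     (\<forall>E'. ellipsoid_in A m E' \<and> K \<subseteq> E' \<longrightarrow> vol_in A m E \<le> vol_in A m E')"

definition coeff_sym :: "('a \<Rightarrow> real) set \<Rightarrow> ('a \<Rightarrow> real) \<Rightarrow> real" where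
  "coeff_sym K v = (GREATEST \<beta>::real. \<forall>f\<in>K. (\<lambda>x. v x - \<beta> * (f x - v x)) \<in> K)"

end

theory Submission
  imports Defs "HOL-Computational_Algebra.Fundamental_Theorem_Algebra"
begin

text \<open>
  The operator \<open>R\<close> integrating a form against \<open>(x \<bullet> v)\<^sup>2\<^sup>k\<close>, normalised to preserve means, is by the Funk--Hecke
  formula the scalar \<open>1 / lam n k i\<close> on \<open>r\<^sup>2\<^sup>k\<^sup>-\<^sup>2\<^sup>i H\<^sub>2\<^sub>i\<close>. It maps the reproducing kernel at a unit vector \<open>v\<close> to
  the extreme point of \<open>Lfbar k\<close> in direction \<open>v\<close>, and the ball of squared radius \<open>D(n,2k)\<close> in \<open>Mset k\<close> to the
  ellipsoid. The reproducing kernels lie on the boundary of this ball and are isotropic, so integrating the inequality of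
  any other containing ellipsoid over the sphere bounds the trace of its quadratic part, and the inequality of arithmetic
  and geometric means bounds its volume. Volumes are compared through triangular (Gram--Schmidt) changes of coordinates.

  The coefficient of symmetry is governed by the largest multiple of an extreme point \<open>f\<^sub>u\<close> that can be subtracted
  from \<open>r\<^sup>2\<^sup>k\<close> inside the cone. It is at most \<open>1 / D(n,k)\<close> by pairing with the square of the reproducing
  kernel of degree \<open>k\<close> at \<open>u\<close>. It is attained because a Gauss--Lobatto rule for the height \<open>u \<bullet> v\<close>,
  combined with a spherical design on each latitude, is a positive quadrature formula with mass \<open>1 / D(n,k)\<close> at \<open>\<plusminus>u\<close>.
\<close>

section \<open>Forms and their derivatives\<close>

text \<open>The measure is given only as a cone measure, so its invariance is first proved for
  rotations in coordinate planes; differentiating that yields Green's identity for forms on the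
  sphere. The rest of the analysis is algebra in the degree: general orthogonal invariance, the
  harmonic decomposition and the Funk--Hecke formula all follow from Green's identity. D(n,2k)
  enters as the constant diagonal value of the reproducing kernel, hence as its squared norm. The
  same number bounds squared values of forms on the sphere, which puts \<open>Lfbar k\<close> inside
  the ball. With m = D(n,2k) - 1 the trace bound is exactly the one that makes the ball of squared
  radius m optimal. \<open>vol_in\<close> uses an unspecified chart, so the comparison of volumes
  has to hold in every chart; a triangular map multiplies volume by the product of its diagonal, and
  Gram--Schmidt supplies such maps. If t is the largest multiple of f_u that can be subtracted from
  r^(2k), rescaling the remainder to mean 1 turns t into t / (1 - t); t = 1 / D(n,k) gives 1 /
  (D(n,k) - 1).\<close>

lemma finite_exps: "finite (exps d :: ('n::finite \<Rightarrow> nat) set)"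
proof -
  have "exps d \<subseteq> (UNIV :: 'n set) \<rightarrow>\<^sub>E {..d}"
    by (auto simp: exps_def PiE_def extensional_def member_le_sum)
  then show ?thesis by (rule finite_subset) (simp add: finite_PiE)
qed

lemma exps_0: "exps 0 = {\<lambda>i::'n::finite. 0}"
  by (auto simp: exps_def)

lemma monomial_add:
  "monomial (\<lambda>i. \<alpha> i + \<beta> i) x = monomial \<alpha> x * monomial \<beta> x"
  by (simp add: monomial_def power_add prod.distrib)

lemma forms_zero [intro]: "(\<lambda>x. 0) \<in> forms d"
  unfolding forms_def by (auto intro!: exI[of _ "\<lambda>_. 0"])

lemma forms_add [intro]:
  assumes "f \<in> forms d" "g \<in> forms d" shows "(\<lambda>x. f x + g x) \<in> forms d"
proof -
  obtain a b where "f = (\<lambda>x. \<Sum>\<alpha>\<in>exps d. a \<alpha> * monomial \<alpha> x)" "g = (\<lambda>x. \<Sum>\<alpha>\<in>exps d. b \<alpha> * monomial \<alpha> x)"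
    using assms unfolding forms_def by blast
  then have "(\<lambda>x. f x + g x) = (\<lambda>x. \<Sum>\<alpha>\<in>exps d. (a \<alpha> + b \<alpha>) * monomial \<alpha> x)"
    by (simp add: sum.distrib algebra_simps)
  then show ?thesis unfolding forms_def by fast
qed

lemma forms_scale [intro]:
  assumes "f \<in> forms d" shows "(\<lambda>x. c * f x) \<in> forms d"
proof -
  obtain a where "f = (\<lambda>x. \<Sum>\<alpha>\<in>exps d. a \<alpha> * monomial \<alpha> x)"
    using assms unfolding forms_def by blast
  then have "(\<lambda>x. c * f x) = (\<lambda>x. \<Sum>\<alpha>\<in>exps d. (c * a \<alpha>) * monomial \<alpha> x)"
    by (simp add: sum_distrib_left algebra_simps)
  then show ?thesis unfolding forms_def by fast
qed

lemma forms_diff [intro]: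
  assumes "f \<in> forms d" "g \<in> forms d" shows "(\<lambda>x. f x - g x) \<in> forms d"
  using forms_add[OF assms(1) forms_scale[OF assms(2), of "-1"]] by simp

lemma forms_sum [intro]:
  "(\<And>i. i \<in> I \<Longrightarrow> f i \<in> forms d) \<Longrightarrow> (\<lambda>x. \<Sum>i\<in>I. f i x) \<in> forms d"
  by (induction I rule: infinite_finite_induct) auto

lemma monomial_forms: "\<alpha> \<in> exps d \<Longrightarrow> monomial \<alpha> \<in> forms d"
  unfolding forms_def mem_Collect_eq
  by (rule exI[of _ "\<lambda>\<beta>. if \<beta> = \<alpha> then 1 else 0"])
     (simp add: if_distrib[of "\<lambda>c. c * _"] finite_exps sum.delta' cong: if_cong)

lemma forms_const: "(\<lambda>x. c) \<in> forms 0"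
proof -
  have "(\<lambda>x. c * monomial (\<lambda>_. 0) x) \<in> forms 0"
    by (intro forms_scale monomial_forms) (simp add: exps_0)
  then show ?thesis by (simp add: monomial_def)
qed

lemma forms_0D: "f \<in> forms 0 \<Longrightarrow> \<exists>c. f = (\<lambda>x. c)"
  unfolding forms_def by (auto simp: exps_0 monomial_def)

lemma forms_mult [intro]:
  assumes "f \<in> forms a" "g \<in> forms b" shows "(\<lambda>x. f x * g x) \<in> forms (a + b)"
proof -
  obtain p q where *: "f = (\<lambda>x. \<Sum>\<alpha>\<in>exps a. p \<alpha> * monomial \<alpha> x)" "g = (\<lambda>x. \<Sum>\<alpha>\<in>exps b. q \<alpha> * monomial \<alpha> x)"
    using assms unfolding forms_def by blast
  have "(\<lambda>x. f x * g x) = (\<lambda>x. \<Sum>\<alpha>\<in>exps a. \<Sum>\<beta>\<in>exps b. (p \<alpha> * q \<beta>) * monomial (\<lambda>i. \<alpha> i + \<beta> i) x)"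
    unfolding * monomial_add by (simp add: sum_product algebra_simps)
  also have "\<dots> \<in> forms (a + b)"
    by (intro forms_sum forms_scale monomial_forms) (auto simp: exps_def sum.distrib)
  finally show ?thesis .
qed

lemma coord_forms: "(\<lambda>x. x $ i) \<in> forms 1" for i :: "'n::finite"
proof -
  have "(monomial (\<lambda>j. if j = i then 1 else 0) :: real^'n \<Rightarrow> real) \<in> forms 1"
    by (rule monomial_forms) (simp add: exps_def)
  moreover have "monomial (\<lambda>j. if j = i then 1 else 0) x = x $ i" for x :: "real^'n"
  proof -
    have "monomial (\<lambda>j. if j = i then 1 else 0) x = (\<Prod>j\<in>UNIV. if j = i then x $ j else 1)"
      unfolding monomial_def by (intro prod.cong) auto
    then show ?thesis by simp
  qed
  ultimately show ?thesis by (metis (no_types, lifting) ext)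
qed

lemma coord_mult_forms: "f \<in> forms d \<Longrightarrow> (\<lambda>x. x $ i * f x) \<in> forms (Suc d)"
  using forms_mult[OF coord_forms, of f d i] by simp

lemma forms_power: "f \<in> forms a \<Longrightarrow> (\<lambda>x. f x ^ m) \<in> forms (a * m)"
  by (induction m) (auto simp: forms_const add.commute dest: forms_mult)

lemma linear_form_forms: "(\<lambda>x::real^'n::finite. v \<bullet> x) \<in> forms 1"
  unfolding inner_vec_def using forms_sum[OF forms_scale[OF coord_forms]] by simp

lemma linear_form_power_forms: "(\<lambda>x::real^'n::finite. (v \<bullet> x) ^ m) \<in> forms m"
  using forms_power[OF linear_form_forms, of v m] by simp

lemma norm_square_forms: "(\<lambda>x::real^'n::finite. (norm x)\<^sup>2) \<in> forms 2"
proof -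
  have "(\<lambda>x::real^'n. \<Sum>i\<in>UNIV. (x $ i) ^ 2) \<in> forms (1 * 2)"
    by (intro forms_sum forms_power coord_forms)
  moreover have "(\<Sum>i\<in>UNIV. (x $ i) ^ 2) = (norm x)\<^sup>2" for x :: "real^'n"
    by (simp add: norm_vec_def L2_set_def sum_nonneg)
  ultimately show ?thesis by simp
qed

lemma norm_power_forms: "(\<lambda>x::real^'n::finite. norm x ^ (2 * m)) \<in> forms (2 * m)"
  using forms_power[OF norm_square_forms, of m] by (simp add: power_mult)

text \<open>A monomial of positive degree has a coordinate factor, so constants, sums and
  multiplication by a coordinate generate all forms. \<open>P\<close> carries the degree because the
  last step raises it.\<close>

lemma forms_induct [consumes 1, case_names const add coord]:
  assumes "f \<in> forms d"
  assumes const: "\<And>c. P 0 (\<lambda>x. c)"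
  assumes add: "\<And>d f g. f \<in> forms d \<Longrightarrow> g \<in> forms d \<Longrightarrow> P d f \<Longrightarrow> P d g \<Longrightarrow> P d (\<lambda>x. f x + g x)"
  assumes coord: "\<And>d f i. f \<in> forms d \<Longrightarrow> P d f \<Longrightarrow> P (Suc d) (\<lambda>x. x $ i * f x)"
  shows "P d (f :: real^'n::finite \<Rightarrow> real)"
proof -
  \<comment> \<open>The zero form of every degree comes from the constant 0 by multiplying with a
    coordinate; it starts the sum over monomials.\<close>
  have zero: "P d (\<lambda>x. 0)" for d
  proof (induction d)
    case (Suc d)
    show ?case using coord[OF forms_zero Suc] by simp
  qed (rule const)
  have mono: "P d (\<lambda>x. c * monomial \<alpha> x)" if "\<alpha> \<in> exps d" for \<alpha> d c
    using that
  proof (induction d arbitrary: \<alpha>)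
    case 0
    then show ?case using const by (simp add: exps_0 monomial_def)
  next
    case (Suc d)
    then have "sum \<alpha> UNIV = Suc d" by (simp add: exps_def)
    then obtain i where i: "\<alpha> i > 0"
      by (metis gr0I sum.neutral zero_less_Suc less_irrefl)
    define \<beta> where "\<beta> = \<alpha>(i := \<alpha> i - 1)"
    define \<delta> where "\<delta> = (\<lambda>j. if j = i then 1 else 0::nat)"
    have \<alpha>: "\<alpha> = (\<lambda>j. \<delta> j + \<beta> j)"
      using i by (auto simp: \<beta>_def \<delta>_def)
    have "sum \<alpha> UNIV = 1 + sum \<beta> UNIV"
      unfolding \<alpha> sum.distrib by (simp add: \<delta>_def)
    then have \<beta>: "\<beta> \<in> exps d" using Suc.prems by (simp add: exps_def)
    have \<delta>x: "monomial \<delta> x = x $ i" for x :: "real^'n"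
    proof -
      have "monomial \<delta> x = (\<Prod>j\<in>UNIV. if j = i then x $ j else 1)"
        unfolding monomial_def \<delta>_def by (intro prod.cong) auto
      then show ?thesis by simp
    qed
    have "P (Suc d) (\<lambda>x. x $ i * (c * monomial \<beta> x))"
      by (intro coord Suc.IH \<beta> forms_scale monomial_forms)
    moreover have "(\<lambda>x. x $ i * (c * monomial \<beta> x)) = (\<lambda>x. c * monomial \<alpha> x)"
      unfolding \<alpha> monomial_add \<delta>x by (simp add: algebra_simps)
    ultimately show ?case by simp
  qed
  obtain c where f: "f = (\<lambda>x. \<Sum>\<alpha>\<in>exps d. c \<alpha> * monomial \<alpha> x)"
    using assms(1) unfolding forms_def by blast
  have "P d (\<lambda>x. \<Sum>\<alpha>\<in>S. c \<alpha> * monomial \<alpha> x)" if "S \<subseteq> exps d" for S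
    using finite_subset[OF that finite_exps] that
  proof (induction S rule: finite_induct)
    case (insert \<alpha> S)
    have "P d (\<lambda>x. c \<alpha> * monomial \<alpha> x + (\<Sum>\<alpha>\<in>S. c \<alpha> * monomial \<alpha> x))"
      using insert by (intro add mono forms_sum forms_scale monomial_forms) auto
    then show ?case using insert by simp
  qed (simp add: zero)
  then show ?thesis unfolding f by simp
qed

lemma forms_homogeneous: "f \<in> forms d \<Longrightarrow> f (c *\<^sub>R x) = c ^ d * f x"
  by (induction rule: forms_induct) (auto simp: algebra_simps)

text \<open>Homogeneity propagates equality along rays; at the origin both sides are values at the
  multiple 0 of a nonzero vector, which also covers degree 0. The common degree is essential: 1 and
  r^2 agree on the sphere.\<close>

lemma forms_eq_on_sphere:
  assumes "f \<in> forms d" "g \<in> forms d" "\<And>x. norm x = 1 \<Longrightarrow> f x = g x"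
  shows "f = (g :: real^'n::finite \<Rightarrow> real)"
proof
  fix x :: "real^'n"
  have *: "f x = g x" if "x \<noteq> 0" for x
  proof -
    have "f (norm x *\<^sub>R sgn x) = g (norm x *\<^sub>R sgn x)"
      unfolding forms_homogeneous[OF assms(1)] forms_homogeneous[OF assms(2)]
      using assms(3)[of "sgn x"] that by (simp add: norm_sgn)
    moreover have "norm x *\<^sub>R sgn x = x"
      using that by (simp add: sgn_div_norm)
    ultimately show ?thesis by simp
  qed
  show "f x = g x"
  proof (cases "x = 0")
    case True
    let ?y = "axis undefined 1 :: real^'n"
    have "f (0 *\<^sub>R ?y) = g (0 *\<^sub>R ?y)"
      unfolding forms_homogeneous[OF assms(1)] forms_homogeneous[OF assms(2)]
      using *[of ?y] by (simp add: axis_eq_0_iff)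
    then show ?thesis using True by simp
  qed (rule *)
qed

lemma axis_expansion: "(\<Sum>i\<in>UNIV. x $ i *\<^sub>R axis i 1) = (x :: real^'n::finite)"
  by (simp add: vec_eq_iff axis_def if_distrib[of "\<lambda>c. _ * c"] cong: if_cong)

lemma forms_compose_linear:
  fixes f :: "real^'n::finite \<Rightarrow> real"
  assumes "f \<in> forms d" "linear (U :: real^'m::finite \<Rightarrow> real^'n)"
  shows "(\<lambda>x. f (U x)) \<in> forms d"
  using assms(1)
proof (induction rule: forms_induct)
  case (coord d f i)
  have "(\<lambda>x. U x $ i) = (\<lambda>x. (\<chi> j. U (axis j 1) $ i) \<bullet> x)"
  proof
    fix x
    have "U x = U (\<Sum>j\<in>UNIV. x $ j *\<^sub>R axis j 1)"
      by (simp only: axis_expansion)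
    also have "\<dots> = (\<Sum>j\<in>UNIV. x $ j *\<^sub>R U (axis j 1))"
      by (simp add: linear_sum[OF assms(2)] linear_scale[OF assms(2)])
    finally show "U x $ i = (\<chi> j. U (axis j 1) $ i) \<bullet> x"
      by (simp add: inner_vec_def sum_component mult.commute)
  qed
  then have "(\<lambda>x. U x $ i) \<in> forms 1"
    using linear_form_forms by metis
  then show ?case using forms_mult[OF _ coord(2), of _ 1] by simp
qed (auto intro: forms_const)

section \<open>Directional derivatives and the Laplacian of forms\<close>

lemma forms_differentiable: "f \<in> forms d \<Longrightarrow> f differentiable (at x)"
proof (induction rule: forms_induct)
  case (coord d f i)
  have "(\<lambda>x. x $ i) differentiable (at x)"
    by (intro bounded_linear_imp_differentiable bounded_linear_vec_nth)
  then show ?case using coord by (intro differentiable_mult)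
qed (auto intro: differentiable_add)

lemma forms_continuous: "f \<in> forms d \<Longrightarrow> continuous_on S f"
  by (meson continuous_at_imp_continuous_on differentiable_imp_continuous_within forms_differentiable)

text \<open>Taken along an arbitrary vector, so that Euler's identity is the case
  \<open>v = x\<close>, while iterating it along an axis gives a summand of
  \<open>laplacian\<close>.\<close>

definition pd :: "'a::real_normed_vector \<Rightarrow> ('a \<Rightarrow> real) \<Rightarrow> 'a \<Rightarrow> real" where
  "pd v f x = deriv (\<lambda>t. f (x + t *\<^sub>R v)) 0"

lemma forms_line_derivative:
  assumes "f \<in> forms d"
  shows "((\<lambda>t. f (x + t *\<^sub>R v)) has_field_derivative pd v f (x + s *\<^sub>R v)) (at s)"
proof -
  obtain f' where f': "(f has_derivative f') (at (x + s *\<^sub>R v))"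
    using forms_differentiable[OF assms] unfolding differentiable_def by blast
  have *: "((\<lambda>t. f (y + t *\<^sub>R v)) has_field_derivative f' v) (at r)" if "y + r *\<^sub>R v = x + s *\<^sub>R v" for y r
  proof -
    have "((\<lambda>t. y + t *\<^sub>R v) has_derivative (\<lambda>t. t *\<^sub>R v)) (at r)"
      by (auto intro!: derivative_eq_intros)
    moreover have "(f has_derivative f') (at (y + r *\<^sub>R v))"
      using f' that by simp
    ultimately have "((\<lambda>t. f (y + t *\<^sub>R v)) has_derivative (\<lambda>t. f' (t *\<^sub>R v))) (at r)"
      using has_derivative_compose by blast
    moreover have "(\<lambda>t. f' (t *\<^sub>R v)) = (*) (f' v)"
      using has_derivative_linear[OF f'] by (simp add: linear_scale fun_eq_iff)
    ultimately show ?thesis unfolding has_field_derivative_def by simp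
  qed
  have "pd v f (x + s *\<^sub>R v) = f' v"
    unfolding pd_def by (intro DERIV_imp_deriv *) simp
  then show ?thesis using *[of x s] by simp
qed

lemma pd_eqI: "((\<lambda>t. f (x + t *\<^sub>R v)) has_field_derivative D) (at 0) \<Longrightarrow> pd v f x = D"
  unfolding pd_def by (rule DERIV_imp_deriv)

lemma pd_has_derivative: "f \<in> forms d \<Longrightarrow> ((\<lambda>t. f (x + t *\<^sub>R v)) has_field_derivative pd v f x) (at 0)"
  using forms_line_derivative[of f d x v 0] by simp

lemma forms_has_derivative:
  assumes "f \<in> forms d"
  shows "(f has_derivative (\<lambda>v. pd v f x)) (at x)"
proof -
  obtain f' where f': "(f has_derivative f') (at x)"
    using forms_differentiable[OF assms] unfolding differentiable_def by blast
  have "f' v = pd v f x" for v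
  proof -
    have "((\<lambda>t. x + t *\<^sub>R v) has_derivative (\<lambda>t. t *\<^sub>R v)) (at 0)"
      by (auto intro!: derivative_eq_intros)
    moreover have "(f has_derivative f') (at (x + 0 *\<^sub>R v))"
      using f' by simp
    ultimately have "((\<lambda>t. f (x + t *\<^sub>R v)) has_derivative (\<lambda>t. f' (t *\<^sub>R v))) (at 0)"
      using has_derivative_compose by blast
    moreover have "(\<lambda>t. f' (t *\<^sub>R v)) = (*) (f' v)"
      using has_derivative_linear[OF f'] by (simp add: linear_scale fun_eq_iff)
    ultimately have "((\<lambda>t. f (x + t *\<^sub>R v)) has_field_derivative f' v) (at 0)"
      unfolding has_field_derivative_def by simp
    then show ?thesis by (simp add: pd_eqI)
  qed
  then have "f' = (\<lambda>v. pd v f x)" by blast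
  then show ?thesis using f' by simp
qed

lemma pd_linear: "f \<in> forms d \<Longrightarrow> linear (\<lambda>v. pd v f x)"
  using forms_has_derivative has_derivative_linear by blast

lemma pd_const [simp]: "pd v (\<lambda>x. c) = (\<lambda>x. 0)"
  by (auto simp: pd_def)

lemma pd_add:
  assumes "f \<in> forms a" "g \<in> forms b"
  shows "pd v (\<lambda>x. f x + g x) x = pd v f x + pd v g x"
  by (intro pd_eqI DERIV_add pd_has_derivative[OF assms(1)] pd_has_derivative[OF assms(2)])

lemma pd_scale:
  assumes "f \<in> forms a"
  shows "pd v (\<lambda>x. c * f x) x = c * pd v f x"
  by (intro pd_eqI DERIV_cmult pd_has_derivative[OF assms])

lemma pd_mult:
  assumes "f \<in> forms a" "g \<in> forms b"
  shows "pd v (\<lambda>x. f x * g x) x = f x * pd v g x + pd v f x * g x"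
  using DERIV_mult'[OF pd_has_derivative[OF assms(1), of x v] pd_has_derivative[OF assms(2), of x v]]
  by (intro pd_eqI) simp

lemma pd_coord [simp]: "pd v (\<lambda>x. x $ i) = (\<lambda>x. v $ i)"
  by (rule ext, rule pd_eqI) (auto intro!: derivative_eq_intros)

lemma pd_coord_mult: "f \<in> forms d \<Longrightarrow> pd v (\<lambda>x. x $ i * f x) = (\<lambda>x. x $ i * pd v f x + v $ i * f x)"
  using pd_mult[OF coord_forms] by (auto simp: fun_eq_iff)

text \<open>Truncated subtraction is harmless in degree 0, where the derivative is the zero form. In
  the coordinate case \<open>d = 0\<close> is separate because there \<open>d - 1\<close> does not
  drop, and multiplying by a coordinate would overshoot the degree.\<close>

lemma pd_forms: "f \<in> forms d \<Longrightarrow> pd v f \<in> forms (d - 1)"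
proof (induction rule: forms_induct)
  case (add d f g)
  then have "pd v (\<lambda>x. f x + g x) = (\<lambda>x. pd v f x + pd v g x)"
    by (auto simp: pd_add)
  then show ?case using add by auto
next
  case (coord d f i)
  show ?case
  proof (cases d)
    case 0
    then obtain c where "f = (\<lambda>x. c)" using coord forms_0D by blast
    then have "pd v (\<lambda>x. x $ i * f x) = (\<lambda>x. v $ i * c)"
      unfolding pd_coord_mult[OF coord(1)] by simp
    then show ?thesis using 0 by (simp add: forms_const)
  next
    case (Suc m)
    then show ?thesis unfolding pd_coord_mult[OF coord(1)]
      using coord_mult_forms[OF coord(2), of i] coord(1) by auto
  qed
qed (simp add: forms_const)

lemma pd_forms_Suc: "f \<in> forms (Suc d) \<Longrightarrow> pd v f \<in> forms d"
  using pd_forms by fastforce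

lemma pd_forms_0: "f \<in> forms 0 \<Longrightarrow> pd v f = (\<lambda>x. 0)"
  using forms_0D by fastforce

lemma pd_sum:
  assumes "\<And>i. i \<in> I \<Longrightarrow> f i \<in> forms d"
  shows "pd v (\<lambda>x. \<Sum>i\<in>I. f i x) x = (\<Sum>i\<in>I. pd v (f i) x)"
  using assms
proof (induction I rule: infinite_finite_induct)
  case (insert i I)
  have "pd v (\<lambda>x. f i x + (\<Sum>i\<in>I. f i x)) x = pd v (f i) x + pd v (\<lambda>x. \<Sum>i\<in>I. f i x) x"
    using insert.prems by (intro pd_add[of _ d _ d] forms_sum) auto
  then show ?case using insert by simp
qed simp_all

lemma pd_commute: "f \<in> forms d \<Longrightarrow> pd v (pd w f) = pd w (pd v f)"
proof (induction rule: forms_induct)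
  case (add d f g)
  have *: "pd u (\<lambda>x. f x + g x) = (\<lambda>x. pd u f x + pd u g x)" for u
    using pd_add[OF add(1,2)] by blast
  show ?case using add pd_add[OF pd_forms[OF add(1)] pd_forms[OF add(2)]]
    by (auto simp: * fun_eq_iff)
next
  case (coord d f i)
  have "pd u (pd u' (\<lambda>x. x $ i * f x)) x = x $ i * pd u (pd u' f) x + u $ i * pd u' f x + u' $ i * pd u f x" for u u' x
    unfolding pd_coord_mult[OF coord(1)]
    by (subst pd_add[OF coord_mult_forms[OF pd_forms[OF coord(1)]] forms_scale[OF coord(1)]],
        subst pd_coord_mult[OF pd_forms[OF coord(1)]], subst pd_scale[OF coord(1)]) simp
  then show ?case using coord by (simp add: fun_eq_iff)
qed simp

lemma euler: "f \<in> forms d \<Longrightarrow> pd x f x = real d * f x"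
proof (induction rule: forms_induct)
  case (add d f g)
  then show ?case by (simp add: pd_add[OF add(1,2)] algebra_simps)
next
  case (coord d f i)
  then show ?case by (simp add: pd_coord_mult[OF coord(1)] distrib_right)
qed simp

lemma pd_expand:
  assumes "f \<in> forms d"
  shows "pd v f x = (\<Sum>i\<in>UNIV. v $ i * pd (axis i 1) f (x :: real^'n::finite))"
proof -
  have "pd v f x = pd (\<Sum>i\<in>UNIV. v $ i *\<^sub>R axis i 1) f x"
    by (simp only: axis_expansion)
  then show ?thesis
    by (simp add: linear_sum[OF pd_linear[OF assms]] linear_scale[OF pd_linear[OF assms]])
qed

text \<open>Differentiating twice at 0 requires the first derivative at every point of the line,
  which \<open>forms_line_derivative\<close> provides.\<close>

lemma laplacian_eq:
  assumes "f \<in> forms d"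
  shows "laplacian f x = (\<Sum>i\<in>UNIV. pd (axis i 1) (pd (axis i 1) f) x)"
proof -
  have "deriv (\<lambda>t. f (x + t *\<^sub>R v)) = (\<lambda>s. pd v f (x + s *\<^sub>R v))" for v
    using DERIV_imp_deriv[OF forms_line_derivative[OF assms]] by blast
  then show ?thesis unfolding laplacian_def by (simp add: pd_def[of _ "pd _ _"])
qed

lemma laplacian_forms:
  assumes "f \<in> forms d" shows "laplacian f \<in> forms (d - 2)"
proof -
  have "(\<lambda>x. \<Sum>i\<in>UNIV. pd (axis i 1) (pd (axis i 1) f) x) \<in> forms (d - 1 - 1)"
    by (intro forms_sum pd_forms assms)
  moreover have "laplacian f = (\<lambda>x. \<Sum>i\<in>UNIV. pd (axis i 1) (pd (axis i 1) f) x)"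
    using laplacian_eq[OF assms] by blast
  ultimately show ?thesis by (simp add: numeral_2_eq_2)
qed

lemma laplacian_low:
  assumes "f \<in> forms d" "d < 2" shows "laplacian f x = 0"
proof -
  have "pd v f \<in> forms 0" for v using pd_forms[OF assms(1), of v] assms(2) by (metis One_nat_def diff_is_0_eq less_2_cases_iff zero_less_diff not_gr0 less_Suc_eq_le diff_0_eq_0 diff_self_eq_0)
  then show ?thesis by (simp add: laplacian_eq[OF assms(1)] pd_forms_0)
qed

lemma laplacian_add:
  assumes "f \<in> forms a" "g \<in> forms a"
  shows "laplacian (\<lambda>x. f x + g x) x = laplacian f x + laplacian g x"
proof -
  have *: "pd u (\<lambda>x. f x + g x) = (\<lambda>x. pd u f x + pd u g x)" for u
    using pd_add[OF assms] by blast
  show ?thesis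
    by (simp add: laplacian_eq[OF forms_add[OF assms]] laplacian_eq[OF assms(1)] laplacian_eq[OF assms(2)] *
      pd_add[OF pd_forms[OF assms(1)] pd_forms[OF assms(2)]] sum.distrib)
qed

lemma laplacian_scale:
  assumes "f \<in> forms a"
  shows "laplacian (\<lambda>x. c * f x) x = c * laplacian f x"
proof -
  have *: "pd u (\<lambda>x. c * f x) = (\<lambda>x. c * pd u f x)" for u
    using pd_scale[OF assms] by blast
  show ?thesis
    by (simp add: laplacian_eq[OF forms_scale[OF assms]] laplacian_eq[OF assms(1)] *
      pd_scale[OF pd_forms[OF assms]] sum_distrib_left)
qed

lemma laplacian_mult:
  assumes "f \<in> forms a" "g \<in> forms b"
  shows "laplacian (\<lambda>x. f x * g x) x =
    f x * laplacian g x + 2 * (\<Sum>i\<in>UNIV. pd (axis i 1) f x * pd (axis i 1) g x) + laplacian f x * g x"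
proof -
  have *: "pd u (\<lambda>x. f x * g x) = (\<lambda>x. f x * pd u g x + pd u f x * g x)" for u
    using pd_mult[OF assms] by blast
  have "pd u (pd u (\<lambda>x. f x * g x)) x =
    f x * pd u (pd u g) x + 2 * (pd u f x * pd u g x) + pd u (pd u f) x * g x" for u
    unfolding * using pd_mult[OF assms(1) pd_forms[OF assms(2)], of u u x]
      pd_mult[OF pd_forms[OF assms(1)] assms(2), of u u x]
      DERIV_add[OF pd_has_derivative[OF forms_mult[OF assms(1) pd_forms[OF assms(2), of u]], of x u]
        pd_has_derivative[OF forms_mult[OF pd_forms[OF assms(1), of u] assms(2)], of x u]]
    by (intro pd_eqI) (simp add: algebra_simps)
  then show ?thesis
    by (simp add: laplacian_eq[OF forms_mult[OF assms]] laplacian_eq[OF assms(1)] laplacian_eq[OF assms(2)]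
       sum.distrib sum_distrib_left sum_distrib_right)
qed

lemma pd_linear_form_power:
  "pd u (\<lambda>x. (v \<bullet> x) ^ a) x = real a * (v \<bullet> x) ^ (a - 1) * (v \<bullet> u)"
  by (rule pd_eqI) (auto intro!: derivative_eq_intros simp: inner_add_right)

lemma laplacian_linear_form_power:
  fixes v :: "real^'n::finite"
  shows "laplacian (\<lambda>x. (v \<bullet> x) ^ a) x = real a * real (a - 1) * (v \<bullet> v) * (v \<bullet> x) ^ (a - 2)"
proof -
  have *: "pd u (\<lambda>x. (v \<bullet> x) ^ a) = (\<lambda>x. (real a * (v \<bullet> u)) * (v \<bullet> x) ^ (a - 1))" for u
    using pd_linear_form_power[of u v a] by (simp add: fun_eq_iff)
  have "pd u (pd u (\<lambda>x. (v \<bullet> x) ^ a)) x = real a * real (a - 1) * (v \<bullet> x) ^ (a - 2) * (v \<bullet> u)\<^sup>2" for u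
    unfolding * pd_scale[OF linear_form_power_forms] pd_linear_form_power
    by (simp add: power2_eq_square numeral_2_eq_2)
  then show ?thesis
    by (simp add: laplacian_eq[OF linear_form_power_forms] sum_distrib_left[symmetric] inner_axis
       inner_vec_def[of v v] power2_eq_square)
qed

section \<open>Integration over the sphere\<close>

text \<open>Fubini isolates one coordinate, and \<open>g\<close>, being independent of it, acts as
  the constant of a one-dimensional affine substitution. This serves both the shears behind
  rotations and the triangular maps behind the comparison of volumes.\<close>

lemma PiM_coord_update:
  fixes f :: "('i \<Rightarrow> real) \<Rightarrow> ennreal" and c :: real
  assumes I: "finite I" "i \<in> I" and c: "c \<noteq> 0"
    and f [measurable]: "f \<in> borel_measurable (Pi\<^sub>M I (\<lambda>_. lborel))"
    and g [measurable]: "g \<in> borel_measurable (Pi\<^sub>M I (\<lambda>_. lborel))"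
    and g_indep: "\<And>u y. g (u(i := y)) = g u"
  shows "(\<integral>\<^sup>+u. f u \<partial>Pi\<^sub>M I (\<lambda>_. lborel)) =
    ennreal \<bar>c\<bar> * (\<integral>\<^sup>+u. f (u(i := g u + c * u i)) \<partial>Pi\<^sub>M I (\<lambda>_. lborel))"
proof -
  interpret product_sigma_finite "\<lambda>_. lborel :: real measure" by standard
  define J where "J = I - {i}"
  have J: "finite J" "i \<notin> J" "insert i J = I" using I by (auto simp: J_def)
  have f': "f \<in> borel_measurable (Pi\<^sub>M (insert i J) (\<lambda>_. lborel))"
    using f by (simp add: J)
  have upd: "(\<lambda>u. u(i := g u + c * u i)) \<in> measurable (Pi\<^sub>M I (\<lambda>_. lborel)) (Pi\<^sub>M I (\<lambda>_. lborel))"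
    using I by (intro measurable_fun_upd[where J = I]) (auto intro!: measurable_component_singleton)
  then have h: "(\<lambda>u. f (u(i := g u + c * u i))) \<in> borel_measurable (Pi\<^sub>M I (\<lambda>_. lborel))"
    by measurable
  have m: "(\<lambda>(x, y). f (x(i := y))) \<in> borel_measurable (Pi\<^sub>M J (\<lambda>_. lborel) \<Otimes>\<^sub>M lborel)"
    using measurable_compose[OF measurable_add_dim f'] by (simp add: case_prod_unfold)
  have "(\<integral>\<^sup>+u. f u \<partial>Pi\<^sub>M I (\<lambda>_. lborel)) = (\<integral>\<^sup>+x. \<integral>\<^sup>+y. f (x(i := y)) \<partial>lborel \<partial>Pi\<^sub>M J (\<lambda>_. lborel))"
    using product_nn_integral_insert[OF J(1,2) f'] by (simp add: J)
  also have "\<dots> = (\<integral>\<^sup>+x. ennreal \<bar>c\<bar> * (\<integral>\<^sup>+y. f (x(i := g x + c * y)) \<partial>lborel) \<partial>Pi\<^sub>M J (\<lambda>_. lborel))"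
  proof (intro nn_integral_cong nn_integral_real_affine c)
    fix x assume "x \<in> space (Pi\<^sub>M J (\<lambda>_. lborel :: real measure))"
    from measurable_Pair_compose_split[OF m measurable_const[OF this, of lborel] measurable_ident]
    show "(\<lambda>y. f (x(i := y))) \<in> borel_measurable borel" by simp
  qed
  also have "\<dots> = (\<integral>\<^sup>+x. ennreal \<bar>c\<bar> * (\<integral>\<^sup>+y. f ((x(i := y))(i := g (x(i := y)) + c * (x(i := y)) i)) \<partial>lborel) \<partial>Pi\<^sub>M J (\<lambda>_. lborel))"
    by (simp add: g_indep)
  also have "\<dots> = ennreal \<bar>c\<bar> * (\<integral>\<^sup>+x. (\<integral>\<^sup>+y. f ((x(i := y))(i := g (x(i := y)) + c * (x(i := y)) i)) \<partial>lborel) \<partial>Pi\<^sub>M J (\<lambda>_. lborel))"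
  proof (rule nn_integral_cmult)
    have h': "(\<lambda>u. f (u(i := g u + c * u i))) \<in> borel_measurable (Pi\<^sub>M (insert i J) (\<lambda>_. lborel))"
      using h by (simp only: J)
    have "(\<lambda>z. f (((fst z)(i := snd z))(i := g ((fst z)(i := snd z)) + c * ((fst z)(i := snd z)) i)))
      \<in> borel_measurable (Pi\<^sub>M J (\<lambda>_. lborel) \<Otimes>\<^sub>M lborel)"
      using measurable_compose[OF measurable_add_dim h'] by (simp add: case_prod_unfold)
    from lborel.borel_measurable_nn_integral_fst[OF this]
    show "(\<lambda>x. \<integral>\<^sup>+y. f ((x(i := y))(i := g (x(i := y)) + c * (x(i := y)) i)) \<partial>lborel)
      \<in> borel_measurable (Pi\<^sub>M J (\<lambda>_. lborel))" by simp
  qed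
  also have "(\<integral>\<^sup>+x. (\<integral>\<^sup>+y. f ((x(i := y))(i := g (x(i := y)) + c * (x(i := y)) i)) \<partial>lborel) \<partial>Pi\<^sub>M J (\<lambda>_. lborel))
     = (\<integral>\<^sup>+u. f (u(i := g u + c * u i)) \<partial>Pi\<^sub>M I (\<lambda>_. lborel))"
    using product_nn_integral_insert[OF J(1,2), of "\<lambda>u. f (u(i := g u + c * u i))"] h by (simp only: J)
  finally show ?thesis .
qed

text \<open>In coordinates a shear alters one coordinate by a multiple of another, which is
  \<open>PiM_coord_update\<close> with factor 1.\<close>

lemma lborel_shear:
  fixes b b' :: "'a::euclidean_space"
  assumes b: "b \<in> Basis" "b' \<in> Basis" "b \<noteq> b'"
  shows "distr lborel borel (\<lambda>x. x + (a * (x \<bullet> b')) *\<^sub>R b) = (lborel :: 'a measure)"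
proof (rule measure_eqI)
  fix A :: "'a set" assume "A \<in> sets (distr lborel borel (\<lambda>x. x + (a * (x \<bullet> b')) *\<^sub>R b))"
  then have A [measurable]: "A \<in> sets borel" by simp
  let ?P = "\<Pi>\<^sub>M b\<in>(Basis :: 'a set). (lborel :: real measure)"
  let ?s = "\<lambda>u::'a \<Rightarrow> real. \<Sum>b\<in>Basis. u b *\<^sub>R b"
  let ?T = "\<lambda>x. x + (a * (x \<bullet> b')) *\<^sub>R b"
  have s: "?s \<in> measurable ?P borel" by measurable
  have sc: "?s u \<bullet> b' = u b'" for u
    using b by (simp add: inner_sum_left inner_Basis if_distrib cong: if_cong)
  have su: "?T (?s u) = ?s (u(b := a * u b' + 1 * u b))" for u
  proof -
    have "?s (u(b := a * u b' + 1 * u b)) = (\<Sum>c\<in>Basis. u c *\<^sub>R c + (if c = b then (a * u b') *\<^sub>R b else 0))"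
      by (intro sum.cong) (auto simp: algebra_simps)
    also have "\<dots> = ?s u + (a * u b') *\<^sub>R b"
      using b by (simp add: sum.distrib)
    finally show ?thesis by (simp only: sc)
  qed
  have "emeasure (distr lborel borel ?T) A = (\<integral>\<^sup>+x. indicator A x \<partial>distr lborel borel ?T)"
    by simp
  also have "\<dots> = (\<integral>\<^sup>+x. indicator A (?T x) \<partial>lborel)"
    by (rule nn_integral_distr) measurable
  also have "\<dots> = (\<integral>\<^sup>+u. indicator A (?T (?s u)) \<partial>?P)"
    unfolding lborel_eq[where 'a = 'a] by (subst nn_integral_distr) (use s in simp_all)
  also have "\<dots> = (\<integral>\<^sup>+u. indicator A (?s (u(b := a * u b' + 1 * u b))) \<partial>?P)"
    by (simp only: su)
  also have "\<dots> = (\<integral>\<^sup>+u. indicator A (?s u) \<partial>?P)"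
  proof -
    have "(\<lambda>u. indicator A (?s u) :: ennreal) \<in> borel_measurable ?P"
      by measurable
    moreover have "(\<lambda>u. a * u b') \<in> borel_measurable ?P" using b by measurable
    ultimately show ?thesis
      using PiM_coord_update[of Basis b 1 "\<lambda>u. indicator A (?s u)" "\<lambda>u. a * u b'"] b by simp
  qed
  also have "\<dots> = (\<integral>\<^sup>+x. indicator A x \<partial>(lborel :: 'a measure))"
    unfolding lborel_eq[where 'a = 'a] by (subst nn_integral_distr) (use s in simp_all)
  also have "\<dots> = emeasure lborel A" by simp
  finally show "emeasure (distr lborel borel ?T) A = emeasure lborel A" .
qed simp

text \<open>Rotation by \<open>t\<close> in the plane of \<open>b\<close> and \<open>b'\<close>,
  written as a correction to the identity so that the remaining coordinates stay untouched.\<close>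

definition rot :: "'a::euclidean_space \<Rightarrow> 'a \<Rightarrow> real \<Rightarrow> 'a \<Rightarrow> 'a" where
  "rot b b' t x = x + ((cos t - 1) * (x \<bullet> b) - sin t * (x \<bullet> b')) *\<^sub>R b
     + (sin t * (x \<bullet> b) + (cos t - 1) * (x \<bullet> b')) *\<^sub>R b'"

lemma rot_inner:
  assumes "b \<in> Basis" "b' \<in> Basis" "b \<noteq> b'"
  shows "rot b b' t x \<bullet> b = cos t * (x \<bullet> b) - sin t * (x \<bullet> b')"
    "rot b b' t x \<bullet> b' = sin t * (x \<bullet> b) + cos t * (x \<bullet> b')"
  using assms by (auto simp: rot_def inner_simps inner_Basis algebra_simps)

lemma norm_rot:
  assumes "b \<in> Basis" "b' \<in> Basis" "b \<noteq> b'"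
  shows "norm (rot b b' t x) = norm x"
proof -
  define s c where "s = sin t" and "c = cos t"
  define p q where "p = x \<bullet> b" and "q = x \<bullet> b'"
  have o: "b \<bullet> b = 1" "b' \<bullet> b' = 1" "b \<bullet> b' = 0" "b' \<bullet> b = 0" "b \<bullet> x = p" "b' \<bullet> x = q"
    using assms by (auto simp: inner_Basis p_def q_def inner_commute)
  have "rot b b' t x \<bullet> rot b b' t x = x \<bullet> x + 2 * ((c - 1) * p - s * q) * p
      + 2 * (s * p + (c - 1) * q) * q
      + ((c - 1) * p - s * q)\<^sup>2 + (s * p + (c - 1) * q)\<^sup>2"
    unfolding rot_def p_def[symmetric] q_def[symmetric] s_def[symmetric] c_def[symmetric]
    by (simp add: inner_add_left inner_add_right o p_def[symmetric] q_def[symmetric] power2_eq_square algebra_simps)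
  also have "\<dots> = x \<bullet> x + (p\<^sup>2 + q\<^sup>2) * (s\<^sup>2 + c\<^sup>2 - 1)"
    by (simp add: power2_eq_square algebra_simps)
  finally show ?thesis by (simp add: norm_eq_sqrt_inner s_def c_def)
qed

text \<open>A plane rotation is a product of three shears.\<close>

lemma lborel_rot:
  assumes b: "b \<in> Basis" "b' \<in> Basis" "b \<noteq> b'" and t: "\<bar>t\<bar> < pi"
  shows "distr lborel borel (rot b b' t) = (lborel :: 'a::euclidean_space measure)"
proof -
  \<comment> \<open>The outer two shears go along \<open>b\<close> with coefficient minus tan(t/2),
    the middle one along \<open>b'\<close> with coefficient sin t; \<open>\<bar>t\<bar> < pi\<close>
    keeps cos(t/2) nonzero.\<close>
  define \<tau> where "\<tau> = tan (t / 2)"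
  have c: "cos (t / 2) \<noteq> 0"
    using t cos_gt_zero_pi[of "t / 2"] by (simp add: abs_less_iff)
  have st: "sin t = 2 * sin (t / 2) * cos (t / 2)" "cos t = 1 - 2 * (sin (t / 2))\<^sup>2"
    "cos t = 2 * (cos (t / 2))\<^sup>2 - 1"
    using sin_double[of "t / 2"] cos_double_sin[of "t / 2"] cos_double_cos[of "t / 2"] by simp_all
  have e1: "1 - sin t * \<tau> = cos t"
    using c by (simp add: st(1) st(2) \<tau>_def tan_def power2_eq_square)
  have e2: "\<tau> * (1 + cos t) = sin t"
    using c by (simp add: st(1) st(3) \<tau>_def tan_def power2_eq_square)
  let ?S1 = "\<lambda>x::'a. x + (- \<tau> * (x \<bullet> b')) *\<^sub>R b"
  let ?S2 = "\<lambda>x::'a. x + (sin t * (x \<bullet> b)) *\<^sub>R b'"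
  have o: "b \<bullet> b = 1" "b' \<bullet> b' = 1" "b \<bullet> b' = 0" "b' \<bullet> b = 0"
    using b by (auto simp: inner_Basis)
  have eq: "?S1 (?S2 (?S1 x)) = rot b b' t x" for x
  proof -
    define p q where "p = x \<bullet> b" and "q = x \<bullet> b'"
    have i: "?S1 x \<bullet> b = p - \<tau> * q" "?S2 (?S1 x) \<bullet> b' = q + sin t * (p - \<tau> * q)"
      by (simp_all add: inner_add_left inner_diff_left o p_def q_def)
    define y where "y = ?S2 (?S1 x)"
    have "y = x + (- \<tau> * q) *\<^sub>R b + (sin t * (p - \<tau> * q)) *\<^sub>R b'"
      unfolding y_def i(1) by (simp only: q_def)
    moreover have "?S1 y = y + (- \<tau> * (q + sin t * (p - \<tau> * q))) *\<^sub>R b"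
      using i(2) by (simp only: y_def)
    ultimately have "?S1 y = x + (- \<tau> * q) *\<^sub>R b + (sin t * (p - \<tau> * q)) *\<^sub>R b'
        + (- \<tau> * (q + sin t * (p - \<tau> * q))) *\<^sub>R b" by simp
    also have "\<dots> = x + (- \<tau> * q - \<tau> * (q + sin t * (p - \<tau> * q))) *\<^sub>R b + (sin t * (p - \<tau> * q)) *\<^sub>R b'"
      by (simp add: scaleR_left_diff_distrib)
    also have "- \<tau> * q - \<tau> * (q + sin t * (p - \<tau> * q)) = (1 - sin t * \<tau> - 1) * p - (\<tau> * (1 + (1 - sin t * \<tau>))) * q"
      by (simp add: algebra_simps)
    also have "\<dots> = (cos t - 1) * p - sin t * q" by (simp only: e1 e2)
    also have "sin t * (p - \<tau> * q) = sin t * p + ((1 - sin t * \<tau>) - 1) * q" by (simp add: algebra_simps)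
    finally show ?thesis unfolding rot_def p_def q_def e1 y_def .
  qed
  have m: "?S1 \<in> borel_measurable borel" "?S2 \<in> borel_measurable borel" by measurable
  have d1: "distr lborel borel ?S1 = lborel" and d2: "distr lborel borel ?S2 = lborel"
    using lborel_shear[OF b, of "- \<tau>"] lborel_shear[OF b(2,1), of "sin t"] b by auto
  have "distr lborel borel (rot b b' t) = distr lborel borel (?S1 \<circ> (?S2 \<circ> ?S1))"
  proof (intro arg_cong[of _ _ "distr lborel borel"] ext)
    show "rot b b' t x = (?S1 \<circ> (?S2 \<circ> ?S1)) x" for x
      unfolding o_def by (rule eq[symmetric])
  qed
  also have "\<dots> = distr (distr (distr lborel borel ?S1) borel ?S2) borel ?S1"
    using m by (simp add: distr_distr measurable_comp o_assoc[symmetric] comp_assoc)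
  finally show ?thesis by (simp only: d1 d2)
qed

section \<open>The spherical mean as a normalised positive functional\<close>

lemma sph_int_eq:
  fixes f :: "real^'n::finite \<Rightarrow> real"
  shows "sph_int f = (\<integral>x. indicator (ball 0 1) x * f (x /\<^sub>R norm x) \<partial>lborel) / measure lborel (ball (0::real^'n) 1)"
  by (simp add: sph_int_def set_lebesgue_integral_def)

lemma ball_measure_pos: "measure lborel (ball (0::real^'n::finite) 1) > 0"
  using content_ball_pos[of 1 "0::real^'n"] by simp

lemma sph_bounded:
  assumes "continuous_on UNIV (f :: real^'n::finite \<Rightarrow> real)"
  obtains C where "C \<ge> 0" "\<And>x. \<bar>f (x /\<^sub>R norm x)\<bar> \<le> C"
proof -
  \<comment> \<open>The closed ball rather than the sphere, since the normalised vector is 0 at the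
    origin.\<close>
  have "compact (f ` cball 0 1)"
    using assms by (intro compact_continuous_image continuous_on_subset[OF assms]) auto
  then obtain C where C: "\<And>y. y \<in> f ` cball 0 1 \<Longrightarrow> norm y \<le> C"
    using compact_imp_bounded bounded_iff by metis
  have "x /\<^sub>R norm x \<in> cball 0 1" for x :: "real^'n"
    by (cases "x = 0") auto
  then have "\<bar>f (x /\<^sub>R norm x)\<bar> \<le> C" for x
    using C[OF imageI] by (simp add: real_norm_def[symmetric] del: real_norm_def)
  moreover from this[of 0] have "C \<ge> 0" by linarith
  ultimately show ?thesis using that by blast
qed

lemma sph_measurable:
  assumes "continuous_on UNIV (f :: real^'n::finite \<Rightarrow> real)"
  shows "(\<lambda>x. indicator (ball 0 1) x * f (x /\<^sub>R norm x)) \<in> borel_measurable lborel"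
proof -
  have "f \<in> borel_measurable borel" by (rule borel_measurable_continuous_onI[OF assms])
  moreover have "(\<lambda>x::real^'n. x /\<^sub>R norm x) \<in> borel_measurable borel" by measurable
  ultimately have "(\<lambda>x. f (x /\<^sub>R norm x)) \<in> borel_measurable borel"
    by (rule measurable_compose[rotated])
  moreover have "(indicator (ball 0 1) :: real^'n \<Rightarrow> real) \<in> borel_measurable borel"
    by (intro borel_measurable_indicator) simp
  ultimately have "(\<lambda>x. indicator (ball 0 1) x * f (x /\<^sub>R norm x)) \<in> borel_measurable borel"
    by (rule borel_measurable_times[rotated])
  then show ?thesis by (subst measurable_cong_sets[OF sets_lborel refl])
qed

lemma integrable_ball_const: "integrable lborel (\<lambda>x::real^'n::finite. indicator (ball 0 1) x * (C::real))"
  using emeasure_lborel_ball_finite[of "0::real^'n" 1]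
  by (intro integrable_mult_left integrable_real_indicator) auto

lemma sph_integrable:
  assumes "continuous_on UNIV (f :: real^'n::finite \<Rightarrow> real)"
  shows "integrable lborel (\<lambda>x. indicator (ball 0 1) x * f (x /\<^sub>R norm x))"
proof -
  obtain C where C: "C \<ge> 0" "\<And>x. \<bar>f (x /\<^sub>R norm x)\<bar> \<le> C" by (rule sph_bounded[OF assms]) blast
  show ?thesis
    by (rule Bochner_Integration.integrable_bound[OF integrable_ball_const[of C] sph_measurable[OF assms]])
       (use C in \<open>auto simp: indicator_def\<close>)
qed

lemma sph_int_cmult: "sph_int (\<lambda>x. c * f x) = c * sph_int f"
proof -
  have "(\<lambda>x. indicator (ball 0 1) x * (c * f (x /\<^sub>R norm x))) = (\<lambda>x. c * (indicator (ball 0 1) x * f (x /\<^sub>R norm x)))"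
    by (auto simp: fun_eq_iff)
  then show ?thesis unfolding sph_int_eq by simp
qed

lemma sph_int_add:
  assumes "continuous_on UNIV f" "continuous_on UNIV g"
  shows "sph_int (\<lambda>x. f x + g x) = sph_int f + sph_int g"
  unfolding sph_int_eq distrib_left
  by (simp add: Bochner_Integration.integral_add[OF sph_integrable[OF assms(1)] sph_integrable[OF assms(2)]] add_divide_distrib)

lemma sph_int_zero [simp]: "sph_int (\<lambda>x. 0) = 0"
  by (simp add: sph_int_eq)

lemma sph_int_sum:
  assumes "\<And>i. i \<in> I \<Longrightarrow> continuous_on UNIV (f i)"
  shows "sph_int (\<lambda>x. \<Sum>i\<in>I. f i x) = (\<Sum>i\<in>I. sph_int (f i))"
  using assms
proof (induction I rule: infinite_finite_induct)
  case (insert i I)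
  then have "sph_int (\<lambda>x. f i x + (\<Sum>i\<in>I. f i x)) = sph_int (f i) + sph_int (\<lambda>x. \<Sum>i\<in>I. f i x)"
    by (intro sph_int_add continuous_on_sum) auto
  then show ?case using insert by simp
qed simp_all

lemma sph_int_one [simp]: "sph_int (\<lambda>x::real^'n::finite. 1) = 1"
  using ball_measure_pos[where 'n='n] by (simp add: sph_int_eq)

lemma sph_int_const [simp]: "sph_int (\<lambda>x::real^'n::finite. c) = c"
  using sph_int_cmult[of c "\<lambda>x::real^'n. 1"] by simp

lemma sph_int_diff:
  assumes "continuous_on UNIV f" "continuous_on UNIV g"
  shows "sph_int (\<lambda>x. f x - g x) = sph_int f - sph_int g"
  using sph_int_add[OF assms(1), of "\<lambda>x. -1 * g x"] sph_int_cmult[of "-1" g] assms(2)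
  by (simp add: continuous_on_minus)

lemma AE_lborel_nonzero: "AE x in lborel. (x::real^'n::finite) \<noteq> 0"
  by (rule AE_lborel_singleton)

lemma norm_normalize: "x \<noteq> 0 \<Longrightarrow> norm (x /\<^sub>R norm x) = 1"
  by simp

text \<open>The two integrands can differ only at the origin, a null set.\<close>

lemma sph_int_cong:
  assumes "continuous_on UNIV f" "continuous_on UNIV g" "\<And>x::real^'n::finite. norm x = 1 \<Longrightarrow> f x = g x"
  shows "sph_int f = sph_int g"
proof -
  have "AE x in lborel. indicator (ball 0 1) x * f (x /\<^sub>R norm x) = indicator (ball 0 1) x * g (x /\<^sub>R norm x)"
    using AE_lborel_nonzero by eventually_elim (use assms(3) norm_normalize in metis)
  then show ?thesis unfolding sph_int_eq
    by (intro arg_cong2[where f = "(/)"] integral_cong_AE sph_measurable assms refl)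
qed

lemma sph_int_mono:
  assumes "continuous_on UNIV f" "continuous_on UNIV g" "\<And>x::real^'n::finite. norm x = 1 \<Longrightarrow> f x \<le> g x"
  shows "sph_int f \<le> sph_int g"
proof -
  have "AE x in lborel. indicator (ball 0 1) x * f (x /\<^sub>R norm x) \<le> indicator (ball 0 1) x * g (x /\<^sub>R norm x)"
    using AE_lborel_nonzero
    by eventually_elim (use assms(3) norm_normalize in \<open>metis (no_types, lifting) mult_left_mono indicator_pos_le\<close>)
  then show ?thesis unfolding sph_int_eq
    using ball_measure_pos[where 'n='n]
    by (intro divide_right_mono integral_mono_AE sph_integrable assms) auto
qed

lemma sph_int_nonneg:
  assumes "continuous_on UNIV f" "\<And>x::real^'n::finite. norm x = 1 \<Longrightarrow> 0 \<le> f x"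
  shows "0 \<le> sph_int f"
  using sph_int_mono[of "\<lambda>_. 0" f] assms by simp

text \<open>A zero integral would make the set where the radial extension of \<open>f\<close> is
  nonzero a null set. This set is open, and it contains \<open>u /\<^sub>R 2\<close>, which lies
  inside the open ball while \<open>u\<close> does not.\<close>

lemma sph_int_pos:
  assumes f: "continuous_on UNIV f" "\<And>x::real^'n::finite. norm x = 1 \<Longrightarrow> 0 \<le> f x"
    and u: "norm u = 1" "f u \<noteq> 0"
  shows "0 < sph_int f"
proof (rule ccontr)
  assume "\<not> 0 < sph_int f"
  then have "sph_int f = 0" using sph_int_nonneg[OF f] by simp
  then have i0: "(\<integral>x. indicator (ball 0 1) x * f (x /\<^sub>R norm x) \<partial>lborel) = 0"
    using ball_measure_pos[where 'n='n] by (simp add: sph_int_eq)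
  have "AE x in lborel. 0 \<le> indicator (ball 0 1) x * f (x /\<^sub>R norm x)"
    using AE_lborel_nonzero
    by eventually_elim (use f(2) norm_normalize in \<open>metis (no_types, lifting) mult_nonneg_nonneg indicator_pos_le\<close>)
  then have AE0: "AE x in lborel. indicator (ball 0 1) x * f (x /\<^sub>R norm x) = 0"
    using integral_nonneg_eq_0_iff_AE[OF sph_integrable[OF f(1)]] i0 by simp
  define S where "S = (ball 0 1 - {0}) \<inter> (\<lambda>x. f (x /\<^sub>R norm x)) -` (- {0})"
  have c: "continuous_on (ball 0 1 - {0}) (\<lambda>x. f (x /\<^sub>R norm x))"
    by (intro continuous_on_compose2[OF f(1)] continuous_intros) auto
  have "open S" unfolding S_def
    by (rule continuous_open_preimage[OF c]) auto
  moreover have "u /\<^sub>R 2 \<in> S"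
    using u by (auto simp: S_def)
  moreover have "S \<in> null_sets lborel"
  proof -
    have "AE x in lborel. x \<notin> S"
      using AE0 by eventually_elim (auto simp: S_def)
    moreover have "S \<in> sets lborel" using \<open>open S\<close> by simp
    ultimately show ?thesis by (simp add: AE_iff_null_sets)
  qed
  ultimately show False
    using open_not_negligible[of S] negligible_iff_null_sets null_sets_completionI by blast
qed

section \<open>Infinitesimal rotations and Green's identity\<close>

text \<open>The angular momentum operator of the plane of axes \<open>i\<close> and
  \<open>j\<close>, that is, the generator of the rotations
  \<open>rot (axis i 1) (axis j 1)\<close>.\<close>

definition rotgen :: "'n \<Rightarrow> 'n \<Rightarrow> (real^'n::finite \<Rightarrow> real) \<Rightarrow> real^'n \<Rightarrow> real" where
  "rotgen i j f x = x $ i * pd (axis j 1) f x - x $ j * pd (axis i 1) f x"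

lemma rotgen_forms: "f \<in> forms d \<Longrightarrow> rotgen i j f \<in> forms d"
proof (cases d)
  case 0
  assume f: "f \<in> forms d"
  show ?thesis using pd_forms_0[OF f[unfolded 0]] by (auto simp: rotgen_def[abs_def])
next
  case (Suc m)
  assume f: "f \<in> forms d"
  show ?thesis using f unfolding Suc rotgen_def[abs_def]
    by (intro forms_diff coord_mult_forms pd_forms_Suc)
qed

text \<open>Rotations in a plane form a one-parameter group, so the derivative at any angle is the
  generator at the rotated point. The mean value theorem in \<open>sph_int_rotgen\<close> uses
  angles other than 0.\<close>

lemma rot_derivative:
  fixes f :: "real^'n::finite \<Rightarrow> real"
  assumes f: "f \<in> forms d" and ij: "i \<noteq> j"
  shows "((\<lambda>t. f (rot (axis i 1) (axis j 1) t x)) has_field_derivative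
      rotgen i j f (rot (axis i 1) (axis j 1) t x)) (at t)"
proof -
  let ?b = "axis i 1 :: real^'n" and ?b' = "axis j 1 :: real^'n"
  have b: "?b \<in> Basis" "?b' \<in> Basis" "?b \<noteq> ?b'"
    using ij by (auto simp: axis_eq_axis axis_in_Basis_iff)
  define v where "v = (- sin t * (x \<bullet> ?b) - cos t * (x \<bullet> ?b')) *\<^sub>R ?b + (cos t * (x \<bullet> ?b) - sin t * (x \<bullet> ?b')) *\<^sub>R ?b'"
  have d: "((\<lambda>t. rot ?b ?b' t x) has_derivative (\<lambda>s. s *\<^sub>R v)) (at t)"
    unfolding rot_def v_def
    by (auto intro!: derivative_eq_intros simp: fun_eq_iff algebra_simps)
  have "((\<lambda>t. f (rot ?b ?b' t x)) has_derivative (\<lambda>s. pd (s *\<^sub>R v) f (rot ?b ?b' t x))) (at t)"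
    by (rule has_derivative_compose[OF d forms_has_derivative[OF f]])
  moreover have pds: "(\<lambda>s. pd (s *\<^sub>R v) f y) = (*) (pd v f y)" for y
    using linear_scale[OF pd_linear[OF f]] by (simp add: fun_eq_iff)
  have pdv: "pd v f y = (- sin t * (x \<bullet> ?b) - cos t * (x \<bullet> ?b')) * pd ?b f y
     + (cos t * (x \<bullet> ?b) - sin t * (x \<bullet> ?b')) * pd ?b' f y" for y
    unfolding v_def by (simp add: linear_add[OF pd_linear[OF f]] linear_scale[OF pd_linear[OF f]])
  have ri: "rot ?b ?b' t x $ i = cos t * (x \<bullet> ?b) - sin t * (x \<bullet> ?b')"
    "rot ?b ?b' t x $ j = sin t * (x \<bullet> ?b) + cos t * (x \<bullet> ?b')"
    using rot_inner[OF b, of t x] by (simp_all add: inner_axis)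
  have "pd v f (rot ?b ?b' t x) = rotgen i j f (rot ?b ?b' t x)"
    unfolding rotgen_def pdv ri by (simp add: algebra_simps)
  ultimately show ?thesis
    unfolding has_field_derivative_def pds by simp
qed

lemma sph_int_rot:
  fixes f :: "real^'n::finite \<Rightarrow> real"
  assumes f: "continuous_on UNIV f" and b: "b \<in> Basis" "b' \<in> Basis" "b \<noteq> b'" and t: "\<bar>t\<bar> < pi"
  shows "sph_int (\<lambda>x. f (rot b b' t x)) = sph_int f"
proof -
  let ?R = "rot b b' t"
  have R: "?R \<in> borel_measurable lborel" unfolding rot_def by measurable
  have "(\<integral>x. indicator (ball 0 1) x * f (x /\<^sub>R norm x) \<partial>lborel)
     = (\<integral>x. indicator (ball 0 1) x * f (x /\<^sub>R norm x) \<partial>distr lborel borel ?R)"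
    by (simp only: lborel_rot[OF b t])
  also have "\<dots> = (\<integral>x. indicator (ball 0 1) (?R x) * f (?R x /\<^sub>R norm (?R x)) \<partial>lborel)"
    using sph_measurable[OF f] R by (intro integral_distr) simp_all
  also have "\<dots> = (\<integral>x. indicator (ball 0 1) x * f (?R (x /\<^sub>R norm x)) \<partial>lborel)"
  proof (intro Bochner_Integration.integral_cong refl)
    fix x :: "real^'n"
    have "?R x /\<^sub>R norm (?R x) = ?R (x /\<^sub>R norm x)"
      unfolding norm_rot[OF b] by (simp add: rot_def algebra_simps)
    moreover have "indicator (ball 0 1) (?R x) = (indicator (ball 0 1) x :: real)"
      by (simp add: indicator_def norm_rot[OF b])
    ultimately show "indicator (ball 0 1) (?R x) * f (?R x /\<^sub>R norm (?R x)) =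
      indicator (ball 0 1) x * f (?R (x /\<^sub>R norm x))" by simp
  qed
  finally show ?thesis by (simp add: sph_int_eq)
qed

text \<open>Differentiate the rotation invariance at the identity.\<close>

lemma sph_int_rotgen:
  fixes f :: "real^'n::finite \<Rightarrow> real"
  assumes f: "f \<in> forms d"
  shows "sph_int (rotgen i j f) = 0"
proof (cases "i = j")
  case True
  then show ?thesis by (simp add: rotgen_def[abs_def])
next
  case False
  let ?b = "axis i 1 :: real^'n" and ?b' = "axis j 1 :: real^'n"
  let ?R = "rot ?b ?b'"
  have b: "?b \<in> Basis" "?b' \<in> Basis" "?b \<noteq> ?b'"
    using False by (auto simp: axis_eq_axis axis_in_Basis_iff)
  \<comment> \<open>A null sequence in (0, 1], hence within the range of angles for which invariance
    is available.\<close>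
  define t where "t n = inverse (real (Suc n))" for n
  have t: "t n > 0" "t n \<le> 1" for n
    by (auto simp: t_def field_simps)
  have t_pi: "\<bar>t n\<bar> < pi" for n
    using t[of n] pi_gt3 by simp
  define D where "D n x = (f (?R (t n) x) - f x) / t n" for n x
  have cL: "continuous_on UNIV (rotgen i j f)"
    by (rule forms_continuous[OF rotgen_forms[OF f]])
  have cR: "continuous_on UNIV (\<lambda>x. f (?R s x))" for s
    by (intro continuous_on_compose2[OF forms_continuous[OF f]]) (auto simp: rot_def intro!: continuous_intros)
  have cD: "continuous_on UNIV (D n)" for n
    unfolding D_def using t[of n] by (intro continuous_intros cR forms_continuous[OF f]) auto
  have R0: "?R 0 x = x" for x by (simp add: rot_def)
  obtain C where C: "C \<ge> 0" "\<And>x. \<bar>rotgen i j f (x /\<^sub>R norm x)\<bar> \<le> C"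
    by (rule sph_bounded[OF cL]) blast
  \<comment> \<open>By the mean value theorem a difference quotient is a value of the generator at
    another unit vector, so a single constant dominates all quotients.\<close>
  have bound: "\<bar>D n (x /\<^sub>R norm x)\<bar> \<le> C" for n x
  proof (cases "x = 0")
    case True
    then show ?thesis using C(1) by (simp add: D_def rot_def)
  next
    case False
    define y where "y = x /\<^sub>R norm x"
    have y: "norm y = 1" using False by (simp add: y_def)
    obtain s where s: "f (?R (t n) y) - f (?R 0 y) = (t n - 0) * rotgen i j f (?R s y)"
      using MVT2[of 0 "t n" "\<lambda>t. f (?R t y)" "\<lambda>s. rotgen i j f (?R s y)"] t[of n]
        rot_derivative[OF f \<open>i \<noteq> j\<close>] by blast
    then have "D n y = rotgen i j f (?R s y)"
      using t[of n] by (simp add: D_def R0)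
    moreover have "\<bar>rotgen i j f (?R s y)\<bar> \<le> C"
      using C(2)[of "?R s y"] by (simp add: norm_rot[OF b] y)
    ultimately show ?thesis by (simp add: y_def)
  qed
  have lim: "(\<lambda>n. D n x) \<longlonglongrightarrow> rotgen i j f x" for x
  proof -
    have "((\<lambda>t. (f (?R (0 + t) x) - f (?R 0 x)) / t) \<longlongrightarrow> rotgen i j f x) (at 0)"
      using rot_derivative[OF f False, of x 0] unfolding R0 DERIV_def by simp
    moreover have "filterlim t (at 0) sequentially"
      unfolding filterlim_at t_def using LIMSEQ_inverse_real_of_nat by simp
    ultimately show ?thesis
      unfolding D_def using filterlim_compose by (force simp: R0)
  qed
  have "sph_int (D n) = 0" for n
  proof -
    have "sph_int (D n) = sph_int (\<lambda>x. inverse (t n) * (f (?R (t n) x) - f x))"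
      by (simp add: D_def[abs_def] field_simps)
    also have "\<dots> = inverse (t n) * (sph_int (\<lambda>x. f (?R (t n) x)) - sph_int f)"
      by (simp only: sph_int_cmult sph_int_diff[OF cR forms_continuous[OF f]])
    finally show ?thesis by (simp add: sph_int_rot[OF forms_continuous[OF f] b t_pi])
  qed
  then have I0: "(\<integral>x. indicator (ball 0 1) x * D n (x /\<^sub>R norm x) \<partial>lborel) = 0" for n
    using ball_measure_pos[where 'n='n] by (simp add: sph_int_eq)
  have "(\<lambda>n. \<integral>x. indicator (ball 0 1) x * D n (x /\<^sub>R norm x) \<partial>lborel)
      \<longlonglongrightarrow> (\<integral>x. indicator (ball 0 1) x * rotgen i j f (x /\<^sub>R norm x) \<partial>lborel)"
  proof (rule integral_dominated_convergence[where w = "\<lambda>x. indicator (ball 0 1) x * C"])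
    show "AE x in lborel. (\<lambda>n. indicator (ball 0 1) x * D n (x /\<^sub>R norm x))
        \<longlonglongrightarrow> indicator (ball 0 1) x * rotgen i j f (x /\<^sub>R norm x)"
      by (intro AE_I2 tendsto_mult tendsto_const lim)
    show "AE x in lborel. norm (indicator (ball 0 1) x * D n (x /\<^sub>R norm x)) \<le> indicator (ball 0 1) x * C" for n
      by (intro AE_I2) (use bound in \<open>auto simp: indicator_def\<close>)
  qed (rule sph_measurable[OF cL] sph_measurable[OF cD] integrable_ball_const)+
  then have "(\<integral>x. indicator (ball 0 1) x * rotgen i j f (x /\<^sub>R norm x) \<partial>lborel) = 0"
    by (simp add: I0 LIMSEQ_const_iff)
  then show ?thesis by (simp add: sph_int_eq)
qed

lemma rotgen_mult:
  assumes "f \<in> forms a" "g \<in> forms b"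
  shows "rotgen i j (\<lambda>x. f x * g x) x = rotgen i j f x * g x + f x * rotgen i j g x"
  by (simp add: rotgen_def pd_mult[OF assms] algebra_simps)

lemma sph_int_rotgen_antisym:
  assumes "f \<in> forms a" "g \<in> forms b"
  shows "sph_int (\<lambda>x. rotgen i j f x * g x) = - sph_int (\<lambda>x. f x * rotgen i j g x)"
proof -
  have "0 = sph_int (\<lambda>x. rotgen i j f x * g x + f x * rotgen i j g x)"
    using sph_int_rotgen[OF forms_mult[OF assms], of i j] by (simp add: rotgen_mult[OF assms, abs_def])
  also have "\<dots> = sph_int (\<lambda>x. rotgen i j f x * g x) + sph_int (\<lambda>x. f x * rotgen i j g x)"
    using assms by (intro sph_int_add forms_continuous[where d = "a + b"] forms_mult rotgen_forms)
  finally show ?thesis by simp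
qed

text \<open>The Casimir operator of the rotation group is r^2 times the Laplacian minus E (E + n -
  2), where the Euler operator E is the scalar \<open>d\<close> on forms of degree \<open>d\<close>.
  The factor 2 arises because each plane is counted as \<open>(i, j)\<close> and as
  \<open>(j, i)\<close>.\<close>

lemma rotgen_casimir:
  fixes f :: "real^'n::finite \<Rightarrow> real"
  assumes f: "f \<in> forms d"
  shows "(\<Sum>i\<in>UNIV. \<Sum>j\<in>UNIV. rotgen i j (rotgen i j f) x) =
    2 * ((norm x)\<^sup>2 * laplacian f x - real d * (real d + real CARD('n) - 2) * f x)"
proof -
  define p where "p i = pd (axis i 1) f x" for i
  define q where "q i j = pd (axis i 1) (pd (axis j 1) f) x" for i j
  define \<delta> where "\<delta> i j = (if i = j then 1 else 0::real)" for i j :: 'n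
  have *: "pd (axis l 1) (rotgen i j f) x =
     x $ i * q l j + \<delta> l i * p j - (x $ j * q l i + \<delta> l j * p i)" for i j l
  proof -
    have "pd (axis l 1) (rotgen i j f) x = pd (axis l 1) (\<lambda>x. x $ i * pd (axis j 1) f x) x
        + pd (axis l 1) (\<lambda>x. -1 * (x $ j * pd (axis i 1) f x)) x"
      unfolding rotgen_def[abs_def]
      using pd_add[OF coord_mult_forms[OF pd_forms[OF f]] forms_scale[OF coord_mult_forms[OF pd_forms[OF f]]],
        of "axis l 1" i "axis j 1" "-1" j "axis i 1" x] by simp
    then show ?thesis
      unfolding pd_scale[OF coord_mult_forms[OF pd_forms[OF f]]]
      unfolding pd_coord_mult[OF pd_forms[OF f]]
      by (auto simp: q_def p_def \<delta>_def axis_def)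
  qed
  have "rotgen i j (rotgen i j f) x =
      (x $ i)\<^sup>2 * q j j + (x $ j)\<^sup>2 * q i i - x $ i * (x $ j * q j i) - x $ j * (x $ i * q i j)
      + \<delta> j i * (x $ i * p j) + \<delta> i j * (x $ j * p i) - x $ i * p i - x $ j * p j" for i j
    unfolding rotgen_def[of i j "rotgen i j f"] * by (simp add: \<delta>_def power2_eq_square algebra_simps)
  then have "(\<Sum>i\<in>UNIV. \<Sum>j\<in>UNIV. rotgen i j (rotgen i j f) x) =
      (\<Sum>i\<in>UNIV. (x $ i)\<^sup>2) * (\<Sum>j\<in>UNIV. q j j) + (\<Sum>j\<in>UNIV. (x $ j)\<^sup>2) * (\<Sum>i\<in>UNIV. q i i)
      - (\<Sum>i\<in>UNIV. x $ i * (\<Sum>j\<in>UNIV. x $ j * q j i)) - (\<Sum>j\<in>UNIV. x $ j * (\<Sum>i\<in>UNIV. x $ i * q i j))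
      + (\<Sum>i\<in>UNIV. x $ i * p i) + (\<Sum>i\<in>UNIV. x $ i * p i)
      - real CARD('n) * (\<Sum>i\<in>UNIV. x $ i * p i) - real CARD('n) * (\<Sum>j\<in>UNIV. x $ j * p j)"
  proof -
    have e1: "(\<Sum>i\<in>UNIV. \<Sum>j\<in>UNIV. x $ j * (x $ i * q i j)) = (\<Sum>j\<in>UNIV. x $ j * (\<Sum>i\<in>UNIV. x $ i * q i j))"
      by (subst sum.swap) (simp add: sum_distrib_left)
    have e2: "(\<Sum>i\<in>UNIV. \<Sum>j\<in>UNIV. (x $ j)\<^sup>2 * q i i) = (\<Sum>j\<in>UNIV. (x $ j)\<^sup>2) * (\<Sum>i\<in>UNIV. q i i)"
      by (subst sum.swap) (simp add: sum_product)
    have e3: "(\<Sum>i\<in>UNIV. \<Sum>j\<in>UNIV. \<delta> j i * (x $ i * p j)) = (\<Sum>i\<in>UNIV. x $ i * p i)"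
      "(\<Sum>i\<in>UNIV. \<Sum>j\<in>UNIV. \<delta> i j * (x $ j * p i)) = (\<Sum>i\<in>UNIV. x $ i * p i)"
      by (simp_all add: \<delta>_def if_distrib[of "\<lambda>c. c * _"] cong: if_cong)
    have e4: "(\<Sum>i\<in>UNIV. \<Sum>j\<in>UNIV. (x $ i)\<^sup>2 * q j j) = (\<Sum>i\<in>UNIV. (x $ i)\<^sup>2) * (\<Sum>j\<in>UNIV. q j j)"
      by (simp add: sum_product)
    have e5: "(\<Sum>i\<in>UNIV. \<Sum>j\<in>UNIV. x $ i * (x $ j * q j i)) = (\<Sum>i\<in>UNIV. x $ i * (\<Sum>j\<in>UNIV. x $ j * q j i))"
      by (simp add: sum_distrib_left)
    have e6: "(\<Sum>i\<in>UNIV. \<Sum>j\<in>(UNIV::'n set). x $ i * p i) = real CARD('n) * (\<Sum>i\<in>UNIV. x $ i * p i)"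
      "(\<Sum>i\<in>(UNIV::'n set). \<Sum>j\<in>UNIV. x $ j * p j) = real CARD('n) * (\<Sum>i\<in>UNIV. x $ i * p i)"
      by (simp_all add: sum_distrib_left)
    show ?thesis
      unfolding \<open>\<And>i j. rotgen i j (rotgen i j f) x = _\<close> sum.distrib sum_subtractf e1 e2 e3 e4 e5 e6 ..
  qed
  moreover have n: "(\<Sum>i\<in>UNIV. (x $ i)\<^sup>2) = (norm x)\<^sup>2"
    by (simp add: norm_vec_def L2_set_def sum_nonneg)
  moreover have "(\<Sum>j\<in>UNIV. q j j) = laplacian f x" by (simp add: laplacian_eq[OF f] q_def)
  moreover have E: "(\<Sum>i\<in>UNIV. x $ i * p i) = real d * f x"
    unfolding p_def by (simp add: pd_expand[OF f, symmetric] euler[OF f])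
  moreover have Q: "(\<Sum>j\<in>UNIV. x $ j * q j i) = real (d - 1) * p i" for i
    unfolding p_def q_def by (simp add: pd_expand[OF pd_forms[OF f], symmetric] euler[OF pd_forms[OF f]])
  moreover have "(\<Sum>i\<in>UNIV. x $ i * (real (d - 1) * p i)) = real (d - 1) * (real d * f x)"
    unfolding E[symmetric] by (simp add: sum_distrib_left algebra_simps)
  \<comment> \<open>The split on \<open>d\<close> is due to the truncated
    \<open>real (d - 1)\<close>.\<close>
  ultimately show ?thesis by (cases d) (simp_all add: algebra_simps)
qed

text \<open>On the sphere half the Casimir sum is the Laplacian minus a scalar depending only on the
  degree. It is self-adjoint, being a sum of squares of antisymmetric operators, so the two
  Laplacian integrals differ by the difference of the scalars.\<close>

lemma green:
  fixes f :: "real^'n::finite \<Rightarrow> real"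
  assumes f: "f \<in> forms a" and g: "g \<in> forms b"
  shows "sph_int (\<lambda>x. f x * laplacian g x) - sph_int (\<lambda>x. laplacian f x * g x) =
    (real b * (real b + real CARD('n) - 2) - real a * (real a + real CARD('n) - 2)) * sph_int (\<lambda>x. f x * g x)"
proof -
  let ?n = "real CARD('n)"
  have c: "h \<in> forms d \<Longrightarrow> h' \<in> forms d' \<Longrightarrow> continuous_on UNIV (\<lambda>x. h x * h' x)" for h h' d d'
    by (rule forms_continuous[OF forms_mult])
  have cas: "sph_int (\<lambda>x. h x * laplacian h' x) - real d' * (real d' + ?n - 2) * sph_int (\<lambda>x. h x * h' x)
      = (\<Sum>i\<in>UNIV. \<Sum>j\<in>UNIV. sph_int (\<lambda>x. h x * rotgen i j (rotgen i j h') x)) / 2"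
    if h: "h \<in> forms d" and h': "h' \<in> forms d'" for h h' :: "real^'n \<Rightarrow> real" and d d'
  proof -
    have "(\<Sum>i\<in>UNIV. \<Sum>j\<in>UNIV. sph_int (\<lambda>x. h x * rotgen i j (rotgen i j h') x))
       = sph_int (\<lambda>x. \<Sum>i\<in>UNIV. \<Sum>j\<in>UNIV. h x * rotgen i j (rotgen i j h') x)"
      by (subst sph_int_sum, intro continuous_on_sum c[OF h rotgen_forms[OF rotgen_forms[OF h']]],
          subst sph_int_sum, intro c[OF h rotgen_forms[OF rotgen_forms[OF h']]]) simp
    also have "\<dots> = sph_int (\<lambda>x. 2 * (h x * laplacian h' x - real d' * (real d' + ?n - 2) * (h x * h' x)))"
    proof (rule sph_int_cong)
      show "continuous_on UNIV (\<lambda>x. \<Sum>i\<in>UNIV. \<Sum>j\<in>UNIV. h x * rotgen i j (rotgen i j h') x)"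
        by (intro continuous_on_sum c[OF h rotgen_forms[OF rotgen_forms[OF h']]])
      show "continuous_on UNIV (\<lambda>x. 2 * (h x * laplacian h' x - real d' * (real d' + ?n - 2) * (h x * h' x)))"
        by (intro continuous_intros forms_continuous[OF h] forms_continuous[OF h'] forms_continuous[OF laplacian_forms[OF h']])
      fix x :: "real^'n" assume "norm x = 1"
      then show "(\<Sum>i\<in>UNIV. \<Sum>j\<in>UNIV. h x * rotgen i j (rotgen i j h') x) =
         2 * (h x * laplacian h' x - real d' * (real d' + ?n - 2) * (h x * h' x))"
        unfolding sum_distrib_left[symmetric] rotgen_casimir[OF h', of x]
        by (simp add: algebra_simps)
    qed
    also have "\<dots> = 2 * sph_int (\<lambda>x. h x * laplacian h' x - real d' * (real d' + ?n - 2) * (h x * h' x))"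
      by (rule sph_int_cmult)
    also have "sph_int (\<lambda>x. h x * laplacian h' x - real d' * (real d' + ?n - 2) * (h x * h' x)) =
        sph_int (\<lambda>x. h x * laplacian h' x) - sph_int (\<lambda>x. real d' * (real d' + ?n - 2) * (h x * h' x))"
      by (intro sph_int_diff continuous_intros forms_continuous[OF h] forms_continuous[OF h']
           forms_continuous[OF laplacian_forms[OF h']])
    also have "sph_int (\<lambda>x. real d' * (real d' + ?n - 2) * (h x * h' x)) = real d' * (real d' + ?n - 2) * sph_int (\<lambda>x. h x * h' x)"
      by (rule sph_int_cmult)
    finally show ?thesis by simp
  qed
  have "sph_int (\<lambda>x. f x * rotgen i j (rotgen i j g) x) = sph_int (\<lambda>x. g x * rotgen i j (rotgen i j f) x)" for i j
  proof -
    have "sph_int (\<lambda>x. f x * rotgen i j (rotgen i j g) x) = - sph_int (\<lambda>x. rotgen i j f x * rotgen i j g x)"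
      using sph_int_rotgen_antisym[OF f rotgen_forms[OF g], of i j i j] by simp
    also have "\<dots> = - sph_int (\<lambda>x. rotgen i j g x * rotgen i j f x)" by (simp add: mult.commute)
    also have "\<dots> = sph_int (\<lambda>x. g x * rotgen i j (rotgen i j f) x)"
      using sph_int_rotgen_antisym[OF g rotgen_forms[OF f], of i j i j] by simp
    finally show ?thesis .
  qed
  then show ?thesis using cas[OF f g] cas[OF g f] by (simp add: mult.commute algebra_simps)
qed

text \<open>Green's identity against the constant 1. It reduces the mean of a form to that of a form
  of lower degree, which drives the later inductions.\<close>

lemma sph_int_laplacian:
  fixes f :: "real^'n::finite \<Rightarrow> real"
  assumes f: "f \<in> forms d"
  shows "sph_int (laplacian f) = real d * (real d + real CARD('n) - 2) * sph_int f"
proof -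
  have "laplacian (\<lambda>x. 1 :: real) x = 0" for x :: "real^'n"
    using laplacian_low[OF forms_const] by simp
  then show ?thesis using green[OF forms_const[of 1] f] by simp
qed

section \<open>Orthonormal bases and reproducing kernels\<close>

text \<open>Instantiated twice: by forms of a fixed degree under \<open>ip\<close>, and by finite
  real sequences under the dot product. A carrier set is used because the forms of one degree are
  not a type.\<close>

locale inner_fun =
  fixes V :: "('a \<Rightarrow> real) set" and B :: "('a \<Rightarrow> real) \<Rightarrow> ('a \<Rightarrow> real) \<Rightarrow> real"
  assumes zero: "(\<lambda>x. 0) \<in> V"
    and add: "f \<in> V \<Longrightarrow> g \<in> V \<Longrightarrow> (\<lambda>x. f x + g x) \<in> V"
    and scale: "f \<in> V \<Longrightarrow> (\<lambda>x. c * f x) \<in> V"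
    and sym: "f \<in> V \<Longrightarrow> g \<in> V \<Longrightarrow> B f g = B g f"
    and B_add: "f \<in> V \<Longrightarrow> g \<in> V \<Longrightarrow> h \<in> V \<Longrightarrow> B (\<lambda>x. f x + g x) h = B f h + B g h"
    and B_scale: "f \<in> V \<Longrightarrow> h \<in> V \<Longrightarrow> B (\<lambda>x. c * f x) h = c * B f h"
    and pos: "f \<in> V \<Longrightarrow> f \<noteq> (\<lambda>x. 0) \<Longrightarrow> 0 < B f f"
begin

lemma B_zero: "h \<in> V \<Longrightarrow> B (\<lambda>x. 0) h = 0"
  using B_scale[OF zero, of h 0] by simp

lemma lincomb: "(\<And>i. i \<in> I \<Longrightarrow> f i \<in> V) \<Longrightarrow> (\<lambda>x. \<Sum>i\<in>I. c i * f i x) \<in> V"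
  by (induction I rule: infinite_finite_induct) (auto intro!: zero add scale)

lemma B_lincomb:
  assumes "h \<in> V" "\<And>i. i \<in> I \<Longrightarrow> f i \<in> V"
  shows "B (\<lambda>x. \<Sum>i\<in>I. c i * f i x) h = (\<Sum>i\<in>I. c i * B (f i) h)"
  using assms(2)
proof (induction I rule: infinite_finite_induct)
  case (insert i I)
  have "B (\<lambda>x. c i * f i x + (\<Sum>i\<in>I. c i * f i x)) h = B (\<lambda>x. c i * f i x) h + B (\<lambda>x. \<Sum>i\<in>I. c i * f i x) h"
    using insert.prems by (intro B_add scale lincomb assms(1)) auto
  then show ?case using insert by (simp add: B_scale assms(1))
qed (simp_all add: B_zero assms(1))

lemma diff: "f \<in> V \<Longrightarrow> g \<in> V \<Longrightarrow> (\<lambda>x. f x - g x) \<in> V"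
  using add[OF _ scale, of f g "-1"] by simp

lemma B_diff: "f \<in> V \<Longrightarrow> g \<in> V \<Longrightarrow> h \<in> V \<Longrightarrow> B (\<lambda>x. f x - g x) h = B f h - B g h"
  using B_add[OF _ scale, of f g h "-1"] B_scale[of g h "-1"] by simp

text \<open>Both directions of the base change are recorded: \<open>\<tau>\<close> is triangular
  with positive diagonal, which is what the volume computation consumes, and \<open>\<kappa>\<close>
  lets properties of the span of \<open>w\<close> pass to \<open>e\<close>.\<close>

lemma gram_schmidt:
  fixes m :: nat
  assumes "\<And>j. j < m \<Longrightarrow> w j \<in> V"
    and "\<And>u. (\<lambda>x. \<Sum>j<m. u j * w j x) = (\<lambda>x. 0) \<Longrightarrow> \<forall>j<m. u j = 0"
  shows "\<exists>e \<tau> \<kappa>. (\<forall>j<m. e j \<in> V) \<and> (\<forall>i<m. \<forall>j<m. B (e i) (e j) = (if i = j then 1 else 0)) \<and>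
    (\<forall>j<m. \<tau> j j > (0::real)) \<and> (\<forall>j<m. w j = (\<lambda>x. \<Sum>l\<le>j. \<tau> j l * e l x)) \<and>
    (\<forall>l<m. e l = (\<lambda>x. \<Sum>j<m. \<kappa> l j * w j x))"
  using assms
proof (induction m)
  case (Suc m)
  have ind: "\<forall>j<m. u j = 0" if "(\<lambda>x. \<Sum>j<m. u j * w j x) = (\<lambda>x. 0)" for u
  proof -
    have "(\<lambda>x. \<Sum>j<Suc m. (u(m := 0)) j * w j x) = (\<lambda>x. \<Sum>j<m. u j * w j x)"
      by (auto intro!: sum.cong)
    then have "\<forall>j<Suc m. (u(m := 0)) j = 0"
      using Suc.prems(2)[of "u(m := 0)"] that by simp
    then show ?thesis by (metis fun_upd_other less_irrefl less_SucI)
  qed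
  have wV: "w j \<in> V" if "j \<le> m" for j using Suc.prems(1) that by simp
  obtain e \<tau> \<kappa> where IH: "(\<forall>j<m. e j \<in> V)" "(\<forall>i<m. \<forall>j<m. B (e i) (e j) = (if i = j then 1 else 0))"
    "(\<forall>j<m. \<tau> j j > (0::real))" "(\<forall>j<m. w j = (\<lambda>x. \<Sum>l\<le>j. \<tau> j l * e l x))"
    "(\<forall>l<m. e l = (\<lambda>x. \<Sum>j<m. \<kappa> l j * w j x))"
    using Suc.IH[OF wV[OF less_imp_le] ind] by blast
  note eV = IH(1)[rule_format] and orth = IH(2)[rule_format] and \<kappa> = IH(5)[rule_format]
  note \<tau> = IH(3,4)[rule_format]
  define c where "c l = B (w m) (e l)" for l
  define q where "q = (\<lambda>x. \<Sum>l<m. c l * e l x)"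
  define p where "p = (\<lambda>x. w m x - q x)"
  \<comment> \<open>The coefficients of the projection \<open>q\<close> in the original vectors;
    \<open>p = 0\<close> would then be a linear relation with coefficient -1 at
    \<open>w m\<close>.\<close>
  define v where "v j = (\<Sum>l<m. c l * \<kappa> l j)" for j
  have q_alt: "q = (\<lambda>x. \<Sum>j<m. v j * w j x)"
  proof
    fix x
    have "q x = (\<Sum>l<m. c l * (\<Sum>j<m. \<kappa> l j * w j x))"
      unfolding q_def using \<kappa> by (metis (no_types, lifting) lessThan_iff sum.cong)
    also have "\<dots> = (\<Sum>l<m. \<Sum>j<m. c l * \<kappa> l j * w j x)" by (simp add: sum_distrib_left mult.assoc)
    also have "\<dots> = (\<Sum>j<m. \<Sum>l<m. c l * \<kappa> l j * w j x)" by (rule sum.swap)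
    finally show "q x = (\<Sum>j<m. v j * w j x)" by (simp add: v_def sum_distrib_right)
  qed
  have qV: "q \<in> V" unfolding q_def using eV by (intro lincomb) auto
  have pV: "p \<in> V" unfolding p_def using qV wV by (intro diff) auto
  have "p \<noteq> (\<lambda>x. 0)"
  proof
    assume p0: "p = (\<lambda>x. 0)"
    have "(\<lambda>x. \<Sum>j<Suc m. (if j = m then -1 else v j) * w j x) = (\<lambda>x. - p x)"
      by (auto simp: p_def q_alt)
    then have "\<forall>j<Suc m. (if j = m then -1 else v j) = 0"
      using Suc.prems(2)[of "\<lambda>j. if j = m then -1 else v j"] p0 by simp
    then show False by auto
  qed
  define s where "s = sqrt (B p p)"
  have s: "s > 0" "s * s = B p p" using pos[OF pV \<open>p \<noteq> _\<close>] by (auto simp: s_def)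
  have pe: "B p (e j) = 0" if "j < m" for j
  proof -
    have "B q (e j) = (\<Sum>l<m. c l * B (e l) (e j))"
      unfolding q_def using eV that by (intro B_lincomb) auto
    also have "\<dots> = (\<Sum>l<m. if l = j then c l else 0)"
      using orth that by (intro sum.cong) auto
    also have "\<dots> = c j" using that by simp
    finally show ?thesis
      unfolding p_def using B_diff[OF wV qV eV[OF that]] by (simp add: c_def)
  qed
  define e' where "e' = e(m := (\<lambda>x. (1 / s) * p x))"
  define \<tau>' where "\<tau>' = \<tau>(m := (\<lambda>l. if l = m then s else c l))"
  define \<kappa>' where "\<kappa>' l j = (if l = m then (if j = m then 1 / s else - v j / s) else if j = m then 0 else \<kappa> l j)" for l j
  have spV: "(\<lambda>x. (1 / s) * p x) \<in> V" using pV by (rule scale)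
  then have "\<forall>j<Suc m. e' j \<in> V" using eV by (auto simp: e'_def less_Suc_eq)
  moreover have "B (e' i) (e' j) = (if i = j then 1 else 0)" if ij: "i < Suc m" "j < Suc m" for i j
  proof -
    consider "i < m" "j < m" | "i = m" "j < m" | "i < m" "j = m" | "i = m" "j = m"
      using ij by linarith
    then show ?thesis
    proof cases
      case 1 then show ?thesis using orth by (simp add: e'_def)
    next
      case 2 then show ?thesis using B_scale[OF pV eV[of j], of "1 / s"] pe by (simp add: e'_def)
    next
      case 3
      have "B (e i) (\<lambda>x. (1 / s) * p x) = B (\<lambda>x. (1 / s) * p x) (e i)"
        by (rule sym[OF eV[OF 3(1)] spV])
      also have "\<dots> = 0" unfolding B_scale[OF pV eV[OF 3(1)]] pe[OF 3(1)] by simp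
      finally show ?thesis using 3 unfolding e'_def by simp
    next
      case 4
      have "B (\<lambda>x. (1 / s) * p x) (\<lambda>x. (1 / s) * p x) = (1 / s) * ((1 / s) * B p p)"
        unfolding B_scale[OF pV spV] sym[OF pV spV] B_scale[OF pV pV] ..
      also have "\<dots> = 1" using s(1) unfolding s(2)[symmetric] by simp
      finally show ?thesis using 4 unfolding e'_def by simp
    qed
  qed
  moreover have "\<forall>j<Suc m. \<tau>' j j > 0" using \<tau> s by (auto simp: \<tau>'_def less_Suc_eq)
  moreover have "w j = (\<lambda>x. \<Sum>l\<le>j. \<tau>' j l * e' l x)" if "j < Suc m" for j
  proof (cases "j = m")
    case True
    have "(\<Sum>l\<le>m. \<tau>' m l * e' l x) = (\<Sum>l<m. c l * e l x) + s * ((1 / s) * p x)" for x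
      by (simp add: lessThan_Suc_atMost[symmetric] \<tau>'_def e'_def)
    then show ?thesis using True s by (auto simp: p_def q_def)
  next
    case False
    then have j: "j < m" using that by simp
    then have "(\<Sum>l\<le>j. \<tau>' j l * e' l x) = (\<Sum>l\<le>j. \<tau> j l * e l x)" for x
      by (intro sum.cong) (auto simp: \<tau>'_def e'_def)
    then show ?thesis using \<tau>(2)[OF j] by simp
  qed
  moreover have "e' l = (\<lambda>x. \<Sum>j<Suc m. \<kappa>' l j * w j x)" if "l < Suc m" for l
  proof (cases "l = m")
    case True
    have "(\<Sum>j<Suc m. \<kappa>' m j * w j x) = (1 / s) * (w m x - (\<Sum>j<m. v j * w j x))" for x
      by (simp add: \<kappa>'_def sum_distrib_left right_diff_distrib sum_negf)
    then show ?thesis using True by (simp add: e'_def p_def q_alt)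
  next
    case False
    then have "e' l = (\<lambda>x. \<Sum>j<m. \<kappa> l j * w j x)" using that \<kappa> by (simp add: e'_def)
    also have "\<dots> = (\<lambda>x. \<Sum>j<Suc m. \<kappa>' l j * w j x)" using False by (simp add: \<kappa>'_def)
    finally show ?thesis .
  qed
  ultimately show ?case by blast
qed simp

lemma expansion_coeff:
  fixes m :: nat
  assumes "\<And>j. j < m \<Longrightarrow> e j \<in> V" "\<And>i j. i < m \<Longrightarrow> j < m \<Longrightarrow> B (e i) (e j) = (if i = j then 1 else 0)"
    and "f = (\<lambda>x. \<Sum>l<m. u l * e l x)" "j < m"
  shows "B f (e j) = u j"
proof -
  have "B f (e j) = (\<Sum>l<m. u l * B (e l) (e j))"
    unfolding assms(3) using assms by (intro B_lincomb) auto
  also have "\<dots> = (\<Sum>l<m. if l = j then u l else 0)"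
    using assms by (intro sum.cong) auto
  finally show ?thesis using assms(4) by simp
qed

end

section \<open>Forms of one degree as an inner product space of dimension
  \<open>Ddim\<close>\<close>

lemma ip_sym: "ip f g = ip g f"
  by (simp add: ip_def mult.commute)

lemma inner_fun_forms: "inner_fun (forms d :: (real^'n::finite \<Rightarrow> real) set) ip"
proof
  fix f g h :: "real^'n \<Rightarrow> real" and c :: real
  show "f \<in> forms d \<Longrightarrow> g \<in> forms d \<Longrightarrow> h \<in> forms d \<Longrightarrow> ip (\<lambda>x. f x + g x) h = ip f h + ip g h"
    unfolding ip_def distrib_right by (intro sph_int_add forms_continuous[OF forms_mult])
  show "ip (\<lambda>x. c * f x) h = c * ip f h"
    unfolding ip_def mult.assoc by (rule sph_int_cmult)
  assume f: "f \<in> forms d" "f \<noteq> (\<lambda>x. 0)"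
  then obtain u where "norm u = 1" "f u \<noteq> 0"
    using forms_eq_on_sphere[OF f(1) forms_zero] by auto
  then show "0 < ip f f" unfolding ip_def
    by (intro sph_int_pos[of _ u] forms_continuous[OF forms_mult[OF f(1) f(1)]]) auto
qed (auto simp: ip_sym)

lemma ip_pos_def: "f \<in> forms d \<Longrightarrow> ip f f = 0 \<Longrightarrow> f = (\<lambda>x::real^'n::finite. 0)"
  using inner_fun.pos[OF inner_fun_forms, of f d] by auto

lemma ip_cong_sphere:
  assumes "f \<in> forms a" "f' \<in> forms a'" "g \<in> forms b" "g' \<in> forms b'"
    and "\<And>x::real^'n::finite. norm x = 1 \<Longrightarrow> f x = f' x" "\<And>x. norm x = 1 \<Longrightarrow> g x = g' x"
  shows "ip f g = ip f' g'"
  unfolding ip_def using assms by (intro sph_int_cong forms_continuous[OF forms_mult]) auto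

lemma pd_monomial:
  "pd (axis i 1) (monomial \<alpha>) x = real (\<alpha> i) * monomial (\<alpha>(i := \<alpha> i - 1)) (x :: real^'n::finite)"
proof (rule pd_eqI)
  define P where "P = (\<Prod>j\<in>UNIV - {i}. (x $ j) ^ \<alpha> j)"
  have "monomial \<alpha> (x + t *\<^sub>R axis i 1) = (x $ i + t) ^ \<alpha> i * P" for t
  proof -
    have "monomial \<alpha> (x + t *\<^sub>R axis i 1) = (x $ i + t) ^ \<alpha> i * (\<Prod>j\<in>UNIV - {i}. ((x + t *\<^sub>R axis i 1) $ j) ^ \<alpha> j)"
      unfolding monomial_def by (subst prod.remove[of _ i]) auto
    also have "(\<Prod>j\<in>UNIV - {i}. ((x + t *\<^sub>R axis i 1) $ j) ^ \<alpha> j) = P"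
      unfolding P_def by (intro prod.cong) (auto simp: axis_def)
    finally show ?thesis .
  qed
  moreover have "((\<lambda>t. (x $ i + t) ^ \<alpha> i * P) has_field_derivative real (\<alpha> i) * ((x $ i) ^ (\<alpha> i - 1) * P)) (at 0)"
    by (auto intro!: derivative_eq_intros)
  moreover have "monomial (\<alpha>(i := \<alpha> i - 1)) x = (x $ i) ^ (\<alpha> i - 1) * P"
    unfolding monomial_def P_def by (subst prod.remove[of _ i]) (auto intro!: prod.cong)
  ultimately show "((\<lambda>t. monomial \<alpha> (x + t *\<^sub>R axis i 1)) has_real_derivative
      real (\<alpha> i) * monomial (\<alpha>(i := \<alpha> i - 1)) x) (at 0)" by simp
qed

text \<open>Differentiating along an axis \<open>i\<close> with \<open>\<alpha> i > 0\<close> kills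
  the monomials free of that coordinate and maps the others injectively, with nonzero factors, to
  monomials of degree \<open>d\<close>.\<close>

lemma monomials_independent:
  assumes "(\<lambda>x::real^'n::finite. \<Sum>\<alpha>\<in>exps d. c \<alpha> * monomial \<alpha> x) = (\<lambda>x. 0)" "\<alpha> \<in> exps d"
  shows "c \<alpha> = 0"
  using assms
proof (induction d arbitrary: c \<alpha>)
  case 0
  then have "c (\<lambda>_. 0) = 0" by (simp add: exps_0 monomial_def fun_eq_iff)
  then show ?case using 0(2) by (simp add: exps_0)
next
  case (Suc d)
  have "sum \<alpha> UNIV = Suc d" using Suc.prems by (simp add: exps_def)
  then obtain i where i: "\<alpha> i > 0"
    by (metis gr0I sum.neutral zero_less_Suc less_irrefl)
  \<comment> \<open>Raising the exponent at \<open>i\<close> matches the monomials of degree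
    \<open>d\<close> with those that survive differentiation.\<close>
  define up where "up \<beta> = \<beta>(i := Suc (\<beta> i))" for \<beta> :: "'n \<Rightarrow> nat"
  have card_up: "sum (up \<beta>) UNIV = Suc (sum \<beta> UNIV)" for \<beta>
  proof -
    have "sum (up \<beta>) UNIV = Suc (\<beta> i) + sum (up \<beta>) (UNIV - {i})"
      by (subst sum.remove[of _ i]) (auto simp: up_def)
    also have "sum (up \<beta>) (UNIV - {i}) = sum \<beta> (UNIV - {i})" by (intro sum.cong) (auto simp: up_def)
    also have "Suc (\<beta> i) + sum \<beta> (UNIV - {i}) = Suc (sum \<beta> UNIV)" by (subst (2) sum.remove[of _ i]) auto
    finally show ?thesis .
  qed
  have inj: "inj_on up (exps d)"
  proof (rule inj_onI)
    fix \<beta> \<gamma> :: "'n \<Rightarrow> nat" assume "up \<beta> = up \<gamma>"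
    then show "\<beta> = \<gamma>" unfolding up_def by (metis fun_upd_triv fun_upd_upd fun_upd_same nat.inject)
  qed
  have img: "up ` exps d = {\<gamma> \<in> exps (Suc d). \<gamma> i > 0}"
  proof
    show "up ` exps d \<subseteq> {\<gamma> \<in> exps (Suc d). \<gamma> i > 0}" by (auto simp: exps_def card_up) (simp add: up_def)
    show "{\<gamma> \<in> exps (Suc d). \<gamma> i > 0} \<subseteq> up ` exps d"
    proof
      fix \<gamma> :: "'n \<Rightarrow> nat" assume g: "\<gamma> \<in> {\<gamma> \<in> exps (Suc d). \<gamma> i > 0}"
      then have e: "up (\<gamma>(i := \<gamma> i - 1)) = \<gamma>" by (auto simp: up_def)
      then have "\<gamma>(i := \<gamma> i - 1) \<in> exps d"
        using g card_up[of "\<gamma>(i := \<gamma> i - 1)"] by (simp add: exps_def)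
      then show "\<gamma> \<in> up ` exps d" using e by force
    qed
  qed
  have "(\<Sum>\<beta>\<in>exps d. (c (up \<beta>) * real (up \<beta> i)) * monomial \<beta> x) = 0" for x :: "real^'n"
  proof -
    have "0 = pd (axis i 1) (\<lambda>x::real^'n. \<Sum>\<alpha>\<in>exps (Suc d). c \<alpha> * monomial \<alpha> x) x"
      unfolding Suc.prems(1) by simp
    also have "\<dots> = (\<Sum>\<gamma>\<in>exps (Suc d). c \<gamma> * (real (\<gamma> i) * monomial (\<gamma>(i := \<gamma> i - 1)) x))"
      by (subst pd_sum[where d = "Suc d"])
         (auto intro!: forms_scale monomial_forms sum.cong simp: pd_scale[OF monomial_forms] pd_monomial)
    also have "\<dots> = (\<Sum>\<gamma>\<in>{\<gamma> \<in> exps (Suc d). \<gamma> i > 0}. c \<gamma> * (real (\<gamma> i) * monomial (\<gamma>(i := \<gamma> i - 1)) x))"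
      by (rule sum.mono_neutral_right) (auto simp: finite_exps)
    also have "\<dots> = (\<Sum>\<beta>\<in>exps d. c (up \<beta>) * (real (up \<beta> i) * monomial ((up \<beta>)(i := up \<beta> i - 1)) x))"
      unfolding img[symmetric] by (rule sum.reindex_cong[OF inj]) auto
    also have "\<dots> = (\<Sum>\<beta>\<in>exps d. (c (up \<beta>) * real (up \<beta> i)) * monomial \<beta> x)"
      by (intro sum.cong) (auto simp: up_def)
    finally show ?thesis by simp
  qed
  then have z: "\<beta> \<in> exps d \<Longrightarrow> c (up \<beta>) * real (up \<beta> i) = 0" for \<beta>
    using Suc.IH[of "\<lambda>\<beta>. c (up \<beta>) * real (up \<beta> i)"] by blast
  have "\<alpha> \<in> up ` exps d" using img i Suc.prems(2) by blast
  then show ?case using z by (auto simp: up_def)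
qed

text \<open>Stars and bars: enumerating the index type turns exponents into lists of given length
  and sum.\<close>

lemma card_exps: "card (exps d :: ('n::finite \<Rightarrow> nat) set) = Ddim CARD('n) d"
proof -
  obtain xs :: "'n list" where xs: "distinct xs" "set xs = UNIV"
    using finite_distinct_list[of "UNIV :: 'n set"] by auto
  have len: "length xs = CARD('n)" using xs distinct_card by fastforce
  have "bij_betw (\<lambda>\<alpha>. map \<alpha> xs) (exps d) {l. length l = CARD('n) \<and> sum_list l = d}"
  proof (rule bij_betw_imageI)
    show "inj_on (\<lambda>\<alpha>. map \<alpha> xs) (exps d)"
      using xs by (auto intro!: inj_onI)
    show "(\<lambda>\<alpha>. map \<alpha> xs) ` exps d = {l. length l = CARD('n) \<and> sum_list l = d}"
    proof (intro set_eqI iffI)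
      fix l assume "l \<in> (\<lambda>\<alpha>. map \<alpha> xs) ` exps d"
      then show "l \<in> {l. length l = CARD('n) \<and> sum_list l = d}"
        using xs len by (auto simp: exps_def sum_list_distinct_conv_sum_set)
    next
      fix l :: "nat list" assume l: "l \<in> {l. length l = CARD('n) \<and> sum_list l = d}"
      define \<alpha> where "\<alpha> x = (the (map_of (zip xs l) x))" for x
      have "map \<alpha> xs = l"
        using l len xs by (intro nth_equalityI) (auto simp: \<alpha>_def map_of_zip_nth)
      moreover from this have "\<alpha> \<in> exps d"
        using l xs(2) sum_list_distinct_conv_sum_set[OF xs(1), of \<alpha>] by (simp add: exps_def)
      ultimately show "l \<in> (\<lambda>\<alpha>. map \<alpha> xs) ` exps d" by blast
    qed
  qed
  then have "card (exps d :: ('n \<Rightarrow> nat) set) = card {l::nat list. length l = CARD('n) \<and> sum_list l = d}"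
    by (rule bij_betw_same_card)
  then show ?thesis using card_length_sum_list[of "CARD('n)" d] by (simp add: Ddim_def add.commute)
qed

text \<open>Gram--Schmidt applied to an enumeration of the monomials; re-expanding the monomials
  through \<open>\<tau>\<close> shows completeness.\<close>

lemma ex_onb:
  "\<exists>e. (\<forall>j<Ddim CARD('n) d. e j \<in> forms d) \<and>
    (\<forall>i<Ddim CARD('n) d. \<forall>j<Ddim CARD('n) d. ip (e i) (e j) = (if i = j then 1 else 0)) \<and>
    (\<forall>f\<in>forms d. f = (\<lambda>x::real^'n::finite. \<Sum>j<Ddim CARD('n) d. ip f (e j) * e j x))"
proof -
  let ?N = "Ddim CARD('n) d"
  interpret inner_fun "forms d :: (real^'n \<Rightarrow> real) set" ip by (rule inner_fun_forms)
  obtain h where h: "bij_betw h {..<?N} (exps d :: ('n \<Rightarrow> nat) set)"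
    using ex_bij_betw_nat_finite[of "exps d :: ('n \<Rightarrow> nat) set"] finite_exps
    by (auto simp: card_exps lessThan_atLeast0)
  define w where "w j = (monomial (h j) :: real^'n \<Rightarrow> real)" for j
  have wV: "w j \<in> forms d" if "j < ?N" for j
    unfolding w_def using h that by (intro monomial_forms) (auto dest: bij_betwE)
  have reidx: "(\<Sum>\<alpha>\<in>exps d. c \<alpha> * monomial \<alpha> x) = (\<Sum>j<?N. c (h j) * w j x)" for c and x :: "real^'n"
    unfolding w_def by (rule sum.reindex_bij_betw[OF h, symmetric])
  have ind: "\<forall>j<?N. u j = 0" if "(\<lambda>x. \<Sum>j<?N. u j * w j x) = (\<lambda>x. 0)" for u
  proof -
    define c where "c = u \<circ> the_inv_into {..<?N} h"
    have c: "c (h j) = u j" if "j < ?N" for j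
      unfolding c_def o_def using h that by (subst the_inv_into_f_f) (auto simp: bij_betw_def)
    have z: "(\<lambda>x. \<Sum>\<alpha>\<in>exps d. c \<alpha> * monomial \<alpha> x) = (\<lambda>x::real^'n. 0)"
      unfolding reidx that[symmetric] using c by (intro ext sum.cong) auto
    then have "c (h j) = 0" if "j < ?N" for j
      using monomials_independent[OF z] h that by (auto dest: bij_betwE)
    then show ?thesis using c by simp
  qed
  obtain e \<tau> \<kappa> where e: "\<forall>j<?N. e j \<in> forms d" "\<forall>i<?N. \<forall>j<?N. ip (e i) (e j) = (if i = j then 1 else 0)"
    and \<tau>: "\<forall>j<?N. w j = (\<lambda>x. \<Sum>l\<le>j. \<tau> j l * e l x)"
    using gram_schmidt[of ?N w, OF wV ind] by blast
  have "f = (\<lambda>x. \<Sum>j<?N. ip f (e j) * e j x)" if ff: "f \<in> forms d" for f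
  proof -
    obtain c where f: "f = (\<lambda>x. \<Sum>\<alpha>\<in>exps d. c \<alpha> * monomial \<alpha> x)"
      using ff unfolding forms_def by blast
    define u where "u l = (\<Sum>j<?N. if l \<le> j then c (h j) * \<tau> j l else 0)" for l
    have fe: "f = (\<lambda>x. \<Sum>l<?N. u l * e l x)"
    proof
      fix x
      have "f x = (\<Sum>j<?N. c (h j) * (\<Sum>l\<le>j. \<tau> j l * e l x))"
        unfolding f reidx using \<tau> by (intro sum.cong) auto
      also have "\<dots> = (\<Sum>j<?N. \<Sum>l<?N. (if l \<le> j then c (h j) * \<tau> j l else 0) * e l x)"
      proof (intro sum.cong refl)
        fix j assume "j \<in> {..<?N}"
        then have "(\<Sum>l\<le>j. c (h j) * (\<tau> j l * e l x)) = (\<Sum>l<?N. (if l \<le> j then c (h j) * \<tau> j l else 0) * e l x)"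
          by (intro sum.mono_neutral_cong_left) auto
        then show "c (h j) * (\<Sum>l\<le>j. \<tau> j l * e l x) = (\<Sum>l<?N. (if l \<le> j then c (h j) * \<tau> j l else 0) * e l x)"
          by (simp add: sum_distrib_left)
      qed
      also have "\<dots> = (\<Sum>l<?N. \<Sum>j<?N. (if l \<le> j then c (h j) * \<tau> j l else 0) * e l x)" by (rule sum.swap)
      finally show "f x = (\<Sum>l<?N. u l * e l x)" by (simp add: u_def sum_distrib_right)
    qed
    have "ip f (e j) = u j" if "j < ?N" for j
      using expansion_coeff[OF _ _ fe that] e by blast
    then show ?thesis using fe by simp
  qed
  then show ?thesis using e by blast
qed

section \<open>Reproducing kernels\<close>

definition onb :: "nat \<Rightarrow> nat \<Rightarrow> real^'n::finite \<Rightarrow> real" where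
  "onb d = (SOME e. (\<forall>j<Ddim CARD('n) d. e j \<in> forms d) \<and>
    (\<forall>i<Ddim CARD('n) d. \<forall>j<Ddim CARD('n) d. ip (e i) (e j) = (if i = j then 1 else 0)) \<and>
    (\<forall>f\<in>forms d. f = (\<lambda>x::real^'n::finite. \<Sum>j<Ddim CARD('n) d. ip f (e j) * e j x)))"

lemma onb:
  fixes f :: "real^'n::finite \<Rightarrow> real"
  shows "j < Ddim CARD('n) d \<Longrightarrow> (onb d j :: real^'n \<Rightarrow> real) \<in> forms d"
    and "i < Ddim CARD('n) d \<Longrightarrow> j < Ddim CARD('n) d \<Longrightarrow>
      ip (onb d i) (onb d j :: real^'n \<Rightarrow> real) = (if i = j then 1 else 0)"
    and "f \<in> forms d \<Longrightarrow> f x = (\<Sum>j<Ddim CARD('n) d. ip f (onb d j) * onb d j x)"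
proof -
  note * = someI_ex[OF ex_onb[of d, where 'n = 'n], folded onb_def]
  show "j < Ddim CARD('n) d \<Longrightarrow> (onb d j :: real^'n \<Rightarrow> real) \<in> forms d" using * by blast
  show "i < Ddim CARD('n) d \<Longrightarrow> j < Ddim CARD('n) d \<Longrightarrow>
      ip (onb d i) (onb d j :: real^'n \<Rightarrow> real) = (if i = j then 1 else 0)" using * by blast
  show "f \<in> forms d \<Longrightarrow> f x = (\<Sum>j<Ddim CARD('n) d. ip f (onb d j) * onb d j x)" using * by metis
qed

text \<open>Independent of the chosen basis by \<open>zkern_unique\<close>, which is what allows a
  kernel to be compared with its rotated copies.\<close>

definition zkern :: "nat \<Rightarrow> real^'n::finite \<Rightarrow> real^'n \<Rightarrow> real" where
  "zkern d v = (\<lambda>y. \<Sum>j<Ddim CARD('n) d. onb d j v * onb d j y)"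

lemma zkern_forms: "zkern d v \<in> forms d"
  unfolding zkern_def by (intro forms_sum forms_scale onb) auto

lemma zkern_reproducing:
  fixes g :: "real^'n::finite \<Rightarrow> real"
  assumes "g \<in> forms d" shows "ip (zkern d v) g = g v"
proof -
  interpret inner_fun "forms d :: (real^'n \<Rightarrow> real) set" ip by (rule inner_fun_forms)
  have "ip (zkern d v) g = (\<Sum>j<Ddim CARD('n) d. onb d j v * ip (onb d j) g)"
    unfolding zkern_def using assms onb(1) by (intro B_lincomb) auto
  then show ?thesis using onb(3)[OF assms, of v] by (simp add: ip_sym[of g] mult.commute)
qed

lemma zkern_unique:
  assumes "z \<in> forms d" "\<And>g. g \<in> forms d \<Longrightarrow> ip z g = g v"
  shows "z = zkern d (v :: real^'n::finite)"
proof -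
  interpret inner_fun "forms d :: (real^'n \<Rightarrow> real) set" ip by (rule inner_fun_forms)
  have "ip (\<lambda>x. z x - zkern d v x) (\<lambda>x. z x - zkern d v x) = 0"
    using assms by (subst B_diff) (auto simp: zkern_forms zkern_reproducing forms_diff)
  then have "(\<lambda>x. z x - zkern d v x) = (\<lambda>x. 0)"
    using assms by (intro ip_pos_def[of _ d]) (auto simp: zkern_forms forms_diff)
  then show ?thesis by (simp add: fun_eq_iff)
qed

text \<open>The integral is the trace of the identity on \<open>forms d\<close>.\<close>

lemma sph_int_zkern_diag: "sph_int (\<lambda>v::real^'n::finite. zkern d v v) = real (Ddim CARD('n) d)"
proof -
  have "sph_int (\<lambda>v::real^'n. zkern d v v) = (\<Sum>j<Ddim CARD('n) d. ip (onb d j) (onb d j :: real^'n \<Rightarrow> real))"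
    unfolding zkern_def ip_def
    by (intro sph_int_sum forms_continuous[OF forms_mult[OF onb(1) onb(1)]]) auto
  then show ?thesis by (simp add: onb(2))
qed

section \<open>Invariance under the orthogonal group\<close>

lemma pd_compose_linear: "linear U \<Longrightarrow> pd v (\<lambda>x. f (U x)) x = pd (U v) f (U x)"
  by (simp add: pd_def linear_add linear_scale)

lemma laplacian_compose_orthogonal:
  fixes f :: "real^'n::finite \<Rightarrow> real"
  assumes f: "f \<in> forms d" and U: "orthogonal_transformation (U :: real^'n \<Rightarrow> real^'n)"
  shows "laplacian (\<lambda>x. f (U x)) x = laplacian f (U x)"
proof -
  have lin: "linear U" using U orthogonal_transformation_linear by blast
  define W where "W = inv U"
  have W: "orthogonal_transformation W" unfolding W_def by (rule orthogonal_transformation_inv[OF U])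
  have UW: "U (W y) = y" for y
    unfolding W_def using orthogonal_transformation_surj[OF U] by (rule surj_f_inv_f)
  have adj: "U x \<bullet> y = x \<bullet> W y" for x y
    using U UW[of y] unfolding orthogonal_transformation_def by metis
  define q where "q a b = pd (axis a 1) (pd (axis b 1) f) (U x)" for a b
  have "pd w (pd w f) (U x) = (\<Sum>a\<in>UNIV. \<Sum>b\<in>UNIV. w $ a * w $ b * q a b)" for w
  proof -
    have "pd w f = (\<lambda>x. \<Sum>b\<in>UNIV. w $ b * pd (axis b 1) f x)"
      using pd_expand[OF f] by blast
    then have "pd (axis a 1) (pd w f) (U x) = (\<Sum>b\<in>UNIV. w $ b * q a b)" for a
      using pd_sum[of UNIV "\<lambda>b x. w $ b * pd (axis b 1) f x" "d - 1" "axis a 1" "U x",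
          OF forms_scale[OF pd_forms[OF f]]]
      by (simp add: pd_scale[OF pd_forms[OF f]] q_def)
    then show ?thesis
      unfolding pd_expand[OF pd_forms[OF f], of w w] by (simp add: sum_distrib_left mult.assoc)
  qed
  then have "laplacian (\<lambda>x. f (U x)) x = (\<Sum>i\<in>UNIV. \<Sum>a\<in>UNIV. \<Sum>b\<in>UNIV. U (axis i 1) $ a * U (axis i 1) $ b * q a b)"
    unfolding laplacian_eq[OF forms_compose_linear[OF f lin]]
    by (simp add: pd_compose_linear[OF lin, abs_def])
  also have "\<dots> = (\<Sum>a\<in>UNIV. \<Sum>b\<in>UNIV. (\<Sum>i\<in>UNIV. U (axis i 1) $ a * U (axis i 1) $ b) * q a b)"
    by (subst sum.swap, rule sum.cong[OF refl], subst sum.swap) (simp add: sum_distrib_right)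
  also have "\<dots> = (\<Sum>a\<in>UNIV. \<Sum>b\<in>UNIV. (if a = b then 1 else 0) * q a b)"
  proof (intro sum.cong refl)
    fix a b
    have "U (axis i 1) $ a = W (axis a 1) $ i" for i a
      using adj[of "axis i 1" "axis a 1"] by (simp add: inner_axis inner_axis')
    then have "(\<Sum>i\<in>UNIV. U (axis i 1) $ a * U (axis i 1) $ b) = W (axis a 1) \<bullet> W (axis b 1)"
      by (simp add: inner_vec_def)
    also have "\<dots> = axis a 1 \<bullet> (axis b 1 :: real^'n)" using W unfolding orthogonal_transformation_def by blast
    finally have "(\<Sum>i\<in>UNIV. U (axis i 1) $ a * U (axis i 1) $ b) = (if a = b then 1 else 0)"
      by (simp add: inner_axis_axis)
    then show "(\<Sum>i\<in>UNIV. U (axis i 1) $ a * U (axis i 1) $ b) * q a b = (if a = b then 1 else 0) * q a b"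
      by simp
  qed
  finally show ?thesis
    by (simp add: laplacian_eq[OF f] q_def if_distrib[of "\<lambda>c. c * _"] cong: if_cong)
qed

text \<open>The Laplacian commutes with \<open>U\<close> and lowers the degree, so
  \<open>sph_int_laplacian\<close> reduces the claim to smaller degrees. Dividing by d (d + n - 2)
  requires the bound on the dimension: this factor is 0 for n = d = 1.\<close>

lemma sph_int_orthogonal:
  fixes f :: "real^'n::finite \<Rightarrow> real"
  assumes "CARD('n) \<ge> 2" "f \<in> forms d" "orthogonal_transformation (U :: real^'n \<Rightarrow> real^'n)"
  shows "sph_int (\<lambda>x. f (U x)) = sph_int f"
  using assms(2)
proof (induction d arbitrary: f rule: less_induct)
  case (less d)
  have lin: "linear U" using assms(3) orthogonal_transformation_linear by blast
  show ?case
  proof (cases "d = 0")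
    case True
    then show ?thesis using less.prems forms_0D by fastforce
  next
    case False
    have "real d * (real d + real CARD('n) - 2) * sph_int (\<lambda>x. f (U x)) = sph_int (laplacian (\<lambda>x. f (U x)))"
      by (simp add: sph_int_laplacian[OF forms_compose_linear[OF less.prems lin]])
    also have "laplacian (\<lambda>x. f (U x)) = (\<lambda>x. laplacian f (U x))"
      using laplacian_compose_orthogonal[OF less.prems assms(3)] by blast
    also have "sph_int (\<lambda>x. laplacian f (U x)) = sph_int (laplacian f)"
      using False by (intro less.IH[OF _ laplacian_forms[OF less.prems]]) simp
    also have "\<dots> = real d * (real d + real CARD('n) - 2) * sph_int f"
      by (rule sph_int_laplacian[OF less.prems])
    finally show ?thesis using False assms(1) by simp
  qed
qed

text \<open>The transported kernel still reproduces values at \<open>v\<close>, because the integral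
  is invariant; uniqueness does the rest.\<close>

lemma zkern_orthogonal:
  fixes v :: "real^'n::finite"
  assumes n: "CARD('n) \<ge> 2" and U: "orthogonal_transformation (U :: real^'n \<Rightarrow> real^'n)"
  shows "zkern d (U v) (U x) = zkern d v x"
proof -
  have lin: "linear U" using U orthogonal_transformation_linear by blast
  have "(\<lambda>x. zkern d (U v) (U x)) = zkern d v"
  proof (rule zkern_unique)
    show "(\<lambda>x. zkern d (U v) (U x)) \<in> forms d" by (rule forms_compose_linear[OF zkern_forms lin])
    fix g :: "real^'n \<Rightarrow> real" assume g: "g \<in> forms d"
    define W where "W = inv U"
    have W: "orthogonal_transformation W" unfolding W_def by (rule orthogonal_transformation_inv[OF U])
    have WU: "W (U y) = y" for y
      unfolding W_def using orthogonal_transformation_inj[OF U] by (rule inv_f_f)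
    have gW: "(\<lambda>x. g (W x)) \<in> forms d"
      by (rule forms_compose_linear[OF g]) (use W orthogonal_transformation_linear in blast)
    have "ip (\<lambda>x. zkern d (U v) (U x)) g = sph_int (\<lambda>x. zkern d (U v) (U x) * g (W (U x)))"
      by (simp add: ip_def WU)
    also have "\<dots> = sph_int (\<lambda>x. zkern d (U v) x * g (W x))"
      by (rule sph_int_orthogonal[OF n forms_mult[OF zkern_forms gW] U])
    also have "\<dots> = g v" using zkern_reproducing[OF gW, of "U v"] by (simp add: ip_def WU)
    finally show "ip (\<lambda>x. zkern d (U v) (U x)) g = g v" .
  qed
  then show ?thesis by metis
qed

text \<open>Orthogonal maps act transitively on the sphere, so the diagonal is constant there and
  equals its mean.\<close>

lemma zkern_diag:
  fixes v :: "real^'n::finite"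
  assumes n: "CARD('n) \<ge> 2" and v: "norm v = 1"
  shows "zkern d v v = real (Ddim CARD('n) d)"
proof -
  have *: "zkern d w w = zkern d v v" if w: "norm w = 1" for w :: "real^'n"
  proof -
    obtain U where "orthogonal_transformation U" "U v = w"
      by (rule orthogonal_transformation_exists[of v w]) (use v w in auto)
    then show ?thesis using zkern_orthogonal[OF n, of U d v v] by simp
  qed
  have c: "continuous_on UNIV (\<lambda>v::real^'n. zkern d v v)"
    unfolding zkern_def by (intro continuous_on_sum continuous_on_mult forms_continuous[OF onb(1)]) auto
  have "sph_int (\<lambda>v::real^'n. zkern d v v) = sph_int (\<lambda>_::real^'n. zkern d v v)"
    by (intro sph_int_cong c) (auto simp: *)
  then show ?thesis by (simp add: sph_int_zkern_diag)
qed

lemma zkern_self: "ip (zkern d v) (zkern d v) = zkern d v v"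
  by (rule zkern_reproducing[OF zkern_forms])

text \<open>Cauchy--Schwarz for \<open>g v\<close>, which is the pairing of \<open>g\<close> with a
  kernel of squared norm \<open>Ddim\<close>.\<close>

lemma form_sphere_bound:
  fixes g :: "real^'n::finite \<Rightarrow> real"
  assumes n: "CARD('n) \<ge> 2" and g: "g \<in> forms d" and v: "norm v = 1"
  shows "(g v)\<^sup>2 \<le> real (Ddim CARD('n) d) * ip g g"
proof -
  interpret inner_fun "forms d :: (real^'n \<Rightarrow> real) set" ip by (rule inner_fun_forms)
  let ?z = "zkern d v" and ?N = "real (Ddim CARD('n) d)"
  have zz: "ip ?z ?z = ?N" using zkern_self zkern_diag[OF n v] by metis
  have N: "?N \<ge> 0" by simp
  \<comment> \<open>Up to the factor \<open>?N\<close>, the component of \<open>g\<close> orthogonal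
    to the kernel; it vanishes at \<open>v\<close>.\<close>
  define h where "h = (\<lambda>x. ?N * g x - g v * ?z x)"
  have hV: "h \<in> forms d" unfolding h_def by (intro diff scale g zkern_forms)
  have "0 \<le> ip h h"
    unfolding ip_def by (rule sph_int_nonneg[OF forms_continuous[OF forms_mult[OF hV hV]]]) simp
  also have "ip h h = ?N * ip g h - g v * ip ?z h"
  proof -
    have "ip h h = ip (\<lambda>x. ?N * g x - g v * ?z x) h" by (simp add: h_def)
    then show ?thesis
      unfolding B_diff[OF scale[OF g] scale[OF zkern_forms] hV] B_scale[OF g hV] B_scale[OF zkern_forms hV] .
  qed
  also have "ip ?z h = 0"
    unfolding zkern_reproducing[OF hV] by (simp add: h_def zkern_diag[OF n v])
  also have "ip g h = ?N * ip g g - g v * ip g ?z"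
    using B_diff[OF scale[OF g] scale[OF zkern_forms] g] B_scale[OF g g] B_scale[OF zkern_forms g]
    by (subst (1 3) ip_sym) (simp only: h_def)
  also have "ip g ?z = g v" by (subst ip_sym) (rule zkern_reproducing[OF g])
  finally have *: "0 \<le> ?N * (?N * ip g g - (g v)\<^sup>2)" by (simp add: power2_eq_square)
  show ?thesis
  proof (cases "?N = 0")
    case True
    then have "ip ?z ?z = 0" using zz by simp
    then have "?z = (\<lambda>x. 0)" by (rule ip_pos_def[OF zkern_forms])
    then have "g v = 0" using zkern_reproducing[OF g, of v] B_zero[OF g] by simp
    then show ?thesis using True by simp
  next
    case False
    then show ?thesis using * N by (simp add: zero_le_mult_iff)
  qed
qed

section \<open>Spherical harmonics and the Funk--Hecke formula\<close>

lemma harmonic_formsD: "h \<in> harmonic_forms d \<Longrightarrow> h \<in> forms d" "h \<in> harmonic_forms d \<Longrightarrow> laplacian h x = 0"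
  by (auto simp: harmonic_forms_def)

text \<open>On the sphere the orthogonal complement of \<open>r\<^sup>2 P\<^sub>d\<close> in \<open>P\<^sub>d\<^sub>+\<^sub>2\<close> is harmonic, by Green's identity.\<close>

lemma harmonic_split:
  fixes f :: "real^'n::finite \<Rightarrow> real"
  assumes f: "f \<in> forms (d + 2)"
  obtains q h :: "real^'n \<Rightarrow> real" where "q \<in> forms d" "h \<in> harmonic_forms (d + 2)" "\<And>x. f x = (norm x)\<^sup>2 * q x + h x"
proof -
  \<comment> \<open>On the sphere r^2 q and q coincide, so the right \<open>q\<close> is the
    orthogonal projection of the restriction of \<open>f\<close> onto
    \<open>forms d\<close>.\<close>
  define q :: "real^'n \<Rightarrow> real" where "q = (\<lambda>x. \<Sum>j<Ddim CARD('n) d. ip f (onb d j) * onb d j x)"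
  define h where "h = (\<lambda>x. f x - (norm x)\<^sup>2 * q x)"
  have q: "q \<in> forms d" unfolding q_def by (intro forms_sum forms_scale onb) auto
  have r2: "g \<in> forms d \<Longrightarrow> (\<lambda>x. (norm x)\<^sup>2 * g x) \<in> forms (d + 2)" for g :: "real^'n \<Rightarrow> real"
    using forms_mult[OF norm_square_forms, of g d] by (simp add: add.commute)
  have h: "h \<in> forms (d + 2)" unfolding h_def by (intro forms_diff f r2 q)
  have qe: "ip q (onb d j) = ip f (onb d j)" if "j < Ddim CARD('n) d" for j
    using inner_fun.expansion_coeff[OF inner_fun_forms onb(1) onb(2) q_def that] .
  have he: "ip h (onb d j) = 0" if "j < Ddim CARD('n) d" for j
  proof -
    note o = onb(1)[OF that]
    have "ip h (onb d j) = ip f (onb d j) - ip (\<lambda>x. (norm x)\<^sup>2 * q x) (onb d j)"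
      unfolding ip_def h_def left_diff_distrib
      by (intro sph_int_diff forms_continuous[OF forms_mult[OF f o]] forms_continuous[OF forms_mult[OF r2[OF q] o]])
    also have "ip (\<lambda>x. (norm x)\<^sup>2 * q x) (onb d j) = ip q (onb d j)"
      by (rule ip_cong_sphere[OF r2[OF q] q o o]) auto
    finally show ?thesis using qe[OF that] by simp
  qed
  have hg: "sph_int (\<lambda>x. h x * g x) = 0" if g: "g \<in> forms d" for g
  proof -
    have "sph_int (\<lambda>x. h x * g x) = sph_int (\<lambda>x. \<Sum>j<Ddim CARD('n) d. ip g (onb d j) * (h x * onb d j x))"
      using onb(3)[OF g] by (simp add: sum_distrib_left mult.left_commute)
    also have "\<dots> = (\<Sum>j<Ddim CARD('n) d. ip g (onb d j) * ip h (onb d j))"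
      by (subst sph_int_sum) (auto simp: sph_int_cmult ip_def intro!: continuous_on_mult
          continuous_on_const forms_continuous[OF h] forms_continuous[OF onb(1)])
    finally show ?thesis by (simp add: he)
  qed
  \<comment> \<open>Green's identity is applied to \<open>g\<close> and \<open>h\<close>: since
    \<open>h\<close> is orthogonal to \<open>g\<close> and to its Laplacian, the integral of
    \<open>g\<close> times \<open>laplacian h\<close> vanishes, and this is the squared norm of
    \<open>g\<close>.\<close>
  define g where "g = laplacian h"
  have g: "g \<in> forms d" using laplacian_forms[OF h] by (simp add: g_def)
  have "sph_int (\<lambda>x. laplacian g x * h x) = 0"
  proof (cases "d < 2")
    case True
    then show ?thesis using laplacian_low[OF g] by simp
  next
    case False
    \<comment> \<open>The factor r^2 is invisible on the sphere and restores the degree for which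
      \<open>hg\<close> is stated.\<close>
    have r: "(\<lambda>x. (norm x)\<^sup>2 * laplacian g x) \<in> forms d"
      using forms_mult[OF norm_square_forms laplacian_forms[OF g]] le_add_diff_inverse[of 2 d] False by (simp del: add_2_eq_Suc)
    have "sph_int (\<lambda>x. laplacian g x * h x) = sph_int (\<lambda>x. h x * ((norm x)\<^sup>2 * laplacian g x))"
      by (rule sph_int_cong[OF forms_continuous[OF forms_mult[OF laplacian_forms[OF g] h]]
            forms_continuous[OF forms_mult[OF h r]]]) simp
    then show ?thesis using hg[OF r] by simp
  qed
  moreover have "sph_int (\<lambda>x. g x * h x) = 0" using hg[OF g] by (simp add: mult.commute)
  ultimately have "sph_int (\<lambda>x. g x * laplacian h x) = 0"
    using green[OF g h] by simp
  then have "ip g g = 0" by (simp add: ip_def g_def)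
  then have "g = (\<lambda>x. 0)" by (rule ip_pos_def[OF g])
  then have "h \<in> harmonic_forms (d + 2)"
    using h by (simp add: harmonic_forms_def g_def)
  with q show ?thesis by (intro that[of q h]) (auto simp: h_def)
qed

lemma harmonic_decomposition:
  fixes f :: "real^'n::finite \<Rightarrow> real"
  assumes "f \<in> forms (2 * k)"
  shows "\<exists>h. (\<forall>i. h i \<in> harmonic_forms (2 * i)) \<and> f = (\<lambda>x. \<Sum>i\<le>k. norm x ^ (2 * k - 2 * i) * h i x)"
  using assms
proof (induction k arbitrary: f)
  case 0
  have z: "(\<lambda>x. 0 :: real) \<in> harmonic_forms d" for d
    using laplacian_low[OF forms_zero[of 0]] by (auto simp: harmonic_forms_def)
  have "f \<in> harmonic_forms 0" using 0 laplacian_low[of f 0] by (auto simp: harmonic_forms_def)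
  \<comment> \<open>The components are indexed by all naturals, so zero fills the indices beyond
    0.\<close>
  then show ?case using z by (intro exI[of _ "\<lambda>i. if i = 0 then f else (\<lambda>x. 0)"]) auto
next
  case (Suc k)
  have "f \<in> forms (2 * k + 2)" using Suc.prems by simp
  then obtain q h where q: "q \<in> forms (2 * k)" and h: "h \<in> harmonic_forms (2 * k + 2)"
    and f: "\<And>x. f x = (norm x)\<^sup>2 * q x + h x"
    using harmonic_split by blast
  obtain h' where h': "\<forall>i. h' i \<in> harmonic_forms (2 * i)"
    "q = (\<lambda>x. \<Sum>i\<le>k. norm x ^ (2 * k - 2 * i) * h' i x)"
    using Suc.IH[OF q] by blast
  define H where "H = h'(Suc k := h)"
  have "f = (\<lambda>x. \<Sum>i\<le>Suc k. norm x ^ (2 * Suc k - 2 * i) * H i x)"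
  proof
    fix x
    have "(norm x)\<^sup>2 * q x = (\<Sum>i\<le>k. norm x ^ (2 * Suc k - 2 * i) * H i x)"
      unfolding h'(2) sum_distrib_left
    proof (intro sum.cong refl)
      fix i assume "i \<in> {..k}"
      then have "2 * Suc k - 2 * i = 2 + (2 * k - 2 * i)" "H i = h' i" by (auto simp: H_def)
      then show "(norm x)\<^sup>2 * (norm x ^ (2 * k - 2 * i) * h' i x) = norm x ^ (2 * Suc k - 2 * i) * H i x"
        by (simp only: power_add mult.assoc)
    qed
    then show "f x = (\<Sum>i\<le>Suc k. norm x ^ (2 * Suc k - 2 * i) * H i x)" by (simp add: f H_def)
  qed
  moreover have "\<forall>i. H i \<in> harmonic_forms (2 * i)" using h h' by (simp add: H_def)
  ultimately show ?case by blast
qed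

text \<open>With both Laplacians zero, Green's identity leaves the difference of the eigenvalues d
  (d + n - 2). It factors as (b - a) (a + b + n - 2), and neither factor is 0.\<close>

lemma harmonic_orthogonal:
  fixes f :: "real^'n::finite \<Rightarrow> real"
  assumes n: "CARD('n) \<ge> 2" and f: "f \<in> harmonic_forms a" and g: "g \<in> harmonic_forms b" and "a \<noteq> b"
  shows "ip f g = 0"
proof -
  have "(real b * (real b + real CARD('n) - 2) - real a * (real a + real CARD('n) - 2)) * ip f g = 0"
    using green[OF harmonic_formsD(1)[OF f] harmonic_formsD(1)[OF g]] harmonic_formsD(2)[OF f] harmonic_formsD(2)[OF g]
    by (simp add: ip_def)
  moreover have "real b * (real b + real CARD('n) - 2) - real a * (real a + real CARD('n) - 2) =
    (real b - real a) * (real a + real b + real CARD('n) - 2)" by (simp add: algebra_simps)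
  moreover have "real a + real b > 0" using \<open>a \<noteq> b\<close> by linarith
  ultimately show ?thesis using n \<open>a \<noteq> b\<close> by auto
qed

lemma harmonic_scale: "h \<in> harmonic_forms d \<Longrightarrow> (\<lambda>x. c * h x) \<in> harmonic_forms d"
  by (auto simp: harmonic_forms_def forms_scale laplacian_scale)

lemma harmonic_add: "g \<in> harmonic_forms d \<Longrightarrow> h \<in> harmonic_forms d \<Longrightarrow> (\<lambda>x. g x + h x) \<in> harmonic_forms d"
  by (auto simp: harmonic_forms_def forms_add laplacian_add)

lemma harmonic_diff: "g \<in> harmonic_forms d \<Longrightarrow> h \<in> harmonic_forms d \<Longrightarrow> (\<lambda>x. g x - h x) \<in> harmonic_forms d"
  using harmonic_add[OF _ harmonic_scale, of g d h "-1"] by simp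

lemma ip_nonneg: "f \<in> forms d \<Longrightarrow> ip f f \<ge> 0"
  unfolding ip_def by (rule sph_int_nonneg[OF forms_continuous[OF forms_mult]]) auto

lemma rH_forms: "i \<le> k \<Longrightarrow> h \<in> harmonic_forms (2 * i) \<Longrightarrow> (\<lambda>x::real^'n::finite. norm x ^ (2 * k - 2 * i) * h x) \<in> forms (2 * k)"
  using forms_mult[OF norm_power_forms[of "k - i"] harmonic_formsD(1), of h "2 * i"]
  by (simp add: right_diff_distrib')

lemma ip_rH:
  fixes h h' :: "real^'n::finite \<Rightarrow> real"
  assumes "i \<le> k" "h \<in> harmonic_forms (2 * i)" "j \<le> l" "h' \<in> harmonic_forms (2 * j)"
  shows "ip (\<lambda>x. norm x ^ (2 * k - 2 * i) * h x) (\<lambda>x. norm x ^ (2 * l - 2 * j) * h' x) = ip h h'"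
  by (rule ip_cong_sphere[OF rH_forms[OF assms(1,2)] harmonic_formsD(1)[OF assms(2)]
      rH_forms[OF assms(3,4)] harmonic_formsD(1)[OF assms(4)]]) auto

lemma ip_lincomb:
  fixes g :: "real^'n::finite \<Rightarrow> real"
  assumes "\<And>i. i \<in> I \<Longrightarrow> f i \<in> forms d" "g \<in> forms d"
  shows "ip (\<lambda>x. \<Sum>i\<in>I. c i * f i x) g = (\<Sum>i\<in>I. c i * ip (f i) g)"
  using inner_fun.B_lincomb[OF inner_fun_forms assms(2,1)] .

lemma ip_sum:
  fixes g :: "real^'n::finite \<Rightarrow> real"
  assumes "\<And>i. i \<in> I \<Longrightarrow> f i \<in> forms d" "g \<in> forms d"
  shows "ip (\<lambda>x. \<Sum>i\<in>I. f i x) g = (\<Sum>i\<in>I. ip (f i) g)"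
  using ip_lincomb[OF assms, where c = "\<lambda>_. 1"] by simp

lemma ip_sum_rH:
  fixes h :: "nat \<Rightarrow> real^'n::finite \<Rightarrow> real"
  assumes n: "CARD('n) \<ge> 2" and h: "\<And>i. h i \<in> harmonic_forms (2 * i)"
    and j: "j \<le> k" and g: "g \<in> harmonic_forms (2 * j)"
  shows "ip (\<lambda>x. \<Sum>i\<le>k. norm x ^ (2 * k - 2 * i) * h i x) (\<lambda>x. norm x ^ (2 * k - 2 * j) * g x) = ip (h j) g"
proof -
  have "ip (\<lambda>x. \<Sum>i\<le>k. norm x ^ (2 * k - 2 * i) * h i x) (\<lambda>x. norm x ^ (2 * k - 2 * j) * g x)
     = (\<Sum>i\<le>k. ip (\<lambda>x. norm x ^ (2 * k - 2 * i) * h i x) (\<lambda>x. norm x ^ (2 * k - 2 * j) * g x))"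
    by (intro ip_sum[where d = "2 * k"] rH_forms h j g) auto
  also have "\<dots> = (\<Sum>i\<le>k. if i = j then ip (h j) g else 0)"
    using ip_rH[OF _ h j g] harmonic_orthogonal[OF n h g] by (intro sum.cong) auto
  finally show ?thesis using j by simp
qed

text \<open>Orthogonality of the summands makes each of them a candidate for the definite
  description in \<open>oproj\<close>, and definiteness of \<open>ip\<close> makes the candidate
  unique. Hence any harmonic decomposition computes the projections.\<close>

lemma lproj_eq:
  fixes h :: "nat \<Rightarrow> real^'n::finite \<Rightarrow> real"
  assumes n: "CARD('n) \<ge> 2" and h: "\<And>i. h i \<in> harmonic_forms (2 * i)"
    and f: "f = (\<lambda>x. \<Sum>i\<le>k. norm x ^ (2 * k - 2 * i) * h i x)" and i: "i \<le> k"
  shows "lproj k i f = (\<lambda>x. norm x ^ (2 * k - 2 * i) * h i x)"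
  unfolding lproj_def oproj_def
proof (rule the_equality)
  let ?g = "\<lambda>x. norm x ^ (2 * k - 2 * i) * h i x"
  interpret inner_fun "forms (2 * k) :: (real^'n \<Rightarrow> real) set" ip by (rule inner_fun_forms)
  have fF: "f \<in> forms (2 * k)" unfolding f by (intro forms_sum rH_forms h) auto
  have sub: "g \<in> rH k i \<Longrightarrow> g \<in> forms (2 * k)" for g :: "real^'n \<Rightarrow> real"
    using rH_forms[OF i] by (auto simp: rH_def)
  have gF: "?g \<in> rH k i" using h by (auto simp: rH_def)
  have orth: "ip (\<lambda>x. f x - ?g x) u = 0" if "u \<in> rH k i" for u
  proof -
    obtain v where v: "v \<in> harmonic_forms (2 * i)" "u = (\<lambda>x. norm x ^ (2 * k - 2 * i) * v x)"
      using \<open>u \<in> rH k i\<close> by (auto simp: rH_def)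
    have "ip (\<lambda>x. f x - ?g x) u = ip f u - ip ?g u"
      by (rule B_diff[OF fF sub[OF gF] sub[OF that]])
    then show ?thesis unfolding v(2) ip_rH[OF i h i v(1)] f ip_sum_rH[OF n h i v(1)] by simp
  qed
  then show "?g \<in> rH k i \<and> (\<forall>u\<in>rH k i. ip (\<lambda>x. f x - ?g x) u = 0)" using gF by blast
  fix g assume g: "g \<in> rH k i \<and> (\<forall>u\<in>rH k i. ip (\<lambda>x. f x - g x) u = 0)"
  \<comment> \<open>The difference of two candidates lies in \<open>rH k i\<close> itself, so it is
    orthogonal to itself.\<close>
  have d: "(\<lambda>x. g x - ?g x) \<in> rH k i"
  proof -
    obtain v where v: "v \<in> harmonic_forms (2 * i)" "g = (\<lambda>x. norm x ^ (2 * k - 2 * i) * v x)"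
      using g by (auto simp: rH_def)
    have "(\<lambda>x. v x - h i x) \<in> harmonic_forms (2 * i)"
      by (rule harmonic_diff[OF v(1) h])
    then show ?thesis unfolding rH_def v(2)
      by (auto intro!: exI[of _ "\<lambda>x. v x - h i x"] simp: right_diff_distrib)
  qed
  have gf: "(\<lambda>x. f x - ?g x) \<in> forms (2 * k)" "(\<lambda>x. f x - g x) \<in> forms (2 * k)"
    using fF sub gF g by (auto intro!: diff)
  have "ip (\<lambda>x. (f x - ?g x) - (f x - g x)) (\<lambda>x. g x - ?g x) = 0"
    using B_diff[OF gf sub[OF d]] orth[OF d] g d by simp
  then have "ip (\<lambda>x. g x - ?g x) (\<lambda>x. g x - ?g x) = 0" by simp
  then have "(\<lambda>x. g x - ?g x) = (\<lambda>x. 0)" by (rule ip_pos_def[OF sub[OF d]])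
  then show "g = ?g" by (simp add: fun_eq_iff)
qed

text \<open>The eigenvalues of the integral operator with kernel \<open>(x \<bullet> v)\<^sup>a\<close> on the harmonic forms of degree \<open>d\<close>;
  meaningful only for \<open>d \<le> a\<close> with \<open>a - d\<close> even.\<close>

definition fh :: "real \<Rightarrow> nat \<Rightarrow> nat \<Rightarrow> real" where
  "fh n d a = fact a * Gamma (n / 2) / (2 ^ a * fact ((a - d) div 2) * Gamma ((real a + real d + n) / 2))"

lemma fh_pos: "n > 0 \<Longrightarrow> fh n d a > 0"
  by (auto simp: fh_def intro!: divide_pos_pos mult_pos_pos Gamma_real_pos)

text \<open>This is the recurrence that integrating a Laplacian produces in
  \<open>funk_hecke\<close>; the shift of the Gamma function by one makes the three values
  comparable.\<close>

lemma fh_rec: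
  assumes n: "n \<ge> 2" and d: "d \<le> a" "even (a - d)" "a \<ge> 1"
  shows "(real d + real a) * (real d + real a + n - 2) * fh n d a =
    2 * real a * real d * fh n (d - 1) (a - 1) + (if d + 2 \<le> a then real a * real (a - 1) * fh n d (a - 2) else 0)"
proof -
  obtain s where s: "a = d + 2 * s" using d by (metis add_diff_inverse_nat evenE linorder_not_less)
  define t where "t = (real a + real d + n) / 2"
  have t: "t - 1 > 0" using n d by (simp add: t_def)
  have G: "Gamma t = (t - 1) * Gamma (t - 1)"
    using Gamma_plus1[of "t - 1"] t by (auto simp: nonpos_Ints_def)
  have Gp: "Gamma (t - 1) > 0" using t by (rule Gamma_real_pos)
  obtain b where b: "a = Suc b" using d(3) by (metis Suc_le_D One_nat_def)
  \<comment> \<open>For positive \<open>d\<close> this is \<open>fh n (d - 1) (a - 1)\<close>; the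
    other two values are rational multiples of it.\<close>
  define C where "C = fact b * Gamma (n / 2) / (2 ^ b * fact s * Gamma (t - 1))"
  have F0: "fh n d a = C * real a / (2 * (t - 1))"
  proof -
    have "fh n d a = fact a * Gamma (n / 2) / (2 ^ a * fact s * Gamma t)"
      by (simp add: fh_def t_def s)
    then show ?thesis unfolding G C_def b by (simp add: field_simps)
  qed
  have F1: "real d * fh n (d - 1) (a - 1) = real d * C"
  proof (cases "d = 0")
    case False
    then have "(a - 1 - (d - 1)) div 2 = s" "(real (a - 1) + real (d - 1) + n) / 2 = t - 1"
      using s b by (auto simp: t_def of_nat_diff field_simps)
    then have "fh n (d - 1) (a - 1) = fact (a - 1) * Gamma (n / 2) / (2 ^ (a - 1) * fact s * Gamma (t - 1))"
      by (simp only: fh_def)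
    then show ?thesis by (simp add: C_def b)
  qed simp
  have F2: "(if d + 2 \<le> a then real a * real (a - 1) * fh n d (a - 2) else 0) = 2 * real a * real s * C"
  proof (cases "s = 0")
    case True
    then show ?thesis using s by simp
  next
    case False
    then obtain r where r: "s = Suc r" using not0_implies_Suc by blast
    then obtain c where c: "b = Suc c" using s b by (cases b) auto
    have "(a - 2 - d) div 2 = r" "(real (a - 2) + real d + n) / 2 = t - 1"
      using s r b c by (auto simp: t_def field_simps)
    then have "fh n d (a - 2) = fact (a - 2) * Gamma (n / 2) / (2 ^ (a - 2) * fact r * Gamma (t - 1))"
      by (simp only: fh_def)
    then have "fh n d (a - 2) = fact c * Gamma (n / 2) / (2 ^ c * fact r * Gamma (t - 1))"
      by (simp add: b c)
    have C: "C = real b * (fact c * Gamma (n / 2) / (2 ^ c * fact r * Gamma (t - 1))) / (2 * real s)"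
      unfolding C_def r c by (simp del: of_nat_Suc add: mult_ac)
    have "real a * real (a - 1) * (fact c * Gamma (n / 2) / (2 ^ c * fact r * Gamma (t - 1))) = 2 * real a * real s * C"
    proof -
      define X where "X = fact c * Gamma (n / 2) / (2 ^ c * fact r * Gamma (t - 1))"
      have "real s > 0" "a - 1 = b" using r b by auto
      then show ?thesis unfolding C X_def[symmetric] by simp
    qed
    then show ?thesis using s r \<open>fh n d (a - 2) = fact c * Gamma (n / 2) / _\<close> by simp
  qed
  have e1: "real d + real a + n - 2 = 2 * (t - 1)" "real d + real a = 2 * real d + 2 * real s"
    using s by (auto simp: t_def field_simps)
  have "(real d + real a) * (real d + real a + n - 2) * fh n d a = (2 * real d + 2 * real s) * (C * real a)"
    unfolding F0 e1(1) unfolding e1(2) using t by simp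
  also have "\<dots> = 2 * real a * (real d * C) + 2 * real a * real s * C" by (simp add: algebra_simps)
  finally show ?thesis unfolding F1[symmetric] unfolding F2[symmetric] by (simp only: mult.assoc)
qed

lemma pd_harmonic:
  assumes h: "h \<in> harmonic_forms d" shows "pd v h \<in> harmonic_forms (d - 1)"
proof -
  note hf = harmonic_formsD(1)[OF h]
  have "laplacian (pd v h) x = pd v (\<lambda>x. \<Sum>i\<in>UNIV. pd (axis i 1) (pd (axis i 1) h) x) x" for x
    unfolding laplacian_eq[OF pd_forms[OF hf]]
    by (subst pd_sum[OF pd_forms[OF pd_forms[OF hf]]])
       (simp add: pd_commute[OF hf, of v] pd_commute[OF pd_forms[OF hf], of v])
  moreover have "(\<lambda>x. \<Sum>i\<in>UNIV. pd (axis i 1) (pd (axis i 1) h) x) = (\<lambda>x. 0)"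
    using laplacian_eq[OF hf] harmonic_formsD(2)[OF h] by metis
  ultimately show ?thesis using pd_forms[OF hf] by (simp add: harmonic_forms_def)
qed

text \<open>\<open>sph_int_laplacian\<close> is applied in the variable \<open>v\<close>. Since
  \<open>f\<close> is harmonic, only the cross term, with \<open>pd x f\<close> and exponent
  \<open>a - 1\<close>, and the second derivative of the power, with exponent \<open>a - 2\<close>,
  remain. The induction runs over all harmonic forms at once because \<open>pd x f\<close> is one of
  lower degree; Euler's identity evaluates it at \<open>x\<close>.\<close>

lemma funk_hecke:
  fixes f :: "real^'n::finite \<Rightarrow> real"
  assumes n: "CARD('n) \<ge> 2" and f: "f \<in> harmonic_forms d"
  shows "sph_int (\<lambda>v. f v * (x \<bullet> v) ^ a) =
    (if d \<le> a \<and> even (a - d) then fh (real CARD('n)) d a * norm x ^ (a - d) * f x else 0)"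
  using f
proof (induction a arbitrary: d f rule: less_induct)
  case (less a)
  let ?n = "real CARD('n)"
  note ff = harmonic_formsD(1)[OF less.prems]
  have gF: "(\<lambda>v. f v * (x \<bullet> v) ^ a) \<in> forms (d + a)"
    by (rule forms_mult[OF ff linear_form_power_forms])
  have lap: "laplacian (\<lambda>v. f v * (x \<bullet> v) ^ a) v =
      2 * real a * (pd x f v * (x \<bullet> v) ^ (a - 1)) + real a * real (a - 1) * (norm x)\<^sup>2 * (f v * (x \<bullet> v) ^ (a - 2))" for v
  proof -
    have "(\<Sum>i\<in>UNIV. pd (axis i 1) f v * pd (axis i 1) (\<lambda>v. (x \<bullet> v) ^ a) v) =
      real a * (x \<bullet> v) ^ (a - 1) * (\<Sum>i\<in>UNIV. x $ i * pd (axis i 1) f v)"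
      by (simp add: pd_linear_form_power inner_axis sum_distrib_left mult_ac)
    then show ?thesis
      unfolding laplacian_mult[OF ff linear_form_power_forms] laplacian_linear_form_power harmonic_formsD(2)[OF less.prems]
      by (simp add: pd_expand[OF ff, symmetric] power2_norm_eq_inner algebra_simps)
  qed
  have "(real d + real a) * (real d + real a + ?n - 2) * sph_int (\<lambda>v. f v * (x \<bullet> v) ^ a)
     = sph_int (laplacian (\<lambda>v. f v * (x \<bullet> v) ^ a))"
    using sph_int_laplacian[OF gF] by simp
  also have "\<dots> = sph_int (\<lambda>v. 2 * real a * (pd x f v * (x \<bullet> v) ^ (a - 1))
      + real a * real (a - 1) * (norm x)\<^sup>2 * (f v * (x \<bullet> v) ^ (a - 2)))"
    using lap by (intro arg_cong[of _ _ sph_int] ext)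
  also have "\<dots> = 2 * real a * sph_int (\<lambda>v. pd x f v * (x \<bullet> v) ^ (a - 1))
      + real a * real (a - 1) * (norm x)\<^sup>2 * sph_int (\<lambda>v. f v * (x \<bullet> v) ^ (a - 2))"
    by (subst sph_int_add) (auto intro!: continuous_intros forms_continuous[OF ff] forms_continuous[OF pd_forms[OF ff]] simp: sph_int_cmult)
  finally have main: "(real d + real a) * (real d + real a + ?n - 2) * sph_int (\<lambda>v. f v * (x \<bullet> v) ^ a) = \<dots>" .
  show ?case
  proof (cases "a = 0")
    case True
    show ?thesis
    proof (cases "d = 0")
      case True
      then obtain c where "f = (\<lambda>x. c)" using ff forms_0D by blast
      moreover have "Gamma (?n / 2) \<noteq> 0"
        by (rule less_imp_neq[symmetric], rule Gamma_real_pos) simp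
      then have "fh ?n 0 0 = 1" by (simp add: fh_def)
      ultimately show ?thesis using \<open>a = 0\<close> \<open>d = 0\<close> by simp
    next
      case False
      then have "sph_int (\<lambda>v. f v * (x \<bullet> v) ^ a) = 0"
        using main \<open>a = 0\<close> n by auto
      then show ?thesis using False \<open>a = 0\<close> by simp
    qed
  next
    case False
    have I1: "2 * real a * sph_int (\<lambda>v. pd x f v * (x \<bullet> v) ^ (a - 1)) =
        (if d \<le> a \<and> even (a - d) then 2 * real a * real d * fh ?n (d - 1) (a - 1) * norm x ^ (a - d) * f x else 0)"
    proof (cases "d = 0")
      case True
      then show ?thesis using pd_forms_0[OF ff[unfolded True], of x] by simp
    next
      case d: False
      have c: "a - 1 < a" "(d - 1 \<le> a - 1) = (d \<le> a)" "a - 1 - (d - 1) = a - d"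
        using d False by auto
      have "sph_int (\<lambda>v. pd x f v * (x \<bullet> v) ^ (a - 1)) =
        (if d \<le> a \<and> even (a - d) then fh ?n (d - 1) (a - 1) * norm x ^ (a - d) * (real d * f x) else 0)"
        using less.IH[OF c(1) pd_harmonic[OF less.prems, of x]] unfolding c(2,3) euler[OF ff] .
      then show ?thesis by (simp only: mult_ac if_distrib[of "(*) _"] mult_zero_right mult_zero_left)
    qed
    have I2: "real a * real (a - 1) * (norm x)\<^sup>2 * sph_int (\<lambda>v. f v * (x \<bullet> v) ^ (a - 2)) =
        (if d \<le> a \<and> even (a - d) then (if d + 2 \<le> a then real a * real (a - 1) * fh ?n d (a - 2) else 0) * norm x ^ (a - d) * f x else 0)"
    proof (cases "d + 2 \<le> a")
      case True
      then have c: "a - 2 < a" "(d \<le> a - 2) = (d \<le> a)" "a - d = 2 + (a - 2 - d)" by auto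
      then have e: "even (a - 2 - d) = even (a - d)" by simp
      have IH: "sph_int (\<lambda>v. f v * (x \<bullet> v) ^ (a - 2)) =
        (if d \<le> a \<and> even (a - d) then fh ?n d (a - 2) * norm x ^ (a - 2 - d) * f x else 0)"
        using less.IH[OF c(1) less.prems] unfolding c(2) e .
      have p: "norm x ^ (a - d) = (norm x)\<^sup>2 * norm x ^ (a - 2 - d)"
        by (subst c(3)) (rule power_add)
      show ?thesis unfolding IH p if_P[OF True]
        by (cases "d \<le> a \<and> even (a - d)") (simp_all only: if_True if_False mult_zero_right mult_ac simp_thms)
    next
      case c: False
      \<comment> \<open>For \<open>a = 1\<close> the exponent \<open>a - 2\<close> truncates to 0
        but the factor \<open>real (a - 1)\<close> vanishes; otherwise \<open>d\<close> exceeds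
        \<open>a - 2\<close> and the induction hypothesis gives 0.\<close>
      show ?thesis
      proof (cases "a = 1")
        case False
        then have "\<not> d \<le> a - 2" using c \<open>a \<noteq> 0\<close> by auto
        then show ?thesis using c less.IH[OF _ less.prems, of "a - 2"] \<open>a \<noteq> 0\<close> by simp
      qed (use c in simp)
    qed
    have nz: "(real d + real a) * (real d + real a + ?n - 2) \<noteq> 0" using False n by auto
    show ?thesis
    proof (cases "d \<le> a \<and> even (a - d)")
      case True
      have "(real d + real a) * (real d + real a + ?n - 2) * sph_int (\<lambda>v. f v * (x \<bullet> v) ^ a) =
        ((real d + real a) * (real d + real a + ?n - 2) * fh ?n d a) * norm x ^ (a - d) * f x"
      proof -
        have fr: "(real d + real a) * (real d + real a + ?n - 2) * fh ?n d a = 2 * real a * real d * fh ?n (d - 1) (a - 1)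
          + (if d + 2 \<le> a then real a * real (a - 1) * fh ?n d (a - 2) else 0)"
          using True False n by (intro fh_rec) auto
        show ?thesis unfolding fr main I1 I2 if_P[OF True] by (simp only: distrib_right)
      qed
      then show ?thesis using nz unfolding if_P[OF True] by (simp add: mult.assoc)
    next
      case False
      then have "(real d + real a) * (real d + real a + ?n - 2) * sph_int (\<lambda>v. f v * (x \<bullet> v) ^ a) = 0"
        unfolding main I1 I2 if_not_P[OF False] by simp
      then show ?thesis using nz unfolding if_not_P[OF False] by simp
    qed
  qed
qed

text \<open>The coefficient of the ellipsoid; \<open>lam_fh\<close> identifies it as the inverse of
  the eigenvalue on the component of degree \<open>2 * i\<close>.\<close>

definition lam :: "real \<Rightarrow> nat \<Rightarrow> nat \<Rightarrow> real" where
  "lam n k i = fact (k - i) * Gamma ((2 * real k + 2 * real i + n) / 2) / (fact k * Gamma ((2 * real k + n) / 2))"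

lemma lam_fh: "n > 0 \<Longrightarrow> i \<le> k \<Longrightarrow> fh n 0 (2 * k) / fh n (2 * i) (2 * k) = lam n k i"
proof -
  assume n: "n > 0" "i \<le> k"
  have p: "Gamma (n / 2) > 0" "Gamma ((2 * real k + 2 * real i + n) / 2) > 0" "Gamma ((2 * real k + n) / 2) > 0"
    using n by (auto intro!: Gamma_real_pos)
  have "(2 * k - 2 * i) div 2 = k - i" by simp
  then show ?thesis using p unfolding fh_def lam_def by (simp add: divide_simps) 
qed

lemma lam_pos: "n > 0 \<Longrightarrow> lam n k i > 0"
  by (auto simp: lam_def intro!: divide_pos_pos mult_pos_pos Gamma_real_pos)

lemma lam_0: assumes "n > 0" shows "lam n k 0 = 1"
proof -
  have "Gamma ((2 * real k + n) / 2) > 0" using assms by (intro Gamma_real_pos) simp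
  then show ?thesis by (simp add: lam_def)
qed

text \<open>The factor \<open>1 / fh n 0 (2k)\<close> makes the operator preserve means.\<close>

definition Rop :: "nat \<Rightarrow> (real^'n::finite \<Rightarrow> real) \<Rightarrow> real^'n \<Rightarrow> real" where
  "Rop k g x = sph_int (\<lambda>v. g v * (x \<bullet> v) ^ (2 * k)) / fh (real CARD('n)) 0 (2 * k)"

lemma Rop_lincomb:
  fixes f :: "'i \<Rightarrow> real^'n::finite \<Rightarrow> real"
  assumes "\<And>i. i \<in> I \<Longrightarrow> f i \<in> forms d"
  shows "Rop k (\<lambda>x. \<Sum>i\<in>I. c i * f i x) = (\<lambda>x. \<Sum>i\<in>I. c i * Rop k (f i) x)"
proof
  fix x :: "real^'n"
  have "sph_int (\<lambda>v. (\<Sum>i\<in>I. c i * f i v) * (x \<bullet> v) ^ (2 * k)) = (\<Sum>i\<in>I. c i * sph_int (\<lambda>v. f i v * (x \<bullet> v) ^ (2 * k)))"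
    unfolding sum_distrib_right mult.assoc
    by (subst sph_int_sum) (auto intro!: continuous_intros forms_continuous[OF assms] simp: sph_int_cmult)
  then show "Rop k (\<lambda>x. \<Sum>i\<in>I. c i * f i x) x = (\<Sum>i\<in>I. c i * Rop k (f i) x)"
    by (simp add: Rop_def sum_divide_distrib)
qed

lemma Rop_rH:
  fixes h :: "real^'n::finite \<Rightarrow> real"
  assumes n: "CARD('n) \<ge> 2" and i: "i \<le> k" and h: "h \<in> harmonic_forms (2 * i)"
  shows "Rop k (\<lambda>x. norm x ^ (2 * k - 2 * i) * h x) x = norm x ^ (2 * k - 2 * i) * h x / lam (real CARD('n)) k i"
proof -
  let ?n = "real CARD('n)"
  have n0: "?n > 0" using n by simp
  have "sph_int (\<lambda>v. (norm v ^ (2 * k - 2 * i) * h v) * (x \<bullet> v) ^ (2 * k)) = sph_int (\<lambda>v. h v * (x \<bullet> v) ^ (2 * k))"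
    by (rule sph_int_cong) (auto intro!: continuous_intros forms_continuous[OF harmonic_formsD(1)[OF h]])
  also have "\<dots> = fh ?n (2 * i) (2 * k) * norm x ^ (2 * k - 2 * i) * h x"
    using funk_hecke[OF n h, of x "2 * k"] i by simp
  finally show ?thesis
    using fh_pos[OF n0, of 0 "2 * k"] fh_pos[OF n0, of "2 * i" "2 * k"]
    by (simp add: Rop_def lam_fh[OF n0 i, symmetric] field_simps)
qed

lemma Rop_decomposition:
  fixes h :: "nat \<Rightarrow> real^'n::finite \<Rightarrow> real"
  assumes n: "CARD('n) \<ge> 2" and h: "\<And>i. h i \<in> harmonic_forms (2 * i)"
  shows "Rop k (\<lambda>x. \<Sum>i\<le>k. norm x ^ (2 * k - 2 * i) * h i x) =
    (\<lambda>x. \<Sum>i\<le>k. norm x ^ (2 * k - 2 * i) * (1 / lam (real CARD('n)) k i * h i x))"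
proof -
  have "Rop k (\<lambda>x. \<Sum>i\<le>k. 1 * (norm x ^ (2 * k - 2 * i) * h i x)) =
      (\<lambda>x. \<Sum>i\<le>k. 1 * Rop k (\<lambda>x. norm x ^ (2 * k - 2 * i) * h i x) x)"
    by (rule Rop_lincomb[where d = "2 * k"]) (auto intro!: rH_forms h)
  also have "\<dots> = (\<lambda>x. \<Sum>i\<le>k. norm x ^ (2 * k - 2 * i) * (1 / lam (real CARD('n)) k i * h i x))"
    by (intro ext sum.cong) (auto simp: Rop_rH[OF n _ h])
  finally show ?thesis by simp
qed

lemma Rop_forms:
  fixes g :: "real^'n::finite \<Rightarrow> real"
  assumes n: "CARD('n) \<ge> 2" and g: "g \<in> forms (2 * k)"
  shows "Rop k g \<in> forms (2 * k)"
proof -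
  obtain h where h: "\<And>i. h i \<in> harmonic_forms (2 * i)" "g = (\<lambda>x. \<Sum>i\<le>k. norm x ^ (2 * k - 2 * i) * h i x)"
    using harmonic_decomposition[OF g] by blast
  show ?thesis unfolding h(2) Rop_decomposition[OF n h(1)]
    by (intro forms_sum rH_forms harmonic_scale h) auto
qed

lemma Rop_surj:
  fixes f :: "real^'n::finite \<Rightarrow> real"
  assumes n: "CARD('n) \<ge> 2" and f: "f \<in> forms (2 * k)"
  shows "\<exists>g\<in>forms (2 * k). f = Rop k g"
proof -
  let ?n = "real CARD('n)"
  have n0: "?n > 0" using n by simp
  obtain h where h: "\<And>i. h i \<in> harmonic_forms (2 * i)" "f = (\<lambda>x. \<Sum>i\<le>k. norm x ^ (2 * k - 2 * i) * h i x)"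
    using harmonic_decomposition[OF f] by blast
  define h' where "h' i = (\<lambda>x. lam ?n k i * h i x)" for i
  have h': "h' i \<in> harmonic_forms (2 * i)" for i unfolding h'_def by (rule harmonic_scale[OF h(1)])
  have "Rop k (\<lambda>x. \<Sum>i\<le>k. norm x ^ (2 * k - 2 * i) * h' i x) = f"
    unfolding Rop_decomposition[OF n h'] unfolding h(2) h'_def
  proof (intro ext sum.cong refl)
    fix x i
    show "norm x ^ (2 * k - 2 * i) * (1 / lam ?n k i * (lam ?n k i * h i x)) = norm x ^ (2 * k - 2 * i) * h i x"
      using lam_pos[OF n0, of k i] by simp
  qed
  moreover have "(\<lambda>x. \<Sum>i\<le>k. norm x ^ (2 * k - 2 * i) * h' i x) \<in> forms (2 * k)"
    by (intro forms_sum rH_forms h') auto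
  ultimately show ?thesis by (intro bexI) (rule sym)
qed

lemma sph_int_ip_norm:
  fixes g :: "real^'n::finite \<Rightarrow> real"
  assumes g: "g \<in> forms (2 * k)"
  shows "sph_int g = ip g (\<lambda>x. norm x ^ (2 * k))"
  unfolding ip_def
  by (rule sph_int_cong) (auto intro!: continuous_intros forms_continuous[OF g])

lemma const_harmonic: "(\<lambda>x::real^'n::finite. c) \<in> harmonic_forms 0"
  using laplacian_low[OF forms_const] by (auto simp: harmonic_forms_def forms_const)

text \<open>The mean is the pairing with r^(2k), which belongs to the component of degree 0.\<close>

lemma sph_int_decomposition:
  fixes h :: "nat \<Rightarrow> real^'n::finite \<Rightarrow> real"
  assumes n: "CARD('n) \<ge> 2" and h: "\<And>i. h i \<in> harmonic_forms (2 * i)"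
  shows "sph_int (\<lambda>x. \<Sum>i\<le>k. norm x ^ (2 * k - 2 * i) * h i x) = sph_int (h 0)"
proof -
  have "(\<lambda>x. \<Sum>i\<le>k. norm x ^ (2 * k - 2 * i) * h i x) \<in> forms (2 * k)"
    by (intro forms_sum rH_forms h) auto
  note sph_int_ip_norm[OF this]
  then show ?thesis
    using ip_sum_rH[OF n h, of 0 k "\<lambda>x. 1"] const_harmonic[of 1] by (simp add: ip_def)
qed

lemma sph_int_Rop:
  fixes g :: "real^'n::finite \<Rightarrow> real"
  assumes n: "CARD('n) \<ge> 2" and g: "g \<in> forms (2 * k)"
  shows "sph_int (Rop k g) = sph_int g"
proof -
  have n0: "real CARD('n) > 0" using n by simp
  obtain h where h: "\<And>i. h i \<in> harmonic_forms (2 * i)" "g = (\<lambda>x. \<Sum>i\<le>k. norm x ^ (2 * k - 2 * i) * h i x)"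
    using harmonic_decomposition[OF g] by blast
  show ?thesis
    unfolding h(2) Rop_decomposition[OF n h(1)] sph_int_decomposition[OF n h(1)] sph_int_decomposition[OF n harmonic_scale[OF h(1)]]
    using lam_0[OF n0] by simp
qed

lemma ip_decomposition:
  fixes h :: "nat \<Rightarrow> real^'n::finite \<Rightarrow> real"
  assumes n: "CARD('n) \<ge> 2" and h: "\<And>i. h i \<in> harmonic_forms (2 * i)"
    and g: "g = (\<lambda>x. \<Sum>i\<le>k. norm x ^ (2 * k - 2 * i) * h i x)"
  shows "ip g g = (\<Sum>i\<le>k. ip (h i) (h i))"
proof -
  have gF: "g \<in> forms (2 * k)" unfolding g by (intro forms_sum rH_forms h) auto
  have "ip g g = (\<Sum>i\<le>k. ip (\<lambda>x. norm x ^ (2 * k - 2 * i) * h i x) g)"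
    by (subst (1) g) (intro ip_sum[OF _ gF] rH_forms h, auto)
  also have "\<dots> = (\<Sum>i\<le>k. ip (h i) (h i))"
    using ip_sum_rH[OF n h _ h] by (intro sum.cong) (auto simp: g ip_sym[of _ "\<lambda>x. \<Sum>i\<le>k. _ i x"])
  finally show ?thesis .
qed

lemma Rop_inj:
  fixes g :: "real^'n::finite \<Rightarrow> real"
  assumes n: "CARD('n) \<ge> 2" and g: "g \<in> forms (2 * k)" and 0: "Rop k g = (\<lambda>x. 0)"
  shows "g = (\<lambda>x. 0)"
proof -
  let ?n = "real CARD('n)"
  have n0: "?n > 0" using n by simp
  obtain h where h: "\<And>i. h i \<in> harmonic_forms (2 * i)" "g = (\<lambda>x. \<Sum>i\<le>k. norm x ^ (2 * k - 2 * i) * h i x)"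
    using harmonic_decomposition[OF g] by blast
  let ?h = "\<lambda>i x. 1 / lam ?n k i * h i x"
  have "(\<Sum>i\<le>k. ip (?h i) (?h i)) = 0"
    using ip_decomposition[OF n harmonic_scale[OF h(1)] refl, of k "\<lambda>i. 1 / lam ?n k i"]
    unfolding Rop_decomposition[OF n h(1), of k, folded h(2), symmetric] 0 by (simp add: ip_def)
  moreover have "ip (?h i) (?h i) \<ge> 0" for i
    by (rule ip_nonneg[OF harmonic_formsD(1)[OF harmonic_scale[OF h(1)]]])
  ultimately have "\<forall>i\<in>{..k}. ip (?h i) (?h i) = 0"
    by (subst (asm) sum_nonneg_eq_0_iff) auto
  then have "?h i = (\<lambda>x. 0)" if "i \<le> k" for i
    using ip_pos_def[OF harmonic_formsD(1)[OF harmonic_scale[OF h(1)]]] that by blast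
  then have "h i x = 0" if "i \<le> k" for i x
    using lam_pos[OF n0, of k i] that by (metis (no_types, lifting) divide_eq_0_iff less_irrefl mult_eq_0_iff zero_neq_one)
  then show ?thesis unfolding h(2) by simp
qed

lemma Rop_inj_on:
  assumes n: "CARD('n::finite) \<ge> 2" and "g \<in> forms (2 * k)" "g' \<in> forms (2 * k)" "Rop k g = Rop k (g' :: real^'n \<Rightarrow> real)"
  shows "g = g'"
proof -
  have *: "Rop k (\<lambda>x. g x - g' x) = (\<lambda>x. Rop k g x - Rop k g' x)"
    using Rop_lincomb[of "{0, 1::nat}" "\<lambda>i. if i = 0 then g else g'" "2 * k" k "\<lambda>i. if i = 0 then 1 else -1"] assms by simp
  have "(\<lambda>x. g x - g' x) = (\<lambda>x. 0)"
    by (rule Rop_inj[OF n]) (use assms * in auto)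
  then show ?thesis by (simp add: fun_eq_iff)
qed

text \<open>In the coordinates provided by \<open>Rop\<close> the ellipsoid of the theorem is a ball.\<close>

lemma lproj_Rop_sum:
  fixes g :: "real^'n::finite \<Rightarrow> real"
  assumes n: "CARD('n) \<ge> 2" and g: "g \<in> forms (2 * k)"
  shows "(\<Sum>i=1..k. (lam (real CARD('n)) k i)\<^sup>2 * (fnorm (lproj k i (Rop k g)))\<^sup>2) = ip g g - (sph_int g)\<^sup>2"
proof -
  let ?n = "real CARD('n)"
  have n0: "?n > 0" using n by simp
  obtain h where h: "\<And>i. h i \<in> harmonic_forms (2 * i)" "g = (\<lambda>x. \<Sum>i\<le>k. norm x ^ (2 * k - 2 * i) * h i x)"
    using harmonic_decomposition[OF g] by blast
  let ?h = "\<lambda>i x. 1 / lam ?n k i * h i x"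
  have hh: "ip (h i) (h i) \<ge> 0" for i
    by (rule ip_nonneg[OF harmonic_formsD(1)[OF h(1)]])
  have "(lam ?n k i)\<^sup>2 * (fnorm (lproj k i (Rop k g)))\<^sup>2 = ip (h i) (h i)" if i: "i \<le> k" for i
  proof -
    have "lproj k i (Rop k g) = (\<lambda>x. norm x ^ (2 * k - 2 * i) * ?h i x)"
      unfolding h(2) by (rule lproj_eq[OF n harmonic_scale[OF h(1)] Rop_decomposition[OF n h(1)] i])
    then have "ip (lproj k i (Rop k g)) (lproj k i (Rop k g)) = ip (?h i) (?h i)"
      by (simp only: ip_rH[OF i harmonic_scale[OF h(1)] i harmonic_scale[OF h(1)]])
    also have "\<dots> = (1 / lam ?n k i)\<^sup>2 * ip (h i) (h i)"
      unfolding ip_def sph_int_cmult[symmetric] by (simp add: power2_eq_square mult_ac)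
    finally have *: "ip (lproj k i (Rop k g)) (lproj k i (Rop k g)) = (1 / lam ?n k i)\<^sup>2 * ip (h i) (h i)" .
    then have "ip (lproj k i (Rop k g)) (lproj k i (Rop k g)) \<ge> 0" using hh by simp
    then show ?thesis using lam_pos[OF n0, of k i] by (simp add: fnorm_def * power_divide)
  qed
  then have "(\<Sum>i=1..k. (lam ?n k i)\<^sup>2 * (fnorm (lproj k i (Rop k g)))\<^sup>2) = (\<Sum>i=1..k. ip (h i) (h i))"
    by (intro sum.cong) auto
  also have "\<dots> = ip g g - ip (h 0) (h 0)"
    unfolding ip_decomposition[OF n h(1) h(2)]
    by (simp add: atMost_atLeast0 sum.atLeast_Suc_atMost[of 0 k])
  \<comment> \<open>The component of degree 0 is a constant, namely the mean.\<close>
  also have "ip (h 0) (h 0) = (sph_int g)\<^sup>2"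
  proof -
    obtain c where "h 0 = (\<lambda>x. c)" using forms_0D harmonic_formsD(1)[OF h(1)[of 0]] by auto
    then show ?thesis unfolding h(2) sph_int_decomposition[OF n h(1)]
      by (simp add: ip_def power2_eq_square)
  qed
  finally show ?thesis .
qed

text \<open>\<open>Rop\<close> at \<open>x\<close> pairs its argument with a power of the linear
  form of \<open>x\<close>, and pairing with the kernel at \<open>v\<close> is evaluation at
  \<open>v\<close>.\<close>

lemma Rop_zkern:
  fixes v :: "real^'n::finite"
  shows "Rop k (zkern (2 * k) v) x = (x \<bullet> v) ^ (2 * k) / fh (real CARD('n)) 0 (2 * k)"
  using zkern_reproducing[OF linear_form_power_forms[of x "2 * k"], of v]
  by (simp add: Rop_def ip_def)

lemma Rop_norm:
  assumes n: "CARD('n::finite) \<ge> 2"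
  shows "Rop k (\<lambda>x::real^'n. norm x ^ (2 * k)) = (\<lambda>x. norm x ^ (2 * k))"
proof -
  have n0: "real CARD('n) > 0" using n by simp
  show ?thesis using Rop_rH[OF n, of 0 k "\<lambda>x. 1"] const_harmonic[of 1] lam_0[OF n0] by auto
qed

section \<open>Volumes of quadrics and affine charts\<close>

lemma space_PiM_lborel: "space (Pi\<^sub>M {..<m} (\<lambda>_. lborel :: real measure)) = Rm m"
  by (simp add: space_PiM Rm_def)

text \<open>The index order \<open>t j l\<close> with \<open>j\<close> from \<open>l\<close> on is
  that of the coefficients in \<open>gram_schmidt\<close>, transposed by
  \<open>triangular_sum\<close>; the restriction keeps values in the extensional
  \<open>Rm m\<close>.\<close>

definition tri :: "nat \<Rightarrow> (nat \<Rightarrow> real) \<Rightarrow> (nat \<Rightarrow> nat \<Rightarrow> real) \<Rightarrow> (nat \<Rightarrow> real) \<Rightarrow> nat \<Rightarrow> real" where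
  "tri m d t u = (\<lambda>l\<in>{..<m}. d l + (\<Sum>j\<in>{l..<m}. t j l * u j))"

lemma tri_Rm: "tri m d t u \<in> Rm m"
  by (simp add: tri_def Rm_def)

text \<open>Coordinates are replaced one at a time, each contributing its diagonal entry. The
  increasing order works because the new coordinate \<open>r\<close> depends only on coordinates
  from \<open>r\<close> on, which the substitutions below \<open>r\<close> leave alone.\<close>

lemma tri_nn_integral:
  fixes f :: "(nat \<Rightarrow> real) \<Rightarrow> ennreal"
  assumes t: "\<And>l. l < m \<Longrightarrow> t l l > 0"
    and f: "f \<in> borel_measurable (Pi\<^sub>M {..<m} (\<lambda>_. lborel))" and r: "r \<le> m"
  shows "(\<integral>\<^sup>+u. f u \<partial>Pi\<^sub>M {..<m} (\<lambda>_. lborel)) = ennreal (\<Prod>l<r. t l l) *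
    (\<integral>\<^sup>+u. f (\<lambda>l. if l < r then d l + (\<Sum>j\<in>{l..<m}. t j l * u j) else u l) \<partial>Pi\<^sub>M {..<m} (\<lambda>_. lborel))"
  using r f
proof (induction r arbitrary: f)
  case (Suc r)
  let ?M = "Pi\<^sub>M {..<m} (\<lambda>_. lborel :: real measure)"
  define g where "g u = d r + (\<Sum>j\<in>{r<..<m}. t j r * u j)" for u :: "nat \<Rightarrow> real"
  have g: "g \<in> borel_measurable ?M"
    unfolding g_def by (intro borel_measurable_add borel_measurable_sum borel_measurable_times borel_measurable_const) (auto intro!: measurable_component_singleton simp: measurable_lborel2)
  have g_indep: "g (u(r := y)) = g u" for u y
    unfolding g_def by (intro arg_cong2[where f = "(+)"] refl sum.cong) auto
  have upd: "(\<lambda>u. u(r := g u + t r r * u r)) \<in> measurable ?M ?M"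
    using g Suc.prems(1) by (intro measurable_fun_upd[where J = "{..<m}"]) (auto intro!: measurable_component_singleton)
  then have f1: "(\<lambda>u. f (u(r := g u + t r r * u r))) \<in> borel_measurable ?M"
    by (rule measurable_compose[OF _ Suc.prems(2)])
  have "(\<integral>\<^sup>+u. f u \<partial>?M) = ennreal \<bar>t r r\<bar> * (\<integral>\<^sup>+u. f (u(r := g u + t r r * u r)) \<partial>?M)"
    using t[of r] Suc.prems by (intro PiM_coord_update g g_indep) auto
  also have "\<dots> = ennreal \<bar>t r r\<bar> * (ennreal (\<Prod>l<r. t l l) *
    (\<integral>\<^sup>+u. f (\<lambda>l. if l < Suc r then d l + (\<Sum>j\<in>{l..<m}. t j l * u j) else u l) \<partial>?M))"
  proof (subst Suc.IH[OF _ f1])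
    have "(\<lambda>l. if l < r then d l + (\<Sum>j\<in>{l..<m}. t j l * u j) else u l)
        (r := g (\<lambda>l. if l < r then d l + (\<Sum>j\<in>{l..<m}. t j l * u j) else u l) +
          t r r * (if r < r then d r + (\<Sum>j\<in>{r..<m}. t j r * u j) else u r)) =
       (\<lambda>l. if l < Suc r then d l + (\<Sum>j\<in>{l..<m}. t j l * u j) else u l)" for u
    proof -
      have "{r..<m} = insert r {r<..<m}" using Suc.prems(1) by auto
      then have "(\<Sum>j\<in>{r..<m}. t j r * u j) = t r r * u r + (\<Sum>j\<in>{r<..<m}. t j r * u j)" by simp
      then have "g (\<lambda>l. if l < r then d l + (\<Sum>j\<in>{l..<m}. t j l * u j) else u l) + t r r * u r
          = d r + (\<Sum>j\<in>{r..<m}. t j r * u j)"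
        by (simp add: g_def)
      then show ?thesis by (auto simp: fun_eq_iff less_Suc_eq)
    qed
    then show "ennreal \<bar>t r r\<bar> * (ennreal (\<Prod>l<r. t l l) *
        (\<integral>\<^sup>+u. f ((\<lambda>l. if l < r then d l + (\<Sum>j\<in>{l..<m}. t j l * u j) else u l)
        (r := g (\<lambda>l. if l < r then d l + (\<Sum>j\<in>{l..<m}. t j l * u j) else u l) +
          t r r * (if r < r then d r + (\<Sum>j\<in>{r..<m}. t j r * u j) else u r))) \<partial>?M)) =
      ennreal \<bar>t r r\<bar> * (ennreal (\<Prod>l<r. t l l) *
        (\<integral>\<^sup>+u. f (\<lambda>l. if l < Suc r then d l + (\<Sum>j\<in>{l..<m}. t j l * u j) else u l) \<partial>?M))"
      by (simp only:)
  qed (use Suc.prems in simp)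
  also have "\<dots> = ennreal (\<Prod>l<Suc r. t l l) *
    (\<integral>\<^sup>+u. f (\<lambda>l. if l < Suc r then d l + (\<Sum>j\<in>{l..<m}. t j l * u j) else u l) \<partial>?M)"
  proof -
    have "ennreal \<bar>t r r\<bar> * ennreal (\<Prod>l<r. t l l) = ennreal (\<Prod>l<Suc r. t l l)"
      using t[of r] t Suc.prems by (subst ennreal_mult[symmetric]) (auto intro!: prod_nonneg simp: mult.commute less_imp_le)
    then show ?thesis by (simp only: mult.assoc[symmetric])
  qed
  finally show ?case .
qed simp

lemma tri_volume:
  assumes t: "\<And>l. l < m \<Longrightarrow> t l l > 0" and S: "S \<in> sets (Pi\<^sub>M {..<m} (\<lambda>_. lborel :: real measure))"
  shows "emeasure (Pi\<^sub>M {..<m} (\<lambda>_. lborel)) S =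
    ennreal (\<Prod>l<m. t l l) * emeasure (Pi\<^sub>M {..<m} (\<lambda>_. lborel)) {u \<in> Rm m. tri m d t u \<in> S}"
proof -
  let ?M = "Pi\<^sub>M {..<m} (\<lambda>_. lborel :: real measure)"
  have "tri m d t \<in> measurable ?M ?M"
    unfolding tri_def[abs_def]
    by (intro measurable_restrict) (auto intro!: borel_measurable_add borel_measurable_sum borel_measurable_times measurable_component_singleton simp: measurable_lborel2)
  then have m: "{u \<in> Rm m. tri m d t u \<in> S} \<in> sets ?M"
  proof -
    assume "tri m d t \<in> measurable ?M ?M"
    from measurable_sets[OF this S] have "tri m d t -` S \<inter> Rm m \<in> sets ?M"
      unfolding space_PiM_lborel .
    moreover have "tri m d t -` S \<inter> Rm m = {u \<in> Rm m. tri m d t u \<in> S}" by blast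
    ultimately show ?thesis by simp
  qed
  have "emeasure ?M S = (\<integral>\<^sup>+u. indicator S u \<partial>?M)" using S by simp
  also have "\<dots> = ennreal (\<Prod>l<m. t l l) *
      (\<integral>\<^sup>+u. indicator S (\<lambda>l. if l < m then d l + (\<Sum>j\<in>{l..<m}. t j l * u j) else u l) \<partial>?M)"
    using S by (intro tri_nn_integral t) auto
  also have "(\<integral>\<^sup>+u. indicator S (\<lambda>l. if l < m then d l + (\<Sum>j\<in>{l..<m}. t j l * u j) else u l) \<partial>?M)
      = (\<integral>\<^sup>+u. indicator {u \<in> Rm m. tri m d t u \<in> S} u \<partial>?M)"
  proof (rule nn_integral_cong)
    fix u assume "u \<in> space ?M"
    then have u: "u \<in> Rm m" by (simp only: space_PiM_lborel)
    then have "(\<lambda>l. if l < m then d l + (\<Sum>j\<in>{l..<m}. t j l * u j) else u l) = tri m d t u"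
      by (auto simp: tri_def Rm_def fun_eq_iff PiE_def extensional_def)
    then show "indicator S (\<lambda>l. if l < m then d l + (\<Sum>j\<in>{l..<m}. t j l * u j) else u l) =
      (indicator {u \<in> Rm m. tri m d t u \<in> S} u :: ennreal)"
      using u by (simp add: indicator_def)
  qed
  finally show ?thesis using m by simp
qed

lemma quadric_sets:
  "{u \<in> Rm m. (\<Sum>l<m. (d l + (\<Sum>j\<in>{l..<m}. t j l * u j))\<^sup>2) \<le> (\<rho>::real)} \<in> sets (Pi\<^sub>M {..<m} (\<lambda>_. lborel :: real measure))"
proof -
  let ?M = "Pi\<^sub>M {..<m} (\<lambda>_. lborel :: real measure)"
  have "(\<lambda>u. \<Sum>l<m. (d l + (\<Sum>j\<in>{l..<m}. t j l * u j))\<^sup>2) \<in> borel_measurable ?M"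
    by (intro borel_measurable_sum borel_measurable_power borel_measurable_add borel_measurable_times borel_measurable_const)
       (auto intro!: measurable_component_singleton simp: measurable_lborel2)
  then show ?thesis unfolding space_PiM_lborel[symmetric] by measurable
qed

text \<open>Arithmetic and geometric means, through \<open>1 + x \<le> exp x\<close> at the numbers
  \<open>m * (r l)^2 - 1\<close>.\<close>

lemma amgm_prod_le:
  fixes r :: "nat \<Rightarrow> real"
  assumes r: "\<And>l. l < m \<Longrightarrow> r l > 0" and le: "(\<Sum>l<m. (r l)\<^sup>2) \<le> 1" and m: "m > 0"
  shows "(\<Prod>l<m. r l) \<le> (1 / sqrt (real m)) ^ m"
proof -
  define s where "s l = sqrt (real m) * r l" for l
  have s: "s l > 0" if "l < m" for l using r[OF that] m by (simp add: s_def)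
  have "(\<Prod>l<m. (s l)\<^sup>2) \<le> exp (\<Sum>l<m. (s l)\<^sup>2 - 1)"
    unfolding exp_sum[OF finite_lessThan]
    by (intro prod_mono) (auto intro: order_trans[OF _ exp_ge_add_one_self])
  also have "(\<Sum>l<m. (s l)\<^sup>2 - 1) \<le> 0"
  proof -
    have "(\<Sum>l<m. (s l)\<^sup>2) = real m * (\<Sum>l<m. (r l)\<^sup>2)"
      by (simp add: s_def power_mult_distrib sum_distrib_left)
    also have "\<dots> \<le> real m" using le by (simp add: mult_left_le)
    finally show ?thesis by (simp add: sum_subtractf)
  qed
  finally have "(\<Prod>l<m. s l)\<^sup>2 \<le> 1\<^sup>2" by (simp add: prod_power_distrib)
  then have "(\<Prod>l<m. s l) \<le> 1" by (rule power2_le_imp_le) simp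
  then have "sqrt (real m) ^ m * (\<Prod>l<m. r l) \<le> 1" by (simp add: s_def prod.distrib)
  then show ?thesis using m by (simp add: power_one_over field_simps)
qed

text \<open>Both sets are preimages of the unit ball, one under scaling by 1 / sqrt m and one under
  the triangular map \<open>r\<close>; \<open>amgm_prod_le\<close> compares the products of the
  diagonals.\<close>

lemma quadric_volume_ge:
  assumes r: "\<And>l. l < m \<Longrightarrow> r l l > 0" and le: "(\<Sum>l<m. (r l l)\<^sup>2) \<le> 1" and m: "m > 0"
  shows "emeasure (Pi\<^sub>M {..<m} (\<lambda>_. lborel)) {u \<in> Rm m. (\<Sum>l<m. (u l)\<^sup>2) \<le> real m} \<le>
    emeasure (Pi\<^sub>M {..<m} (\<lambda>_. lborel)) {u \<in> Rm m. (\<Sum>l<m. (d l + (\<Sum>j\<in>{l..<m}. r j l * u j))\<^sup>2) \<le> 1}"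
    (is "emeasure ?M ?B \<le> emeasure ?M ?Y")
proof -
  let ?U = "{u \<in> Rm m. (\<Sum>l<m. (u l)\<^sup>2) \<le> (1::real)}"
  have id: "(\<Sum>l<m. (0 + (\<Sum>j\<in>{l..<m}. (if j = l then c else 0) * u j))\<^sup>2) = (\<Sum>l<m. (c * u l)\<^sup>2)" for c and u :: "nat \<Rightarrow> real"
    by (intro sum.cong) (auto simp: if_distrib[of "\<lambda>c. c * _"] cong: if_cong)
  have U: "?U \<in> sets ?M" using quadric_sets[of m "\<lambda>_. 0" "\<lambda>j l. if j = l then 1 else 0" 1] unfolding id by simp
  have s: "1 / sqrt (real m) > 0" using m by simp
  define C where "C = ennreal ((1 / sqrt (real m)) ^ m)"
  have C: "C \<noteq> 0" "C \<noteq> top" using s by (auto simp: C_def)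
  have "emeasure ?M ?U = ennreal (\<Prod>l<m. (\<lambda>j l. if j = l then 1 / sqrt (real m) else 0) l l) * emeasure ?M
      {u \<in> Rm m. tri m (\<lambda>_. 0) (\<lambda>j l. if j = l then 1 / sqrt (real m) else 0) u \<in> ?U}"
    by (rule tri_volume[OF _ U]) (use s in simp)
  also have "{u \<in> Rm m. tri m (\<lambda>_. 0) (\<lambda>j l. if j = l then 1 / sqrt (real m) else 0) u \<in> ?U} = ?B"
  proof -
    have "(\<Sum>l<m. (tri m (\<lambda>_. 0) (\<lambda>j l. if j = l then 1 / sqrt (real m) else 0) u l)\<^sup>2) = (\<Sum>l<m. (u l)\<^sup>2) / real m" for u
    proof -
      have "(\<Sum>l<m. (tri m (\<lambda>_. 0) (\<lambda>j l. if j = l then 1 / sqrt (real m) else 0) u l)\<^sup>2) = (\<Sum>l<m. (1 / sqrt (real m) * u l)\<^sup>2)"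
        unfolding id[symmetric] by (intro sum.cong) (auto simp: tri_def)
      then show ?thesis by (simp add: power_divide sum_divide_distrib)
    qed
    then show ?thesis using m tri_Rm by (auto simp: divide_le_eq)
  qed
  finally have 1: "emeasure ?M ?U = C * emeasure ?M ?B" by (simp add: C_def)
  have "emeasure ?M ?U = ennreal (\<Prod>l<m. r l l) * emeasure ?M {u \<in> Rm m. tri m d r u \<in> ?U}"
    by (rule tri_volume[OF r U])
  also have "{u \<in> Rm m. tri m d r u \<in> ?U} = ?Y"
    using tri_Rm by (auto simp: tri_def)
  finally have "emeasure ?M ?U = ennreal (\<Prod>l<m. r l l) * emeasure ?M ?Y" .
  also have "\<dots> \<le> C * emeasure ?M ?Y"
    unfolding C_def by (intro mult_right_mono ennreal_leI amgm_prod_le[OF r le m]) auto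
  finally show ?thesis unfolding 1 using C by (simp add: ennreal_mult_le_mult_iff)
qed

lemma triangular_sum:
  fixes \<tau> :: "nat \<Rightarrow> nat \<Rightarrow> real"
  shows "(\<Sum>j<m. u j * (\<Sum>l\<le>j. \<tau> j l * X l)) = (\<Sum>l<m. (\<Sum>j\<in>{l..<m}. \<tau> j l * u j) * X l)"
proof -
  have "(\<Sum>j<m. u j * (\<Sum>l\<le>j. \<tau> j l * X l)) = (\<Sum>j<m. \<Sum>l<m. if l \<le> j then \<tau> j l * u j * X l else 0)"
  proof (intro sum.cong refl)
    fix j assume "j \<in> {..<m}"
    then have "(\<Sum>l\<le>j. u j * (\<tau> j l * X l)) = (\<Sum>l<m. if l \<le> j then \<tau> j l * u j * X l else 0)"
      by (intro sum.mono_neutral_cong_left) auto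
    then show "u j * (\<Sum>l\<le>j. \<tau> j l * X l) = (\<Sum>l<m. if l \<le> j then \<tau> j l * u j * X l else 0)"
      by (simp add: sum_distrib_left)
  qed
  also have "\<dots> = (\<Sum>l<m. \<Sum>j<m. if l \<le> j then \<tau> j l * u j * X l else 0)" by (rule sum.swap)
  also have "\<dots> = (\<Sum>l<m. \<Sum>j\<in>{l..<m}. \<tau> j l * u j * X l)"
    by (intro sum.cong refl sum.mono_neutral_cong_right) auto
  finally show ?thesis by (simp add: sum_distrib_right)
qed

text \<open>Sequences vanish from \<open>m\<close> on instead of being undefined there as in
  \<open>Rm m\<close>, so that the zero function and pointwise sums stay in the space.\<close>

lemma inner_fun_coords: "inner_fun {f :: nat \<Rightarrow> real. \<forall>l\<ge>m. f l = 0} (\<lambda>f g. \<Sum>l<m. f l * g l)"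
proof
  fix f :: "nat \<Rightarrow> real" assume f: "f \<in> {f. \<forall>l\<ge>m. f l = 0}" "f \<noteq> (\<lambda>x. 0)"
  from f(2) obtain l where "f l \<noteq> 0" by blast
  moreover have "l < m" using f(1) \<open>f l \<noteq> 0\<close> by (simp add: not_le[symmetric]) blast
  moreover from \<open>f l \<noteq> 0\<close> have "0 < (f l)\<^sup>2" by simp
  ultimately show "(\<Sum>l<m. f l * f l) > 0"
    by (intro sum_pos2[of "{..<m}" l]) (auto simp: power2_eq_square)
next
  fix f g h :: "nat \<Rightarrow> real" and c :: real
  show "(\<Sum>l<m. f l * g l) = (\<Sum>l<m. g l * f l)" by (simp only: mult.commute)
  show "(\<Sum>l<m. (f l + g l) * h l) = (\<Sum>l<m. f l * h l) + (\<Sum>l<m. g l * h l)"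
    by (simp only: distrib_right sum.distrib)
  show "(\<Sum>l<m. (c * f l) * h l) = c * (\<Sum>l<m. f l * h l)"
    by (simp only: sum_distrib_left mult.assoc)
qed auto

section \<open>Affine charts of the hyperplane of forms with mean 1\<close>

lemma Mset_forms: "f \<in> Mset k \<Longrightarrow> f \<in> forms (2 * k)"
  by (simp add: Mset_def)

lemma norm_Mset: "(\<lambda>x::real^'n::finite. norm x ^ (2 * k)) \<in> Mset k"
proof -
  have "sph_int (\<lambda>x::real^'n. norm x ^ (2 * k)) = sph_int (\<lambda>x::real^'n. 1)"
    by (rule sph_int_cong) (auto intro!: continuous_intros)
  then show ?thesis by (simp add: Mset_def norm_power_forms)
qed

lemma sph_int_lincomb:
  fixes f :: "'i \<Rightarrow> real^'n::finite \<Rightarrow> real"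
  assumes "\<And>i. i \<in> I \<Longrightarrow> f i \<in> forms d"
  shows "sph_int (\<lambda>x. \<Sum>i\<in>I. c i * f i x) = (\<Sum>i\<in>I. c i * sph_int (f i))"
  by (subst sph_int_sum) (auto intro!: continuous_intros forms_continuous[OF assms] simp: sph_int_cmult)

lemma sph_int_forms_add:
  "f \<in> forms d \<Longrightarrow> g \<in> forms d \<Longrightarrow> sph_int (\<lambda>x. f x + g x) = sph_int f + sph_int g"
  "f \<in> forms d \<Longrightarrow> g \<in> forms d \<Longrightarrow> sph_int (\<lambda>x. f x - g x) = sph_int f - sph_int g"
  by (auto intro!: sph_int_add sph_int_diff forms_continuous)

text \<open>Evaluation at a coordinate vector reads off the coefficient of the pure power of that
  coordinate; \<open>ex_chart\<close> uses this to single out one monomial.\<close>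

lemma monomial_axis:
  assumes "\<alpha> \<in> exps d"
  shows "monomial \<alpha> (axis i 1 :: real^'n::finite) = (if \<alpha> = (\<lambda>j. if j = i then d else 0) then 1 else 0)"
proof (cases "\<exists>j. j \<noteq> i \<and> \<alpha> j > 0")
  case True
  then obtain j where j: "j \<noteq> i" "\<alpha> j > 0" by blast
  then have "(axis i 1 :: real^'n) $ j ^ \<alpha> j = 0" by (simp add: axis_def)
  then have "monomial \<alpha> (axis i 1 :: real^'n) = 0"
    unfolding monomial_def using prod_zero[of UNIV "\<lambda>j. (axis i 1 :: real^'n) $ j ^ \<alpha> j"] by auto
  then show ?thesis using j by auto
next
  case False
  then have z: "\<alpha> j = 0" if "j \<noteq> i" for j using that by auto
  have "sum \<alpha> UNIV = \<alpha> i" using z by (subst sum.remove[of _ i]) auto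
  then have "\<alpha> i = d" using assms by (simp add: exps_def)
  then have "\<alpha> = (\<lambda>j. if j = i then d else 0)" using z by auto
  moreover have "monomial \<alpha> (axis i 1 :: real^'n) = 1"
    unfolding monomial_def by (intro prod.neutral) (auto simp: axis_def z)
  ultimately show ?thesis by simp
qed

text \<open>\<open>vol_in\<close> picks a chart by \<open>SOME\<close>, which says something only
  once a chart exists. Here r^(2k) is the origin and takes the place of the pure power
  \<open>\<alpha>0\<close>: both have value 1 at the chosen axis, where the other monomials
  vanish.\<close>

lemma ex_chart:
  "\<exists>c w. affine_chart (Mset k :: (real^'n::finite \<Rightarrow> real) set) (Ddim CARD('n) (2 * k) - 1) c w"
proof -
  let ?m = "Ddim CARD('n) (2 * k) - 1"
  let ?r = "\<lambda>x::real^'n. norm x ^ (2 * k)"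
  define i :: 'n where "i = undefined"
  define \<alpha>0 where "\<alpha>0 = (\<lambda>j. if j = i then 2 * k else 0)"
  let ?a = "axis i 1 :: real^'n"
  define X where "X = exps (2 * k) - {\<alpha>0}"
  have \<alpha>0: "\<alpha>0 \<in> exps (2 * k)" by (simp add: \<alpha>0_def exps_def)
  have fX: "finite X" and cX: "card X = ?m"
    using \<alpha>0 by (auto simp: X_def finite_exps card_exps)
  obtain h where h: "bij_betw h {..<?m} X"
    using ex_bij_betw_nat_finite[OF fX] by (auto simp: cX lessThan_atLeast0)
  have hX: "h j \<in> X" if "j < ?m" for j using h that by (auto dest: bij_betwE)
  then have he: "h j \<in> exps (2 * k)" "h j \<noteq> \<alpha>0" if "j < ?m" for j using that by (auto simp: X_def)
  define p where "p j = (monomial (h j) :: real^'n \<Rightarrow> real)" for j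
  have pF: "p j \<in> forms (2 * k)" if "j < ?m" for j unfolding p_def by (rule monomial_forms[OF he(1)[OF that]])
  have pa: "p j ?a = 0" if "j < ?m" for j
    using monomial_axis[OF he(1)[OF that], of i] he(2)[OF that] by (simp add: p_def \<alpha>0_def)
  \<comment> \<open>Removing the mean makes the direction parallel to \<open>Mset\<close>.\<close>
  define w where "w j = (\<lambda>x. p j x - sph_int (p j) * ?r x)" for j
  have ind: "\<forall>j<?m. v j = 0" if v: "\<And>x. (\<Sum>j<?m. v j * p j x) = 0" for v
  proof -
    define c where "c \<alpha> = (if \<alpha> \<in> X then v (the_inv_into {..<?m} h \<alpha>) else 0)" for \<alpha>
    have ch: "c (h j) = v j" if "j < ?m" for j
      using h hX that by (simp add: c_def the_inv_into_f_f bij_betw_def)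
    have "(\<Sum>\<alpha>\<in>exps (2 * k). c \<alpha> * monomial \<alpha> x) = 0" for x :: "real^'n"
    proof -
      have "(\<Sum>\<alpha>\<in>exps (2 * k). c \<alpha> * monomial \<alpha> x) = (\<Sum>\<alpha>\<in>X. c \<alpha> * monomial \<alpha> x)"
        by (intro sum.mono_neutral_right) (auto simp: finite_exps X_def c_def)
      also have "\<dots> = (\<Sum>j<?m. c (h j) * monomial (h j) x)" by (rule sum.reindex_bij_betw[OF h, symmetric])
      also have "\<dots> = (\<Sum>j<?m. v j * p j x)" using ch by (intro sum.cong) (auto simp: p_def)
      finally show ?thesis using v by simp
    qed
    then have z: "(\<lambda>x::real^'n. \<Sum>\<alpha>\<in>exps (2 * k). c \<alpha> * monomial \<alpha> x) = (\<lambda>x. 0)" by blast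
    show ?thesis using monomials_independent[OF z he(1)] ch by metis
  qed
  have wsum: "(\<Sum>j<?m. u j * w j x) = (\<Sum>j<?m. u j * p j x) - (\<Sum>j<?m. u j * sph_int (p j)) * ?r x" for u x
    by (simp add: w_def right_diff_distrib sum_subtractf sum_distrib_right mult.assoc)
  have psa: "(\<Sum>j<?m. u j * p j ?a) = 0" for u using pa by (intro sum.neutral) auto
  have "bij_betw (aff_param ?r w ?m) (Rm ?m) (Mset k)"
  proof (rule bij_betw_imageI)
    show "inj_on (aff_param ?r w ?m) (Rm ?m)"
    proof (rule inj_onI)
      fix u u' assume u: "u \<in> Rm ?m" "u' \<in> Rm ?m" "aff_param ?r w ?m u = aff_param ?r w ?m u'"
      define v where "v j = u j - u' j" for j
      have "(\<Sum>j<?m. v j * w j x) = 0" for x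
        using fun_cong[OF u(3), of x] by (simp add: aff_param_def v_def left_diff_distrib sum_subtractf)
      then have e: "(\<Sum>j<?m. v j * p j x) = (\<Sum>j<?m. v j * sph_int (p j)) * ?r x" for x
        unfolding wsum by (simp add: algebra_simps)
      have "(\<Sum>j<?m. v j * sph_int (p j)) = 0"
        using e[of ?a] psa by simp
      then have "\<forall>j<?m. v j = 0" using e by (intro ind) simp
      then show "u = u'"
        using u by (intro PiE_ext[of u "{..<?m}" "\<lambda>_. UNIV" u']) (auto simp: Rm_def v_def)
    qed
    show "aff_param ?r w ?m ` Rm ?m = Mset k"
    proof (intro set_eqI iffI)
      fix f assume "f \<in> aff_param ?r w ?m ` Rm ?m"
      then obtain u where f: "f = (\<lambda>x. ?r x + (\<Sum>j<?m. u j * w j x))" by (auto simp: aff_param_def)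
      have wF: "w j \<in> forms (2 * k)" if "j < ?m" for j
        unfolding w_def by (intro forms_diff forms_scale pF[OF that] norm_power_forms)
      have ws: "sph_int (w j) = 0" if "j < ?m" for j
        using norm_Mset[of k, where 'n = 'n] sph_int_forms_add(2)[OF pF[OF that] forms_scale[OF norm_power_forms], of "sph_int (p j)"]
        by (simp add: w_def sph_int_cmult Mset_def)
      have sF: "(\<lambda>x. \<Sum>j<?m. u j * w j x) \<in> forms (2 * k)" by (intro forms_sum forms_scale wF) auto
      have "sph_int f = 1 + (\<Sum>j<?m. u j * sph_int (w j))"
        unfolding f sph_int_forms_add(1)[OF norm_power_forms sF]
        using norm_Mset[of k, where 'n = 'n] wF by (subst sph_int_lincomb[where d = "2 * k"]) (auto simp: Mset_def)
      then show "f \<in> Mset k" using ws sF by (auto simp: Mset_def f norm_power_forms)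
    next
      fix f :: "real^'n \<Rightarrow> real" assume fM: "f \<in> Mset k"
      \<comment> \<open>The value at \<open>?a\<close> is the coefficient of
        \<open>\<alpha>0\<close>, so this multiple of r^(2k) removes that coefficient and leaves a
        combination of the other monomials.\<close>
      define g where "g = (\<lambda>x. f x - f ?a * ?r x)"
      have "g \<in> forms (2 * k)" unfolding g_def by (intro forms_diff forms_scale norm_power_forms Mset_forms fM)
      then obtain c where g: "g = (\<lambda>x. \<Sum>\<alpha>\<in>exps (2 * k). c \<alpha> * monomial \<alpha> x)" unfolding forms_def by blast
      have "c \<alpha>0 = g ?a"
      proof -
        have "g ?a = (\<Sum>\<alpha>\<in>exps (2 * k). if \<alpha> = \<alpha>0 then c \<alpha> else 0)"
          unfolding g by (intro sum.cong) (auto simp: monomial_axis \<alpha>0_def)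
        then show ?thesis using \<alpha>0 by (simp add: finite_exps)
      qed
      then have c0: "c \<alpha>0 = 0" by (simp add: g_def)
      define u where "u = (\<lambda>j\<in>{..<?m}. c (h j))"
      have gp: "g x = (\<Sum>j<?m. u j * p j x)" for x
      proof -
        have "g x = (\<Sum>\<alpha>\<in>X. c \<alpha> * monomial \<alpha> x)"
          unfolding g by (intro sum.mono_neutral_right) (auto simp: finite_exps X_def c0)
        also have "\<dots> = (\<Sum>j<?m. c (h j) * monomial (h j) x)" by (rule sum.reindex_bij_betw[OF h, symmetric])
        finally show ?thesis by (simp add: u_def p_def)
      qed
      have "(\<Sum>j<?m. u j * sph_int (p j)) = sph_int g"
        unfolding gp[abs_def] using pF by (subst sph_int_lincomb[where d = "2 * k"]) auto
      also have "\<dots> = 1 - f ?a"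
        unfolding g_def sph_int_forms_add(2)[OF Mset_forms[OF fM] forms_scale[OF norm_power_forms]]
        using fM norm_Mset[of k, where 'n = 'n] by (simp add: sph_int_cmult Mset_def)
      finally have S: "(\<Sum>j<?m. u j * sph_int (p j)) = 1 - f ?a" .
      have "f = aff_param ?r w ?m u"
        unfolding aff_param_def wsum gp[symmetric] S by (simp add: g_def algebra_simps)
      moreover have "u \<in> Rm ?m" by (simp add: u_def Rm_def)
      ultimately show "f \<in> aff_param ?r w ?m ` Rm ?m" by blast
    qed
  qed
  then show ?thesis unfolding affine_chart_def by blast
qed

text \<open>Unpacks a chart into linear algebra: unit parameter vectors exhibit the directions as
  differences of points of \<open>Mset\<close>. The parameters may be arbitrary functions because
  \<open>aff_param\<close> reads only the indices below \<open>m\<close>.\<close>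

lemma affine_chartD:
  fixes c :: "real^'n::finite \<Rightarrow> real"
  assumes ch: "affine_chart (Mset k) m c w"
  shows "c \<in> Mset k" and "j < m \<Longrightarrow> w j \<in> forms (2 * k)" and "j < m \<Longrightarrow> sph_int (w j) = 0"
    and "(\<lambda>x. \<Sum>j<m. u j * w j x) = (\<lambda>x. 0) \<Longrightarrow> \<forall>j<m. u j = 0"
    and "f \<in> Mset k \<Longrightarrow> \<exists>u. f = (\<lambda>x. c x + (\<Sum>j<m. u j * w j x))"
    and "(\<lambda>x. c x + (\<Sum>j<m. u j * w j x)) \<in> Mset k"
proof -
  have inM: "(\<lambda>x. c x + (\<Sum>j<m. u j * w j x)) \<in> Mset k" for u
  proof -
    have "aff_param c w m (restrict u {..<m}) \<in> Mset k"
      using ch by (auto simp: affine_chart_def Rm_def dest!: bij_betwE)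
    then show ?thesis by (simp add: aff_param_def)
  qed
  then show "(\<lambda>x. c x + (\<Sum>j<m. u j * w j x)) \<in> Mset k" .
  show c: "c \<in> Mset k" using inM[of "\<lambda>_. 0"] by simp
  have w: "w j \<in> forms (2 * k) \<and> sph_int (w j) = 0" if "j < m" for j
  proof -
    have "(\<lambda>x. c x + w j x) \<in> Mset k"
      using inM[of "\<lambda>i. if i = j then 1 else 0"] that by (simp add: if_distrib[of "\<lambda>c. c * _"] cong: if_cong)
    moreover have "w j = (\<lambda>x. (c x + w j x) - c x)" by simp
    ultimately show ?thesis
      using forms_diff[of "\<lambda>x. c x + w j x" "2 * k" c] sph_int_forms_add(2)[of "\<lambda>x. c x + w j x" "2 * k" c] c
      by (simp add: Mset_def)
  qed
  then show "j < m \<Longrightarrow> w j \<in> forms (2 * k)" "j < m \<Longrightarrow> sph_int (w j) = 0" by auto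
  show "\<forall>j<m. u j = 0" if z: "(\<lambda>x. \<Sum>j<m. u j * w j x) = (\<lambda>x. 0)"
  proof -
    have "aff_param c w m (restrict u {..<m}) = aff_param c w m (\<lambda>j\<in>{..<m}. 0)"
      using z by (simp add: aff_param_def fun_eq_iff)
    moreover have "restrict u {..<m} \<in> Rm m" "(\<lambda>j\<in>{..<m}. 0) \<in> Rm m" by (auto simp: Rm_def)
    ultimately have "restrict u {..<m} = (\<lambda>j\<in>{..<m}. 0)"
      using ch unfolding affine_chart_def bij_betw_def by (metis inj_onD)
    then show ?thesis by (metis lessThan_iff restrict_apply')
  qed
  show "\<exists>u. f = (\<lambda>x. c x + (\<Sum>j<m. u j * w j x))" if "f \<in> Mset k"
    using ch that unfolding affine_chart_def bij_betw_def aff_param_def by blast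
qed

lemma ennreal_mult_le_cancel:
  "0 < c \<Longrightarrow> ennreal c * a \<le> ennreal c * b \<longleftrightarrow> a \<le> b"
  by (rule ennreal_mult_le_mult_iff) auto

section \<open>The Loewner ellipsoid\<close>

text \<open>In \<open>Mset\<close> the squared norm is 1 plus the squared distance from r^(2k), so
  the squared radius about that form is \<open>m\<close>. For m = D(n,2k) - 1 the bound
  \<open>m + 1\<close> is the squared norm of the kernels at unit vectors.\<close>

definition ballM :: "nat \<Rightarrow> nat \<Rightarrow> (real^'n::finite \<Rightarrow> real) set" where
  "ballM k m = Rop k ` {g \<in> Mset k. ip g g \<le> real m + 1}"

definition mean_zero :: "nat \<Rightarrow> (real^'n::finite \<Rightarrow> real) set" where
  "mean_zero k = {g \<in> forms (2 * k). sph_int g = 0}"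

lemma Rop_add:
  "f \<in> forms (2 * k) \<Longrightarrow> g \<in> forms (2 * k) \<Longrightarrow> Rop k (\<lambda>x. f x + g x) = (\<lambda>x::real^'n::finite. Rop k f x + Rop k g x)"
  using Rop_lincomb[of "{0, 1::nat}" "\<lambda>i. if i = 0 then f else g" "2 * k" k "\<lambda>i. 1"] by simp

lemma Rop_diff:
  "f \<in> forms (2 * k) \<Longrightarrow> g \<in> forms (2 * k) \<Longrightarrow> Rop k (\<lambda>x. f x - g x) = (\<lambda>x::real^'n::finite. Rop k f x - Rop k g x)"
  using Rop_lincomb[of "{0, 1::nat}" "\<lambda>i. if i = 0 then f else g" "2 * k" k "\<lambda>i. if i = 0 then 1 else -1"] by simp

lemma Rop_scale: "Rop k (\<lambda>x. c * f x) = (\<lambda>x. c * Rop k f x)"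
  by (rule ext) (simp add: Rop_def mult.assoc sph_int_cmult)

lemma Rop_Mset:
  fixes g :: "real^'n::finite \<Rightarrow> real"
  assumes n: "CARD('n) \<ge> 2"
  shows "g \<in> Mset k \<Longrightarrow> Rop k g \<in> Mset k"
  by (simp add: Mset_def Rop_forms[OF n] sph_int_Rop[OF n])

lemma Rop_Mset_surj:
  fixes f :: "real^'n::finite \<Rightarrow> real"
  assumes n: "CARD('n) \<ge> 2" and "f \<in> Mset k"
  obtains g where "g \<in> Mset k" "f = Rop k g"
  using Rop_surj[OF n, of f k] assms(2) sph_int_Rop[OF n] by (auto simp: Mset_def)

lemma mean_zero_surj:
  fixes f :: "real^'n::finite \<Rightarrow> real"
  assumes n: "CARD('n) \<ge> 2" and "f \<in> forms (2 * k)" "sph_int f = 0"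
  obtains g where "g \<in> mean_zero k" "f = Rop k g"
  using Rop_surj[OF n, of f k] assms(2,3) sph_int_Rop[OF n] by (auto simp: mean_zero_def)

lemma mean_zero_diff: "f \<in> Mset k \<Longrightarrow> g \<in> Mset k \<Longrightarrow> (\<lambda>x. f x - g x) \<in> mean_zero k"
  using sph_int_forms_add(2)[of f "2 * k" g] by (auto simp: mean_zero_def Mset_def)

lemma zkern_Mset:
  fixes v :: "real^'n::finite"
  assumes "norm v = 1" shows "zkern (2 * k) v \<in> Mset k"
  using zkern_reproducing[OF norm_power_forms[of k], of v] sph_int_ip_norm[OF zkern_forms[of "2 * k" v]] assms
  by (simp add: Mset_def zkern_forms)

text \<open>Coordinates in which \<open>ballM k m\<close> is round: an orthonormal basis of the
  mean-zero forms, taken before \<open>Rop\<close> is applied.\<close>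

locale chart_basis =
  fixes k m :: nat and e :: "nat \<Rightarrow> real^'n::finite \<Rightarrow> real"
  assumes n: "CARD('n) \<ge> 2"
    and e_mean_zero: "j < m \<Longrightarrow> e j \<in> mean_zero k"
    and e_orth: "i < m \<Longrightarrow> j < m \<Longrightarrow> ip (e i) (e j) = (if i = j then 1 else 0)"
    and e_complete: "g \<in> mean_zero k \<Longrightarrow> g = (\<lambda>x. \<Sum>l<m. ip g (e l) * e l x)"
begin

sublocale P: inner_fun "forms (2 * k) :: (real^'n \<Rightarrow> real) set" ip by (rule inner_fun_forms)

abbreviation "r2k \<equiv> \<lambda>x::real^'n. norm x ^ (2 * k)"

definition pt :: "(nat \<Rightarrow> real) \<Rightarrow> real^'n \<Rightarrow> real" where
  "pt y = (\<lambda>x. norm x ^ (2 * k) + (\<Sum>l<m. y l * Rop k (e l) x))"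

text \<open>The preimage of \<open>pt y\<close> under \<open>Rop\<close> (\<open>pt_pre\<close>), on
  the side where the basis is orthonormal.\<close>

definition pre :: "(nat \<Rightarrow> real) \<Rightarrow> real^'n \<Rightarrow> real" where
  "pre y = (\<lambda>x. norm x ^ (2 * k) + (\<Sum>l<m. y l * e l x))"

lemma eF: "j < m \<Longrightarrow> e j \<in> forms (2 * k)" "j < m \<Longrightarrow> sph_int (e j) = 0"
  using e_mean_zero by (auto simp: mean_zero_def)

lemma sumF: "(\<lambda>x. \<Sum>l<m. y l * e l x) \<in> forms (2 * k)"
  by (intro forms_sum forms_scale eF) auto

lemma sph_int_sum_e: "sph_int (\<lambda>x. \<Sum>l<m. y l * e l x) = 0"
  using eF by (subst sph_int_lincomb[where d = "2 * k"]) auto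

lemma pre_Mset: "pre y \<in> Mset k"
  using norm_Mset[of k, where 'n = 'n] sph_int_forms_add(1)[OF norm_power_forms sumF, of y] sumF[of y]
  by (auto simp: pre_def Mset_def sph_int_sum_e)

lemma pt_pre: "pt y = Rop k (pre y)"
  unfolding pt_def pre_def Rop_add[OF norm_power_forms sumF] Rop_norm[OF n]
  using eF by (subst Rop_lincomb[where d = "2 * k"]) auto

lemma pt_Mset: "pt y \<in> Mset k"
  unfolding pt_pre by (rule Rop_Mset[OF n pre_Mset])

lemma ip_sum_e: "ip (\<lambda>x. \<Sum>l<m. y l * e l x) (\<lambda>x. \<Sum>l<m. z l * e l x) = (\<Sum>l<m. y l * z l)"
proof -
  have "ip (\<lambda>x. \<Sum>l<m. y l * e l x) (\<lambda>x. \<Sum>l<m. z l * e l x) = (\<Sum>l<m. y l * ip (\<lambda>x. \<Sum>l<m. z l * e l x) (e l))"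
    by (subst P.B_lincomb) (auto simp: sumF eF ip_sym)
  also have "\<dots> = (\<Sum>l<m. y l * z l)"
    using P.expansion_coeff[OF eF(1) e_orth refl] by (intro sum.cong) auto
  finally show ?thesis .
qed

lemma ip_pre: "ip (pre y) (pre y) = 1 + (\<Sum>l<m. (y l)\<^sup>2)"
proof -
  let ?s = "\<lambda>x. \<Sum>l<m. y l * e l x"
  have rr: "ip r2k r2k = 1"
    using sph_int_ip_norm[OF norm_power_forms[of k, where 'n = 'n]] norm_Mset[of k, where 'n = 'n] by (simp add: Mset_def)
  have sr: "ip ?s r2k = 0" using sph_int_ip_norm[OF sumF] sph_int_sum_e by simp
  have pF: "pre y \<in> forms (2 * k)" using pre_Mset Mset_forms by blast
  have p: "ip (pre y) g = ip r2k g + ip ?s g" if "g \<in> forms (2 * k)" for g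
    unfolding pre_def by (rule P.B_add[OF norm_power_forms sumF that])
  have "ip (pre y) (pre y) = ip (pre y) r2k + ip (pre y) ?s"
    unfolding p[OF pF] by (simp only: ip_sym[of r2k "pre y"] ip_sym[of ?s "pre y"])
  also have "\<dots> = 1 + ip ?s ?s"
    unfolding p[OF norm_power_forms] p[OF sumF] ip_sym[of r2k ?s] rr sr by simp
  finally show ?thesis unfolding ip_sum_e by (simp add: power2_eq_square)
qed

lemma pre_surj:
  assumes "g \<in> Mset k" obtains y where "g = pre y"
proof -
  have "(\<lambda>x. g x - r2k x) \<in> mean_zero k" by (rule mean_zero_diff[OF assms norm_Mset])
  from fun_cong[OF e_complete[OF this], unfolded diff_eq_eq]
  have "g x = r2k x + (\<Sum>l<m. ip (\<lambda>x. g x - r2k x) (e l) * e l x)" for x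
    by (rule trans[OF _ add.commute])
  then have "g = pre (\<lambda>l. ip (\<lambda>x. g x - r2k x) (e l))" unfolding pre_def by blast
  then show ?thesis by (rule that)
qed

lemma pre_inj:
  assumes "pre y = pre z" "l < m" shows "y l = z l"
proof -
  have "(\<lambda>x. \<Sum>l<m. y l * e l x) = (\<lambda>x. \<Sum>l<m. z l * e l x)"
    using fun_cong[OF assms(1)] unfolding pre_def by simp
  then show ?thesis
    using P.expansion_coeff[OF eF(1) e_orth refl assms(2), of y] P.expansion_coeff[OF eF(1) e_orth refl assms(2), of z]
    by (simp only:)
qed

lemma pt_inj: "pt y = pt z \<Longrightarrow> l < m \<Longrightarrow> y l = z l"
  unfolding pt_pre using Rop_inj_on[OF n Mset_forms[OF pre_Mset] Mset_forms[OF pre_Mset]] pre_inj by blast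

lemma pt_surj: assumes "f \<in> Mset k" obtains y where "f = pt y"
  using Rop_Mset_surj[OF n assms] pre_surj pt_pre by metis

lemma pt_ballM: "pt y \<in> ballM k m \<longleftrightarrow> (\<Sum>l<m. (y l)\<^sup>2) \<le> real m"
proof -
  have "pt y \<in> ballM k m \<longleftrightarrow> (\<exists>g\<in>Mset k. ip g g \<le> real m + 1 \<and> Rop k (pre y) = Rop k g)"
    by (auto simp: ballM_def pt_pre)
  also have "\<dots> \<longleftrightarrow> ip (pre y) (pre y) \<le> real m + 1"
    using Rop_inj_on[OF n Mset_forms[OF pre_Mset] Mset_forms] pre_Mset by metis
  finally show ?thesis by (simp add: ip_pre)
qed

lemma ballM_ellipsoid:
  assumes m: "m > 0" shows "ellipsoid_in (Mset k) m (ballM k m :: (real^'n \<Rightarrow> real) set)"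
proof -
  define w where "w l = (\<lambda>x. sqrt (real m) * Rop k (e l) x)" for l
  have ap: "aff_param r2k w m u = pt (\<lambda>l. sqrt (real m) * u l)" for u
    by (auto simp: aff_param_def pt_def w_def mult_ac)
  have sm: "sqrt (real m) > 0" using m by simp
  have bij: "bij_betw (aff_param r2k w m) (Rm m) (Mset k)"
  proof (rule bij_betw_imageI)
    show "inj_on (aff_param r2k w m) (Rm m)"
    proof (rule inj_onI)
      fix u u' assume u: "u \<in> Rm m" "u' \<in> Rm m" "aff_param r2k w m u = aff_param r2k w m u'"
      then have "sqrt (real m) * u l = sqrt (real m) * u' l" if "l < m" for l
        using pt_inj[OF _ that, of "\<lambda>l. sqrt (real m) * u l" "\<lambda>l. sqrt (real m) * u' l"] unfolding ap by simp
      then have "u l = u' l" if "l < m" for l using that sm by simp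
      then show "u = u'" using u by (intro PiE_ext[of u "{..<m}" "\<lambda>_. UNIV" u']) (auto simp: Rm_def)
    qed
    show "aff_param r2k w m ` Rm m = Mset k"
    proof (intro set_eqI iffI)
      fix f :: "real^'n \<Rightarrow> real" assume "f \<in> Mset k"
      then obtain y where y: "f = pt y" by (rule pt_surj)
      have "f = aff_param r2k w m (\<lambda>l\<in>{..<m}. y l / sqrt (real m))"
        unfolding y ap pt_def using sm by (intro ext arg_cong2[where f = "(+)"] refl sum.cong) auto
      then show "f \<in> aff_param r2k w m ` Rm m" by (auto simp: Rm_def)
    qed (auto simp: ap pt_Mset)
  qed
  have sq: "(\<Sum>l<m. (sqrt (real m) * u l)\<^sup>2) \<le> real m \<longleftrightarrow> (\<Sum>l<m. (u l)\<^sup>2) \<le> 1" for u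
  proof -
    have "(\<Sum>l<m. (sqrt (real m) * u l)\<^sup>2) = real m * (\<Sum>l<m. (u l)\<^sup>2)"
      by (simp add: power_mult_distrib sum_distrib_left)
    then show ?thesis using m by simp
  qed
  have "ballM k m = aff_param r2k w m ` {u \<in> Rm m. (\<Sum>j<m. (u j)\<^sup>2) \<le> 1}"
  proof (intro set_eqI iffI)
    fix f :: "real^'n \<Rightarrow> real" assume f: "f \<in> ballM k m"
    then have "f \<in> Mset k" using Rop_Mset[OF n] by (auto simp: ballM_def)
    then obtain u where u: "u \<in> Rm m" "f = aff_param r2k w m u"
      using bij unfolding bij_betw_def by blast
    then show "f \<in> aff_param r2k w m ` {u \<in> Rm m. (\<Sum>j<m. (u j)\<^sup>2) \<le> 1}"
      using f pt_ballM[of "\<lambda>l. sqrt (real m) * u l"] sq[of u] unfolding ap by auto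
  next
    fix f assume "f \<in> aff_param r2k w m ` {u \<in> Rm m. (\<Sum>j<m. (u j)\<^sup>2) \<le> 1}"
    then show "f \<in> ballM k m" using pt_ballM sq unfolding ap by auto
  qed
  then show ?thesis using bij unfolding ellipsoid_in_def affine_chart_def by blast
qed

text \<open>By the reproducing property the coordinates of the kernel are the values
  \<open>e l v\<close>. Averaging over \<open>v\<close> therefore turns products of coordinates into
  inner products of the \<open>e l\<close>, which is the isotropy of the contact points.\<close>

lemma zkern_pre:
  assumes v: "norm v = 1" shows "zkern (2 * k) v = pre (\<lambda>l. e l v)"
proof -
  have z: "zkern (2 * k) v \<in> Mset k" by (rule zkern_Mset[OF v])
  have "(\<lambda>x. zkern (2 * k) v x - r2k x) \<in> mean_zero k" by (rule mean_zero_diff[OF z norm_Mset])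
  note c = e_complete[OF this]
  have i: "ip (\<lambda>x. zkern (2 * k) v x - r2k x) (e l) = e l v" if "l < m" for l
  proof -
    have "ip (\<lambda>x. zkern (2 * k) v x - r2k x) (e l) = ip (zkern (2 * k) v) (e l) - ip r2k (e l)"
      by (rule P.B_diff[OF zkern_forms norm_power_forms eF(1)[OF that]])
    also have "ip r2k (e l) = 0"
      using sph_int_ip_norm[OF eF(1)[OF that]] eF(2)[OF that] by (simp add: ip_sym)
    finally show ?thesis by (simp add: zkern_reproducing[OF eF(1)[OF that]])
  qed
  have "zkern (2 * k) v x = r2k x + (\<Sum>l<m. e l v * e l x)" for x
    using fun_cong[OF c, of x] i by simp
  then show ?thesis unfolding pre_def by blast
qed

text \<open>Integrating the inequality defining an ellipsoid over the points \<open>Rop (zkern v)\<close> bounds its quadratic part.\<close>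

lemma quadric_diag_bound:
  assumes "\<And>v. norm v = 1 \<Longrightarrow> (\<Sum>l<m. (\<delta> l + (\<Sum>j\<in>{l..<m}. r j l * e j v))\<^sup>2) \<le> 1"
  shows "(\<Sum>l<m. (r l l)\<^sup>2) \<le> 1"
proof -
  define z where "z l j = (if j \<ge> l then r j l else 0)" for l j :: nat
  define g where "g l = (\<lambda>v. \<Sum>j<m. z l j * e j v)" for l
  have g_eq: "(\<Sum>j\<in>{l..<m}. r j l * e j v) = g l v" for l v
    unfolding g_def by (intro sum.mono_neutral_cong_left) (auto simp: z_def)
  have gF: "g l \<in> forms (2 * k)" for l unfolding g_def by (rule sumF)
  have cg: "continuous_on UNIV (g l)" for l by (rule forms_continuous[OF gF])
  have "sph_int (\<lambda>v. \<Sum>l<m. (\<delta> l + g l v)\<^sup>2) \<le> sph_int (\<lambda>v::real^'n. 1)"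
    using assms unfolding g_eq by (intro sph_int_mono) (auto intro!: continuous_intros cg)
  moreover have "sph_int (\<lambda>v. \<Sum>l<m. (\<delta> l + g l v)\<^sup>2) = (\<Sum>l<m. sph_int (\<lambda>v. (\<delta> l + g l v)\<^sup>2))"
    by (intro sph_int_sum continuous_intros cg)
  \<comment> \<open>The cross term vanishes as the \<open>e j\<close> have mean zero; discarding the
    centre and the off-diagonal squares leaves the diagonal entry.\<close>
  moreover have "sph_int (\<lambda>v. (\<delta> l + g l v)\<^sup>2) \<ge> (r l l)\<^sup>2" if "l < m" for l
  proof -
    have "sph_int (\<lambda>v. (\<delta> l + g l v)\<^sup>2) = sph_int (\<lambda>v. ((\<delta> l)\<^sup>2 + 2 * \<delta> l * g l v) + g l v * g l v)"
      by (simp add: power2_eq_square algebra_simps)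
    also have "\<dots> = (\<delta> l)\<^sup>2 + 2 * \<delta> l * sph_int (g l) + ip (g l) (g l)"
      by (subst sph_int_add, (intro continuous_intros cg)+, subst sph_int_add)
         (auto intro!: continuous_intros cg simp: sph_int_cmult ip_def)
    also have "sph_int (g l) = 0" unfolding g_def by (rule sph_int_sum_e)
    also have "ip (g l) (g l) = (\<Sum>j<m. z l j * z l j)" unfolding g_def by (rule ip_sum_e)
    finally have "sph_int (\<lambda>v. (\<delta> l + g l v)\<^sup>2) \<ge> (\<Sum>j<m. z l j * z l j)" by simp
    also have "(\<Sum>j<m. z l j * z l j) \<ge> z l l * z l l"
      using that by (intro member_le_sum) auto
    finally show ?thesis by (simp add: z_def power2_eq_square)
  qed
  ultimately show ?thesis
    using sum_mono[of "{..<m}" "\<lambda>l. (r l l)\<^sup>2" "\<lambda>l. sph_int (\<lambda>v. (\<delta> l + g l v)\<^sup>2)"] by simp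
qed

text \<open>A QR decomposition. The matrix \<open>t\<close> passes from the directions
  \<open>Rop k (e j)\<close> to those of the chart of \<open>E\<close>; Gram--Schmidt on its rows
  writes it as a triangular factor \<open>r\<close> times orthonormal rows \<open>q\<close>, and the
  latter do not change sums of squares.\<close>

lemma ellipsoid_coords:
  assumes E: "ellipsoid_in (Mset k) m E"
  shows "\<exists>\<delta> r. (\<forall>l<m. r l l > 0) \<and>
    (\<forall>y. pt y \<in> E \<longleftrightarrow> (\<Sum>l<m. (\<delta> l + (\<Sum>j\<in>{l..<m}. r j l * y j))\<^sup>2) \<le> (1::real))"
proof -
  obtain c w where ch: "affine_chart (Mset k) m c w"
    and Eeq: "E = aff_param c w m ` {u \<in> Rm m. (\<Sum>j<m. (u j)\<^sup>2) \<le> 1}"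
    using E unfolding ellipsoid_in_def by blast
  note chD = affine_chartD[OF ch]
  have "\<exists>u. \<forall>x. Rop k (e j) x = (\<Sum>l<m. u l * w l x)" if "j < m" for j
  proof -
    have ap: "(\<lambda>x. c x + Rop k (e j) x) \<in> Mset k"
      using chD(1) eF[OF that] sph_int_forms_add(1)[of c "2 * k" "Rop k (e j)"] Rop_forms[OF n, of "e j" k] sph_int_Rop[OF n, of "e j" k]
      by (auto simp: Mset_def)
    from chD(5)[OF ap] show ?thesis by (auto simp: fun_eq_iff)
  qed
  then obtain t0 where t0: "\<And>j x. j < m \<Longrightarrow> Rop k (e j) x = (\<Sum>l<m. t0 j l * w l x)" by metis
  \<comment> \<open>Cut off beyond \<open>m\<close> so as to lie in the space of
    \<open>inner_fun_coords\<close>.\<close>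
  define t where "t j = (\<lambda>l. if l < m then t0 j l else 0)" for j
  have t: "Rop k (e j) x = (\<Sum>l<m. t j l * w l x)" if "j < m" for j x
    using t0[OF that] by (simp add: t_def)
  have comb: "(\<Sum>j<m. z j * Rop k (e j) x) = (\<Sum>l<m. (\<Sum>j<m. z j * t j l) * w l x)" for z x
  proof -
    have "(\<Sum>j<m. z j * Rop k (e j) x) = (\<Sum>j<m. \<Sum>l<m. z j * t j l * w l x)"
      using t by (intro sum.cong) (auto simp: sum_distrib_left mult.assoc)
    also have "\<dots> = (\<Sum>l<m. \<Sum>j<m. z j * t j l * w l x)" by (rule sum.swap)
    finally show ?thesis by (simp add: sum_distrib_right)
  qed
  let ?V = "{f :: nat \<Rightarrow> real. \<forall>l\<ge>m. f l = 0}"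
  let ?B = "\<lambda>f g. \<Sum>l<m. f l * g l :: real"
  interpret C: inner_fun ?V ?B by (rule inner_fun_coords)
  have tV: "t j \<in> ?V" for j by (simp add: t_def)
  have ind: "\<forall>j<m. z j = 0" if "(\<lambda>l. \<Sum>j<m. z j * t j l) = (\<lambda>x. 0)" for z
  proof -
    have "(\<Sum>j<m. z j * Rop k (e j) x) = 0" for x
      unfolding comb using fun_cong[OF that] by simp
    then have "pt z = pt (\<lambda>_. 0)" by (simp add: pt_def)
    then show ?thesis using pt_inj[of z "\<lambda>_. 0"] by blast
  qed
  have "\<exists>q r \<kappa>. (\<forall>j<m. q j \<in> ?V) \<and> (\<forall>i<m. \<forall>j<m. ?B (q i) (q j) = (if i = j then 1 else 0)) \<and>
    (\<forall>j<m. r j j > (0::real)) \<and> (\<forall>j<m. t j = (\<lambda>x. \<Sum>l\<le>j. r j l * q l x)) \<and>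
    (\<forall>l<m. q l = (\<lambda>x. \<Sum>j<m. \<kappa> l j * t j x))"
    by (rule C.gram_schmidt) (rule tV, erule ind)
  then obtain q r where q: "\<forall>j<m. q j \<in> ?V" "\<forall>i<m. \<forall>j<m. ?B (q i) (q j) = (if i = j then 1 else 0)"
    and r: "\<forall>j<m. r j j > (0::real)" "\<forall>j<m. t j = (\<lambda>x. \<Sum>l\<le>j. r j l * q l x)"
    by (elim exE conjE) (rule that; assumption)
  have nrm: "(\<Sum>l<m. (\<Sum>j<m. z j * t j l)\<^sup>2) = (\<Sum>l<m. (\<Sum>j\<in>{l..<m}. r j l * z j)\<^sup>2)" for z
  proof -
    define s where "s l = (\<Sum>j\<in>{l..<m}. r j l * z j)" for l
    have f: "(\<Sum>j<m. z j * t j i) = (\<Sum>l<m. s l * q l i)" for i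
    proof -
      have "(\<Sum>j<m. z j * t j i) = (\<Sum>j<m. z j * (\<Sum>l\<le>j. r j l * q l i))"
        using r(2) by (intro sum.cong) auto
      then show ?thesis unfolding triangular_sum s_def .
    qed
    let ?f = "\<lambda>i. \<Sum>l<m. s l * q l i"
    have fV: "?f \<in> ?V" using q(1) by (intro C.lincomb) auto
    have "?B ?f ?f = (\<Sum>l<m. s l * ?B (q l) ?f)"
      using q(1) by (intro C.B_lincomb[OF fV]) auto
    also have "\<dots> = (\<Sum>l<m. s l * s l)"
    proof (intro sum.cong refl)
      fix l assume l: "l \<in> {..<m}"
      have "?B ?f (q l) = s l"
        by (rule C.expansion_coeff[of m q]) (use q l in auto)
      moreover have "?B (q l) ?f = ?B ?f (q l)" by (simp only: mult.commute)
      ultimately show "s l * ?B (q l) ?f = s l * s l" by simp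
    qed
    finally show ?thesis unfolding f s_def by (simp add: power2_eq_square)
  qed
  \<comment> \<open>The chart of \<open>E\<close> is centred at \<open>c\<close>, the coordinates
    \<open>pt\<close> at r^(2k); \<open>a\<close> is the offset between the two.\<close>
  obtain a where a: "\<And>x. r2k x - c x = (\<Sum>j<m. a j * Rop k (e j) x)"
  proof -
    obtain g where g: "g \<in> Mset k" "c = Rop k g" by (rule Rop_Mset_surj[OF n chD(1)])
    obtain y where y: "g = pre y" by (rule pre_surj[OF g(1)])
    have "c = pt y" unfolding pt_pre g(2) y ..
    then show ?thesis by (intro that[of "\<lambda>j. - y j"]) (simp add: pt_def sum_negf)
  qed
  define \<delta> where "\<delta> l = (\<Sum>j\<in>{l..<m}. r j l * a j)" for l
  have iff: "pt y \<in> E \<longleftrightarrow> (\<Sum>l<m. (\<delta> l + (\<Sum>j\<in>{l..<m}. r j l * y j))\<^sup>2) \<le> 1" for y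
  proof -
    define u where "u = (\<lambda>l\<in>{..<m}. \<Sum>j<m. (a j + y j) * t j l)"
    have u: "u \<in> Rm m" by (simp add: u_def Rm_def)
    have "pt y x = aff_param c w m u x" for x
    proof -
      have "pt y x = c x + (\<Sum>j<m. (a j + y j) * Rop k (e j) x)"
        using a[of x] by (simp add: pt_def distrib_right sum.distrib)
      then show ?thesis unfolding comb by (simp add: aff_param_def u_def)
    qed
    then have pu: "pt y = aff_param c w m u" by blast
    have "pt y \<in> E \<longleftrightarrow> (\<Sum>l<m. (u l)\<^sup>2) \<le> 1"
    proof
      assume "pt y \<in> E"
      then obtain u' where u': "u' \<in> Rm m" "(\<Sum>j<m. (u' j)\<^sup>2) \<le> 1" "aff_param c w m u = aff_param c w m u'"
        unfolding Eeq pu by blast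
      then have "u = u'" using ch u unfolding affine_chart_def bij_betw_def by (metis inj_onD)
      then show "(\<Sum>l<m. (u l)\<^sup>2) \<le> 1" using u' by simp
    qed (use u pu in \<open>auto simp: Eeq\<close>)
    also have "(\<Sum>l<m. (u l)\<^sup>2) = (\<Sum>l<m. (\<Sum>j<m. (a j + y j) * t j l)\<^sup>2)"
      by (intro sum.cong) (auto simp: u_def)
    also have "\<dots> = (\<Sum>l<m. (\<delta> l + (\<Sum>j\<in>{l..<m}. r j l * y j))\<^sup>2)"
      unfolding nrm by (intro sum.cong refl) (simp add: \<delta>_def distrib_left sum.distrib)
    finally show ?thesis .
  qed
  show ?thesis by (intro exI conjI allI) (use r iff in auto)
qed

lemma ellipsoid_sets:
  assumes E: "ellipsoid_in (Mset k) m E"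
  shows "{y \<in> Rm m. pt y \<in> E} \<in> sets (Pi\<^sub>M {..<m} (\<lambda>_. lborel :: real measure))"
proof -
  obtain \<delta> r where *: "\<forall>l<m. r l l > 0"
    "\<forall>y. pt y \<in> E \<longleftrightarrow> (\<Sum>l<m. (\<delta> l + (\<Sum>j\<in>{l..<m}. r j l * y j))\<^sup>2) \<le> (1::real)"
    using ellipsoid_coords[OF E] by (elim exE conjE) (rule that)
  show ?thesis unfolding *(2)[rule_format] by (rule quadric_sets)
qed

text \<open>The extreme points alone force the bound: they limit the diagonal of the triangular form
  of \<open>E\<close>, and \<open>quadric_volume_ge\<close> converts this into volume.\<close>

lemma ellipsoid_volume:
  assumes E: "ellipsoid_in (Mset k) m E" and m: "m > 0"
    and sub: "\<And>v. norm v = 1 \<Longrightarrow> Rop k (zkern (2 * k) v) \<in> E"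
  shows "emeasure (Pi\<^sub>M {..<m} (\<lambda>_. lborel)) {y \<in> Rm m. pt y \<in> ballM k m} \<le>
    emeasure (Pi\<^sub>M {..<m} (\<lambda>_. lborel)) {y \<in> Rm m. pt y \<in> E}"
proof -
  obtain \<delta> r where *: "\<forall>l<m. r l l > 0"
    "\<forall>y. pt y \<in> E \<longleftrightarrow> (\<Sum>l<m. (\<delta> l + (\<Sum>j\<in>{l..<m}. r j l * y j))\<^sup>2) \<le> (1::real)"
    using ellipsoid_coords[OF E] by (elim exE conjE) (rule that)
  note r = *(1)[rule_format] and iff = *(2)[rule_format]
  have "(\<Sum>l<m. (r l l)\<^sup>2) \<le> 1"
  proof (rule quadric_diag_bound[of \<delta> r])
    fix v :: "real^'n" assume v: "norm v = 1"
    have "pt (\<lambda>l. e l v) \<in> E" using sub[OF v] unfolding zkern_pre[OF v] pt_pre .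
    then show "(\<Sum>l<m. (\<delta> l + (\<Sum>j\<in>{l..<m}. r j l * e j v))\<^sup>2) \<le> 1" unfolding iff .
  qed
  from quadric_volume_ge[of m r \<delta>, OF r this m] show ?thesis unfolding iff pt_ballM .
qed

end

text \<open>Pulling the directions of an arbitrary chart back through \<open>Rop\<close> and
  orthonormalising them leaves only a triangular change of coordinates, so volumes in the chart and
  in \<open>pt\<close> coordinates differ by a constant factor.\<close>

lemma chart_to_basis:
  fixes c :: "real^'n::finite \<Rightarrow> real"
  assumes n: "CARD('n) \<ge> 2" and ch: "affine_chart (Mset k) m c w"
  obtains e d t where "chart_basis k m e" "\<And>l. l < m \<Longrightarrow> t l l > 0"
    "\<And>u. aff_param c w m u = chart_basis.pt k m e (tri m d t u)"
proof -
  interpret P: inner_fun "forms (2 * k) :: (real^'n \<Rightarrow> real) set" ip by (rule inner_fun_forms)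
  note chD = affine_chartD[OF ch]
  have "\<exists>g. g \<in> mean_zero k \<and> w j = Rop k g" if "j < m" for j
    by (rule mean_zero_surj[OF n chD(2)[OF that] chD(3)[OF that]]) blast
  then obtain a where a: "\<And>j. j < m \<Longrightarrow> a j \<in> mean_zero k" "\<And>j. j < m \<Longrightarrow> w j = Rop k (a j)" by metis
  have aF: "a j \<in> forms (2 * k)" "sph_int (a j) = 0" if "j < m" for j using a(1)[OF that] by (auto simp: mean_zero_def)
  have Ra: "Rop k (\<lambda>x. \<Sum>j<m. u j * a j x) = (\<lambda>x. \<Sum>j<m. u j * w j x)" for u
    using aF a(2) by (subst Rop_lincomb[where d = "2 * k"]) (auto intro!: sum.cong)
  have ind: "\<forall>j<m. u j = 0" if "(\<lambda>x. \<Sum>j<m. u j * a j x) = (\<lambda>x. 0)" for u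
  proof (rule chD(4))
    have "Rop k (\<lambda>x::real^'n. 0) = (\<lambda>x. 0)" by (simp add: Rop_def[abs_def])
    then show "(\<lambda>x. \<Sum>j<m. u j * w j x) = (\<lambda>x. 0)" unfolding Ra[symmetric] that .
  qed
  obtain e t \<kappa> where e: "\<forall>j<m. e j \<in> forms (2 * k)" "\<forall>i<m. \<forall>j<m. ip (e i) (e j) = (if i = j then 1 else 0)"
    and t: "\<forall>j<m. t j j > (0::real)" "\<forall>j<m. a j = (\<lambda>x. \<Sum>l\<le>j. t j l * e l x)"
    and \<kappa>: "\<forall>l<m. e l = (\<lambda>x. \<Sum>j<m. \<kappa> l j * a j x)"
    using P.gram_schmidt[of m a, OF aF(1) ind] by blast
  have a_e: "(\<Sum>j<m. u j * a j x) = (\<Sum>l<m. (\<Sum>j\<in>{l..<m}. t j l * u j) * e l x)" for u x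
    unfolding triangular_sum[symmetric] using t(2) by (intro sum.cong) auto
  \<comment> \<open>The coefficients \<open>\<kappa>\<close> express \<open>e l\<close> through the
    mean-zero forms \<open>a j\<close>.\<close>
  have e0: "e l \<in> mean_zero k" if "l < m" for l
  proof -
    have "sph_int (e l) = (\<Sum>j<m. \<kappa> l j * sph_int (a j))"
      using \<kappa> that aF by (subst \<kappa>[rule_format, OF that], subst sph_int_lincomb[where d = "2 * k"]) auto
    then show ?thesis using aF e that by (simp add: mean_zero_def)
  qed
  have span: "\<exists>y. g = (\<lambda>x. \<Sum>l<m. y l * e l x)" if g: "g \<in> mean_zero k" for g
  proof -
    have gF: "g \<in> forms (2 * k)" using g by (simp add: mean_zero_def)
    have "(\<lambda>x. c x + Rop k g x) \<in> Mset k"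
      using chD(1) g sph_int_forms_add(1)[of c "2 * k" "Rop k g"] Rop_forms[OF n, of g k] sph_int_Rop[OF n, of g k]
      by (auto simp: Mset_def mean_zero_def)
    from chD(5)[OF this] obtain u where "Rop k g = (\<lambda>x. \<Sum>j<m. u j * w j x)" by (auto simp: fun_eq_iff)
    then have "Rop k g = Rop k (\<lambda>x. \<Sum>j<m. u j * a j x)" by (simp only: Ra)
    then have "g = (\<lambda>x. \<Sum>j<m. u j * a j x)"
      by (intro Rop_inj_on[OF n gF]) (auto intro!: aF)
    then have "g = (\<lambda>x. \<Sum>l<m. (\<Sum>j\<in>{l..<m}. t j l * u j) * e l x)" unfolding a_e .
    then show ?thesis by (rule exI[of _ "\<lambda>l. \<Sum>j\<in>{l..<m}. t j l * u j"])
  qed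
  have cb: "chart_basis k m e"
  proof
    fix g :: "real^'n \<Rightarrow> real" assume "g \<in> mean_zero k"
    then obtain y where y: "g = (\<lambda>x. \<Sum>l<m. y l * e l x)" using span by blast
    have i: "ip g (e l) = y l" if "l < m" for l
      by (rule P.expansion_coeff[of m e, OF _ _ y that]) (use e in auto)
    have "g x = (\<Sum>l<m. ip g (e l) * e l x)" for x
    proof -
      have "g x = (\<Sum>l<m. y l * e l x)" using y by (rule fun_cong)
      also have "\<dots> = (\<Sum>l<m. ip g (e l) * e l x)" by (intro sum.cong) (auto simp: i)
      finally show ?thesis .
    qed
    then show "g = (\<lambda>x. \<Sum>l<m. ip g (e l) * e l x)" by (rule ext)
  qed (use n e e0 in auto)
  interpret chart_basis k m e by (rule cb)
  obtain b where b: "c = pt b" by (rule pt_surj[OF chD(1)])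
  have "aff_param c w m u = pt (tri m b t u)" for u
  proof
    fix x
    have "(\<Sum>j<m. u j * w j x) = Rop k (\<lambda>x. \<Sum>j<m. u j * a j x) x" by (simp only: Ra)
    also have "\<dots> = (\<Sum>l<m. (\<Sum>j\<in>{l..<m}. t j l * u j) * Rop k (e l) x)"
      unfolding a_e using e by (subst Rop_lincomb[where d = "2 * k"]) auto
    finally have "aff_param c w m u x = norm x ^ (2 * k) + ((\<Sum>l<m. b l * Rop k (e l) x) + (\<Sum>l<m. (\<Sum>j\<in>{l..<m}. t j l * u j) * Rop k (e l) x))"
      by (simp add: aff_param_def b pt_def)
    then show "aff_param c w m u x = pt (tri m b t u) x"
      by (simp add: pt_def tri_def distrib_right sum.distrib)
  qed
  then show ?thesis using t by (intro that[OF cb]) auto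
qed

section \<open>The cone of powers lies in the ball and touches it at the kernels\<close>

lemma Lf_member: "(\<lambda>x::real^'n::finite. (x \<bullet> v) ^ (2 * k) * c) \<in> Lf k" if "c \<ge> 0" "k \<ge> 1"
proof -
  have "root (2 * k) c ^ (2 * k) = c" using that by (intro real_root_pow_pos2) auto
  then have "(\<lambda>x. (x \<bullet> v) ^ (2 * k) * c) = (\<lambda>x. \<Sum>v\<leftarrow>[root (2 * k) c *\<^sub>R v]. (v \<bullet> x) ^ (2 * k))"
    by (simp add: power_mult_distrib inner_commute mult.commute)
  then show ?thesis unfolding Lf_def by blast
qed

lemma Rop_zkern_Lfbar:
  fixes v :: "real^'n::finite"
  assumes n: "CARD('n) \<ge> 2" and k: "k \<ge> 1" and v: "norm v = 1"
  shows "Rop k (zkern (2 * k) v) \<in> Lfbar k"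
proof -
  have "fh (real CARD('n)) 0 (2 * k) > 0" using n by (intro fh_pos) simp
  then have "(\<lambda>x. (x \<bullet> v) ^ (2 * k) * (1 / fh (real CARD('n)) 0 (2 * k))) \<in> Lf k"
    using k by (intro Lf_member) auto
  moreover have "Rop k (zkern (2 * k) v) = (\<lambda>x. (x \<bullet> v) ^ (2 * k) * (1 / fh (real CARD('n)) 0 (2 * k)))"
    by (auto simp: Rop_zkern)
  ultimately have "Rop k (zkern (2 * k) v) \<in> Lf k" by (simp only:)
  then show ?thesis using Rop_Mset[OF n zkern_Mset[OF v]] unfolding Lfbar_def by (rule IntI)
qed

lemma Lf_sum_index:
  fixes f :: "real^'n::finite \<Rightarrow> real"
  shows "f \<in> Lf k \<longleftrightarrow> (\<exists>N (v :: nat \<Rightarrow> real^'n). f = (\<lambda>x. \<Sum>i<N. (v i \<bullet> x) ^ (2 * k)))"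
proof
  assume "f \<in> Lf k"
  then obtain vs where "f = (\<lambda>x. \<Sum>v\<leftarrow>vs. (v \<bullet> x) ^ (2 * k))" by (auto simp: Lf_def)
  then have "f = (\<lambda>x. \<Sum>i<length vs. (vs ! i \<bullet> x) ^ (2 * k))"
    by (simp add: sum_list_sum_nth lessThan_atLeast0)
  then show "\<exists>N (v :: nat \<Rightarrow> real^'n). f = (\<lambda>x. \<Sum>i<N. (v i \<bullet> x) ^ (2 * k))"
    by (intro exI[of _ "length vs"] exI[of _ "\<lambda>i. vs ! i"])
next
  assume "\<exists>N (v :: nat \<Rightarrow> real^'n). f = (\<lambda>x. \<Sum>i<N. (v i \<bullet> x) ^ (2 * k))"
  then obtain N and v :: "nat \<Rightarrow> real^'n" where "f = (\<lambda>x. \<Sum>i<N. (v i \<bullet> x) ^ (2 * k))" by blast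
  then have "f = (\<lambda>x. \<Sum>v\<leftarrow>map v [0..<N]. (v \<bullet> x) ^ (2 * k))"
    by (simp add: interv_sum_list_conv_sum_set_nat lessThan_atLeast0 o_def)
  then show "f \<in> Lf k" unfolding Lf_def by blast
qed

text \<open>Kernels at vectors of any length are allowed: by homogeneity the factor
  \<open>norm (v i) ^ (2 * k)\<close> carries the weight of a power.\<close>

lemma Lf_zkern:
  fixes f :: "real^'n::finite \<Rightarrow> real"
  assumes n: "CARD('n) \<ge> 2" and f: "f \<in> Lf k"
  obtains N and v :: "nat \<Rightarrow> real^'n" where "f = Rop k (\<lambda>x. \<Sum>i<N. fh (real CARD('n)) 0 (2 * k) * zkern (2 * k) (v i) x)"
    "f = (\<lambda>x. \<Sum>i<N. (v i \<bullet> x) ^ (2 * k))"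
proof -
  have A: "fh (real CARD('n)) 0 (2 * k) > 0" using n by (intro fh_pos) simp
  obtain N and v :: "nat \<Rightarrow> real^'n" where v: "f = (\<lambda>x. \<Sum>i<N. (v i \<bullet> x) ^ (2 * k))"
    using f Lf_sum_index by metis
  have "f = Rop k (\<lambda>x. \<Sum>i<N. fh (real CARD('n)) 0 (2 * k) * zkern (2 * k) (v i) x)"
    using A by (subst Rop_lincomb[where d = "2 * k"]) (auto simp: zkern_forms Rop_zkern v inner_commute)
  then show ?thesis by (rule that[OF _ v])
qed

lemma form_bound:
  fixes g :: "real^'n::finite \<Rightarrow> real"
  assumes n: "CARD('n) \<ge> 2" and g: "g \<in> forms d"
  shows "\<bar>g v\<bar> \<le> norm v ^ d * sqrt (real (Ddim CARD('n) d) * ip g g)"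
proof (cases "v = 0")
  case False
  have "norm (sgn v) = 1" using False by (simp add: norm_sgn)
  then have "\<bar>g (sgn v)\<bar> \<le> sqrt (real (Ddim CARD('n) d) * ip g g)"
    using real_sqrt_le_mono[OF form_sphere_bound[OF n g]] by simp
  moreover have "g v = norm v ^ d * g (sgn v)"
    using forms_homogeneous[OF g, of "norm v" "sgn v"] False by (simp add: sgn_div_norm)
  ultimately show ?thesis by (simp add: abs_mult mult_left_mono)
next
  case True
  show ?thesis
  proof (cases "d = 0")
    case True
    obtain c where c: "g = (\<lambda>x. c)" using g True forms_0D by blast
    have "\<bar>g (axis undefined 1)\<bar> \<le> sqrt (real (Ddim CARD('n) d) * ip g g)"
      using real_sqrt_le_mono[OF form_sphere_bound[OF n g, of "axis undefined 1"]] by simp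
    then show ?thesis using c True by simp
  next
    case False
    have "g 0 = 0" using forms_homogeneous[OF g, of 0 0] False by (simp add: power_0_left)
    then show ?thesis using True False by (simp add: zero_power)
  qed
qed

text \<open>Pairing the preimage \<open>g\<close> with itself evaluates it at the
  \<open>v i\<close>, with weights of total mass 1 after normalisation. The bound on values of forms
  then gives <g,g> <= sqrt (D <g,g>), hence <g,g> <= D.\<close>

lemma Lfbar_ballM:
  fixes f :: "real^'n::finite \<Rightarrow> real"
  assumes n: "CARD('n) \<ge> 2" and f: "f \<in> Lfbar k" and m: "real m + 1 = real (Ddim CARD('n) (2 * k))"
  shows "f \<in> ballM k m"
proof -
  interpret P: inner_fun "forms (2 * k) :: (real^'n \<Rightarrow> real) set" ip by (rule inner_fun_forms)
  let ?A = "fh (real CARD('n)) 0 (2 * k)" and ?N = "real (Ddim CARD('n) (2 * k))"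
  have A: "?A > 0" using n by (intro fh_pos) simp
  obtain N and v :: "nat \<Rightarrow> real^'n" where fR: "f = Rop k (\<lambda>x. \<Sum>i<N. ?A * zkern (2 * k) (v i) x)"
    by (rule Lf_zkern[OF n, of f k]) (use f in \<open>simp add: Lfbar_def\<close>)
  define g where "g = (\<lambda>x. \<Sum>i<N. ?A * zkern (2 * k) (v i) x)"
  have gF: "g \<in> forms (2 * k)" unfolding g_def by (intro forms_sum forms_scale zkern_forms)
  have ipg: "ip g h = (\<Sum>i<N. ?A * h (v i))" if "h \<in> forms (2 * k)" for h
    unfolding g_def using that by (subst P.B_lincomb) (auto simp: zkern_forms zkern_reproducing)
  have g1: "sph_int g = 1"
    using sph_int_Rop[OF n gF] f fR by (simp add: Lfbar_def Mset_def g_def)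
  then have s1: "(\<Sum>i<N. ?A * norm (v i) ^ (2 * k)) = 1"
    using sph_int_ip_norm[OF gF] ipg[OF norm_power_forms] by simp
  let ?s = "sqrt (?N * ip g g)"
  have "(\<Sum>i<N. ?A * g (v i)) \<le> (\<Sum>i<N. ?A * (norm (v i) ^ (2 * k) * ?s))"
    by (intro sum_mono mult_left_mono order_trans[OF abs_ge_self form_bound[OF n gF]]) (use A in auto)
  also have "\<dots> = (\<Sum>i<N. ?A * norm (v i) ^ (2 * k)) * ?s" by (simp add: sum_distrib_right mult.assoc)
  finally have le: "ip g g \<le> ?s" by (simp only: s1 ipg[OF gF, symmetric] mult_1)
  have p: "ip g g \<ge> 0" by (rule ip_nonneg[OF gF])
  have "ip g g * ip g g \<le> ?N * ip g g"
    using mult_mono[OF le le] p by simp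
  then have "ip g g \<le> ?N" using p by (cases "ip g g = 0") (auto simp: mult_le_cancel_right)
  then show ?thesis using gF g1 m fR by (auto simp: ballM_def Mset_def g_def)
qed

lemma Ddim_ge_2: "n \<ge> 2 \<Longrightarrow> d \<ge> 1 \<Longrightarrow> Ddim n d \<ge> 2"
proof -
  assume *: "n \<ge> 2" "d \<ge> 1"
  then have "Suc d choose d \<le> (n + d - 1) choose d" by (intro binomial_right_mono) simp
  then show ?thesis using * by (simp add: Ddim_def)
qed

text \<open>\<open>lproj_Rop_sum\<close> for a form \<open>g\<close> of mean 1: the weighted sum of
  squared projections of \<open>Rop k g\<close> is \<open>ip g g - 1\<close>.\<close>

lemma ellipsoid_eq_ballM:
  assumes n: "CARD('n::finite) \<ge> 2" and m: "real m + 1 = real (Ddim CARD('n) (2 * k))"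
  shows "{f \<in> Mset k :: (real^'n \<Rightarrow> real) set. (\<Sum>i=1..k. (lam (real CARD('n)) k i)\<^sup>2 * (fnorm (lproj k i f))\<^sup>2)
             \<le> real (Ddim CARD('n) (2*k)) - 1} = ballM k m"
proof -
  have *: "(\<Sum>i=1..k. (lam (real CARD('n)) k i)\<^sup>2 * (fnorm (lproj k i (Rop k g)))\<^sup>2) = ip g g - 1"
    if "g \<in> Mset k" for g :: "real^'n \<Rightarrow> real"
    using lproj_Rop_sum[OF n Mset_forms[OF that]] that by (simp add: Mset_def)
  show ?thesis
  proof (intro set_eqI iffI)
    fix f :: "real^'n \<Rightarrow> real"
    assume f: "f \<in> {f \<in> Mset k. (\<Sum>i=1..k. (lam (real CARD('n)) k i)\<^sup>2 * (fnorm (lproj k i f))\<^sup>2) \<le> real (Ddim CARD('n) (2*k)) - 1}"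
    then obtain g where g: "g \<in> Mset k" "f = Rop k g" using Rop_Mset_surj[OF n] by blast
    then show "f \<in> ballM k m" using f *[OF g(1)] m by (auto simp: ballM_def)
  next
    fix f :: "real^'n \<Rightarrow> real" assume "f \<in> ballM k m"
    then obtain g where "g \<in> Mset k" "f = Rop k g" "ip g g \<le> real m + 1" by (auto simp: ballM_def)
    then show "f \<in> {f \<in> Mset k. (\<Sum>i=1..k. (lam (real CARD('n)) k i)\<^sup>2 * (fnorm (lproj k i f))\<^sup>2) \<le> real (Ddim CARD('n) (2*k)) - 1}"
      using * Rop_Mset[OF n] m by auto
  qed
qed

text \<open>The chart chosen inside \<open>vol_in\<close> enters every volume through the same
  positive factor, the product of the \<open>t l l\<close>, which cancels; the rest happens in
  orthonormal coordinates.\<close>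

lemma loewner_ballM:
  assumes n: "CARD('n::finite) \<ge> 2" and k: "k \<ge> 1" and m: "m = Ddim CARD('n) (2 * k) - 1"
  shows "is_loewner (Mset k :: (real^'n \<Rightarrow> real) set) m (Lfbar k) (ballM k m)"
proof -
  have D: "Ddim CARD('n) (2 * k) \<ge> 2" using n k by (intro Ddim_ge_2) auto
  then have m0: "m > 0" and m1: "real m + 1 = real (Ddim CARD('n) (2 * k))" using m by (auto simp: of_nat_diff)
  define p where "p = (SOME p. affine_chart (Mset k :: (real^'n \<Rightarrow> real) set) m (fst p) (snd p))"
  have ch: "affine_chart (Mset k :: (real^'n \<Rightarrow> real) set) m (fst p) (snd p)"
  proof -
    obtain c w where "affine_chart (Mset k :: (real^'n \<Rightarrow> real) set) m c w"
      using ex_chart[of k, where 'n = 'n] m by blast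
    then show ?thesis unfolding p_def by (intro someI[of "\<lambda>p. affine_chart (Mset k) m (fst p) (snd p)" "(c, w)"]) simp
  qed
  obtain e d t where cb: "chart_basis k m (e :: nat \<Rightarrow> real^'n \<Rightarrow> real)" and t: "\<And>l. l < m \<Longrightarrow> t l l > 0"
    and ap: "\<And>u. aff_param (fst p) (snd p) m u = chart_basis.pt k m e (tri m d t u)"
    using chart_to_basis[OF n ch] by metis
  interpret chart_basis k m e by (rule cb)
  let ?M = "Pi\<^sub>M {..<m} (\<lambda>_. lborel :: real measure)"
  have vol: "vol_in (Mset k) m S = emeasure ?M {u \<in> Rm m. pt (tri m d t u) \<in> S}" for S
    unfolding vol_in_def p_def[symmetric] by (simp add: case_prod_beta ap)
  have T: "{u \<in> Rm m. pt (tri m d t u) \<in> S} = {u \<in> Rm m. tri m d t u \<in> {y \<in> Rm m. pt y \<in> S}}" for S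
    using tri_Rm by auto
  have E: "ellipsoid_in (Mset k) m (ballM k m :: (real^'n \<Rightarrow> real) set)" by (rule ballM_ellipsoid[OF m0])
  have sub: "(Lfbar k :: (real^'n \<Rightarrow> real) set) \<subseteq> ballM k m" using Lfbar_ballM[OF n _ m1] by blast
  have min: "vol_in (Mset k) m (ballM k m :: (real^'n \<Rightarrow> real) set) \<le> vol_in (Mset k) m E'"
    if E': "ellipsoid_in (Mset k) m E'" "Lfbar k \<subseteq> E'" for E' :: "(real^'n \<Rightarrow> real) set"
  proof -
    have c: "(\<Prod>l<m. t l l) > 0" using t by (intro prod_pos) auto
    have e: "ennreal (\<Prod>l<m. t l l) * emeasure ?M {u \<in> Rm m. tri m d t u \<in> {y \<in> Rm m. pt y \<in> S}} =
        emeasure ?M {y \<in> Rm m. pt y \<in> S}" if "ellipsoid_in (Mset k) m S" for S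
      by (rule tri_volume[symmetric]) (use t ellipsoid_sets[OF that] in auto)
    have "ennreal (\<Prod>l<m. t l l) * emeasure ?M {u \<in> Rm m. tri m d t u \<in> {y \<in> Rm m. pt y \<in> ballM k m}}
       \<le> ennreal (\<Prod>l<m. t l l) * emeasure ?M {u \<in> Rm m. tri m d t u \<in> {y \<in> Rm m. pt y \<in> E'}}"
      unfolding e[OF E'(1)] e[OF E]
      by (rule ellipsoid_volume[OF E'(1) m0 subsetD[OF E'(2) Rop_zkern_Lfbar[OF n k]]])
    then show ?thesis unfolding vol T by (simp only: ennreal_mult_le_cancel[OF c])
  qed
  show ?thesis unfolding is_loewner_def using E sub min by blast
qed

section \<open>Gauss quadrature and the Hilbert identity\<close>

abbreviation cpoly :: "real poly \<Rightarrow> complex poly" where "cpoly \<equiv> map_poly complex_of_real"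

lemma cpoly_add: "cpoly (p + q) = cpoly p + cpoly q"
  by (intro poly_eqI) (simp add: coeff_map_poly)

lemma cpoly_smult: "cpoly (smult c p) = smult (complex_of_real c) (cpoly p)"
  by (intro poly_eqI) (simp add: coeff_map_poly)

lemma cpoly_pCons: "cpoly (pCons a p) = pCons (complex_of_real a) (cpoly p)"
  by (intro poly_eqI) (simp add: coeff_map_poly coeff_pCons split: nat.split)

lemma cpoly_mult: "cpoly (p * q) = cpoly p * cpoly q"
  by (induction p) (simp_all add: cpoly_add cpoly_smult cpoly_pCons)

lemma cpoly_of_real: "poly (cpoly p) (complex_of_real x) = complex_of_real (poly p x)"
  by (induction p) (simp_all add: cpoly_pCons)

text \<open>The polynomial (t - a)^2 + b^2. Since \<open>b = 0\<close> is allowed, it covers both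
  obstructions: a repeated real root and a pair of conjugate roots.\<close>

definition quadp :: "real \<Rightarrow> real \<Rightarrow> real poly" where
  "quadp a b = [:a\<^sup>2 + b\<^sup>2, -2 * a, 1:]"

lemma quadp_eq: "quadp a b = [:-a, 1:] * [:-a, 1:] + smult (b\<^sup>2) 1"
  by (simp add: quadp_def power2_eq_square)

text \<open>A complex root exists. If real, its linear factor is split off and either the root
  repeats or the induction continues; if not, its real quadratic divides \<open>p\<close>.\<close>

lemma real_poly_roots_dichotomy:
  fixes p :: "real poly"
  assumes "p \<noteq> 0"
  shows "card {x. poly p x = 0} = degree p \<or> (\<exists>a b q. p = quadp a b * q)"
  using assms
proof (induction "degree p" arbitrary: p rule: less_induct)
  case less
  show ?case
  proof (cases "degree p = 0")
    case True
    then obtain c where "p = [:c:]" by (rule degree_eq_zeroE)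
    then show ?thesis using less.prems True by auto
  next
    case False
    have dc: "degree (cpoly p) = degree p" by (rule degree_map_poly) simp
    then have "\<not> constant (poly (cpoly p))" using False by (simp add: constant_degree)
    then obtain z where z: "poly (cpoly p) z = 0" using fundamental_theorem_of_algebra by blast
    show ?thesis
    proof (cases "Im z = 0")
      case True
      define a where "a = Re z"
      have "z = complex_of_real a" using True by (simp add: a_def complex_eq_iff)
      then have "poly p a = 0" using z by (simp add: cpoly_of_real)
      then obtain q where q: "p = [:-a, 1:] * q" by (auto simp: poly_eq_0_iff_dvd elim: dvdE)
      have q0: "q \<noteq> 0" using q less.prems by auto
      have dq: "degree p = Suc (degree q)"
        unfolding q using q0 by (subst degree_mult_eq) auto
      consider "card {x. poly q x = 0} = degree q" | a' b' q' where "q = quadp a' b' * q'"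
        using less.hyps[of q] q0 dq by auto
      then show ?thesis
      proof cases
        case 1
        have roots: "{x. poly p x = 0} = insert a {x. poly q x = 0}" by (auto simp: q)
        show ?thesis
        proof (cases "poly q a = 0")
          case True
          then obtain q' where "q = [:-a, 1:] * q'" by (auto simp: poly_eq_0_iff_dvd elim: dvdE)
          moreover have "quadp a 0 = [:-a, 1:] * [:-a, 1:]" by (simp add: quadp_def power2_eq_square)
          ultimately have "p = quadp a 0 * q'" by (simp only: q mult.assoc)
          then show ?thesis by blast
        next
          case False
          then show ?thesis using 1 dq q0 poly_roots_finite[OF q0] by (simp add: roots)
        qed
      next
        case 2
        then have "p = quadp a' b' * ([:-a, 1:] * q')" by (simp add: q mult.left_commute)
        then show ?thesis by blast
      qed
    next
      case False
      define Q where "Q = quadp (Re z) (Im z)"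
      have dQ: "degree Q = 2" "Q \<noteq> 0" by (simp_all add: Q_def quadp_def)
      have Qz: "poly (cpoly Q) z = 0"
        by (simp add: Q_def quadp_def cpoly_pCons complex_eq_iff power2_eq_square algebra_simps)
      \<comment> \<open>The remainder has degree below 2 and real coefficients, yet vanishes at a
        nonreal point, so it is 0.\<close>
      define r where "r = p mod Q"
      have "degree r < 2" using degree_mod_less[OF dQ(2), of p] dQ(1) by (auto simp: r_def)
      then have "r = [:coeff r 0, coeff r 1:]"
        by (intro poly_eqI) (auto simp: coeff_pCons coeff_eq_0 split: nat.split)
      then obtain c d where r: "r = [:c, d:]" by blast
      have "poly (cpoly p) z = poly (cpoly (p div Q * Q + r)) z" by (simp add: r_def)
      then have "poly (cpoly r) z = 0" using z Qz by (simp add: cpoly_add cpoly_mult)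
      then have "d = 0 \<and> c = 0" using False by (auto simp: r cpoly_pCons complex_eq_iff)
      then have "p mod Q = 0" using r r_def by simp
      then have "p = Q * (p div Q)" by (metis mult.commute div_mult_mod_eq add.right_neutral)
      then show ?thesis unfolding Q_def by blast
    qed
  qed
qed

section \<open>Interpolation and Gauss quadrature\<close>

definition lagrange :: "real set \<Rightarrow> real \<Rightarrow> real poly" where
  "lagrange X x = (\<Prod>y\<in>X - {x}. smult (1 / (x - y)) [:-y, 1:])"

lemma poly_lagrange:
  assumes "finite X" "x \<in> X" "y \<in> X"
  shows "poly (lagrange X x) y = (if x = y then 1 else 0)"
proof (cases "x = y")
  case True
  have "poly (smult (1 / (x - z)) [:-z, 1:]) x = 1" if "z \<noteq> x" for z
  proof -
    have "poly (smult (1 / (x - z)) [:-z, 1:]) x = 1 / (x - z) * (x - z)"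
      by (simp add: diff_divide_distrib[symmetric])
    then show ?thesis using that by simp
  qed
  then show ?thesis using True unfolding lagrange_def poly_prod by (auto intro!: prod.neutral)
next
  case False
  then show ?thesis using assms unfolding lagrange_def poly_prod by (auto intro!: prod_zero bexI[of _ y])
qed

lemma degree_lagrange:
  assumes "finite X" "x \<in> X" shows "degree (lagrange X x) < card X"
proof -
  have "degree (lagrange X x) \<le> (\<Sum>y\<in>X - {x}. degree (smult (1 / (x - y)) [:-y, 1:]))"
    unfolding lagrange_def
    using degree_prod_sum_le[of "X - {x}" "\<lambda>y. smult (1 / (x - y)) [:-y, 1:]"] assms by (simp add: o_def)
  also have "\<dots> \<le> (\<Sum>y\<in>X - {x}. 1)" by (intro sum_mono) (auto intro: order_trans[OF degree_smult_le])
  also have "\<dots> = card X - 1" using assms by simp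
  finally show ?thesis using assms card_gt_0_iff[of X] by fastforce
qed

lemma lagrange_interpolation:
  fixes q :: "real poly"
  assumes X: "finite X" and d: "degree q < card X"
  shows "q = (\<Sum>x\<in>X. smult (poly q x) (lagrange X x))"
proof (rule poly_eqI_degree[of X])
  fix y assume y: "y \<in> X"
  have "poly (\<Sum>x\<in>X. smult (poly q x) (lagrange X x)) y = (\<Sum>x\<in>X. if x = y then poly q x else 0)"
    unfolding poly_sum using X y by (intro sum.cong) (auto simp: poly_lagrange)
  then show "poly q y = poly (\<Sum>x\<in>X. smult (poly q x) (lagrange X x)) y" using X y by simp
next
  have "degree (\<Sum>x\<in>X. smult (poly q x) (lagrange X x)) \<le> card X - 1"
  proof (intro degree_sum_le X order_trans[OF degree_smult_le])
    show "degree (lagrange X x) \<le> card X - 1" if "x \<in> X" for x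
      using degree_lagrange[OF X that] by simp
  qed
  then show "degree (\<Sum>x\<in>X. smult (poly q x) (lagrange X x)) < card X" using d by simp
qed (use d in simp)

text \<open>Used for the Gaussian functional \<open>Lg\<close> and for the weighted distribution
  \<open>Ls u\<close> of heights on the sphere.\<close>

locale moment_functional =
  fixes L :: "real poly \<Rightarrow> real"
  assumes L_add: "L (p + q) = L p + L q" and L_smult: "L (smult c p) = c * L p"
begin

lemma L_0: "L 0 = 0" using L_smult[of 0 0] by simp

lemma L_sum: "L (\<Sum>i\<in>I. smult (c i) (f i)) = (\<Sum>i\<in>I. c i * L (f i))"
  by (induction I rule: infinite_finite_induct) (auto simp: L_add L_smult L_0)

lemma L_minus: "L (p - q) = L p - L q"
  using L_add[of p "smult (-1) q"] L_smult[of "-1" q] by simp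

text \<open>An orthogonal polynomial has no quadratic factor of the form \<open>(t - a)\<^sup>2 + b\<^sup>2\<close>, so its roots are real and simple.\<close>

lemma orthogonal_roots:
  assumes p: "degree p = k" "p \<noteq> 0"
    and pos: "\<And>q. q \<noteq> 0 \<Longrightarrow> degree q < k \<Longrightarrow> L (q * q) > 0"
    and orth: "\<And>q. degree q < k \<Longrightarrow> L (p * q) = 0"
  shows "card {x. poly p x = 0} = k"
proof (rule ccontr)
  assume "card {x. poly p x = 0} \<noteq> k"
  then obtain a b q where q: "p = quadp a b * q" using real_poly_roots_dichotomy[OF p(2)] p(1) by blast
  have q0: "q \<noteq> 0" using q p(2) by auto
  have "degree p = 2 + degree q"
    unfolding q using q0 by (subst degree_mult_eq) (auto simp: quadp_def)
  then have d: "degree q < k" "degree ([:-a, 1:] * q) < k"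
    using p(1) q0 degree_mult_eq[of "[:-a, 1:]" q] by auto
  \<comment> \<open>Both squares involve polynomials of degree below \<open>k\<close>, so
    \<open>L\<close> would be positive on \<open>p * q\<close>, although \<open>q\<close> is
    orthogonal to \<open>p\<close>.\<close>
  have "p * q = ([:-a, 1:] * q) * ([:-a, 1:] * q) + smult (b\<^sup>2) (q * q)"
  proof -
    define A :: "real poly" where "A = [:-a, 1:]"
    show ?thesis unfolding q quadp_eq A_def[symmetric] by (simp add: algebra_simps)
  qed
  then have "L (p * q) = L (([:-a, 1:] * q) * ([:-a, 1:] * q)) + b\<^sup>2 * L (q * q)"
    by (simp only: L_add L_smult)
  moreover have "L (([:-a, 1:] * q) * ([:-a, 1:] * q)) > 0"
    by (intro pos d(2) no_zero_divisors q0) simp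
  moreover have "b\<^sup>2 * L (q * q) \<ge> 0" using pos[OF q0 d(1)] by simp
  ultimately show False using orth[OF d(1)] by linarith
qed

text \<open>Division by \<open>p\<close> reduces exactness to interpolation at its roots: the
  quotient has degree below \<open>k\<close> and is orthogonal to \<open>p\<close>. A weight is the
  value of \<open>L\<close> on the square of a Lagrange polynomial, hence positive.\<close>

lemma gauss_quadrature:
  assumes p: "degree p = k" "p \<noteq> 0"
    and pos: "\<And>q. q \<noteq> 0 \<Longrightarrow> degree q < k \<Longrightarrow> L (q * q) > 0"
    and orth: "\<And>q. degree q < k \<Longrightarrow> L (p * q) = 0"
  shows "\<exists>w. (\<forall>x\<in>{x. poly p x = 0}. w x > 0) \<and>
    (\<forall>q. degree q < 2 * k \<longrightarrow> L q = (\<Sum>x | poly p x = 0. w x * poly q x))"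
proof -
  define X where "X = {x. poly p x = 0}"
  have cX: "card X = k" unfolding X_def by (rule orthogonal_roots[OF p pos orth])
  have X: "finite X" unfolding X_def by (rule poly_roots_finite[OF p(2)])
  define w where "w x = L (lagrange X x)" for x
  have quad: "L q = (\<Sum>x\<in>X. w x * poly q x)" if q: "degree q < 2 * k" for q
  proof -
    define s r where "s = q div p" and "r = q mod p"
    have qs: "q = p * s + r" by (simp add: s_def r_def)
    have rd: "r = 0 \<or> degree r < k" using degree_mod_less[OF p(2), of q] p(1) by (auto simp: r_def)
    have k: "k > 0" using q by simp
    have dr: "degree r < k" using rd k by auto
    have ds: "degree s < k"
    proof (cases "s = 0")
      case False
      then have "degree (p * s) = k + degree s" using p by (simp add: degree_mult_eq)
      then have "degree q = k + degree s"
        unfolding qs using dr by (subst degree_add_eq_left) auto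
      then show ?thesis using q by simp
    qed (use k in simp)
    have "L q = L r" unfolding qs L_add using orth[OF ds] by simp
    also have "\<dots> = L (\<Sum>x\<in>X. smult (poly r x) (lagrange X x))"
      using lagrange_interpolation[OF X, of r] dr cX by simp
    also have "\<dots> = (\<Sum>x\<in>X. poly r x * w x)" unfolding L_sum w_def ..
    also have "\<dots> = (\<Sum>x\<in>X. w x * poly q x)"
      by (intro sum.cong) (auto simp: qs X_def)
    finally show ?thesis .
  qed
  have "w x > 0" if x: "x \<in> X" for x
  proof -
    have l0: "lagrange X x \<noteq> 0" using poly_lagrange[OF X x x] by auto
    have d: "degree (lagrange X x) < k" using degree_lagrange[OF X x] cX by simp
    have "L (lagrange X x * lagrange X x) = (\<Sum>y\<in>X. w y * poly (lagrange X x * lagrange X x) y)"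
      using d by (intro quad) (simp add: degree_mult_eq[OF l0 l0])
    also have "\<dots> = (\<Sum>y\<in>X. if x = y then w x else 0)"
      using X x by (intro sum.cong) (auto simp: poly_lagrange)
    also have "\<dots> = w x" using X x by simp
    finally show ?thesis using pos[OF l0 d] by simp
  qed
  then show ?thesis using quad unfolding X_def by blast
qed

end

text \<open>Moments of the standard normal distribution.\<close>

fun gmom :: "nat \<Rightarrow> real" where
  "gmom 0 = 1" | "gmom (Suc 0) = 0" | "gmom (Suc (Suc n)) = real (Suc n) * gmom n"

text \<open>The expectation of a polynomial in a standard normal variable, given by its moments so
  that the Hermite theory stays algebraic.\<close>

definition Lg :: "real poly \<Rightarrow> real" where
  "Lg p = (\<Sum>i\<le>degree p. coeff p i * gmom i)"

lemma Lg_le: "degree p \<le> n \<Longrightarrow> Lg p = (\<Sum>i\<le>n. coeff p i * gmom i)"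
  unfolding Lg_def by (intro sum.mono_neutral_left) (auto simp: coeff_eq_0)

interpretation Lg: moment_functional Lg
proof
  fix p q :: "real poly" and c :: real
  let ?n = "max (degree p) (degree q)"
  show "Lg (p + q) = Lg p + Lg q"
    using Lg_le[of p ?n] Lg_le[of q ?n] Lg_le[of "p + q" ?n] degree_add_le_max[of p q]
    by (simp add: sum.distrib distrib_right)
  show "Lg (smult c p) = c * Lg p"
    using Lg_le[of "smult c p" "degree p"] by (simp add: Lg_def sum_distrib_left mult.assoc)
qed

text \<open>Gaussian integration by parts, E[X p(X)] = E[p'(X)]; coefficientwise it is the
  recurrence of \<open>gmom\<close>.\<close>

lemma Lg_X_mult: "Lg (pCons 0 p) = Lg (pderiv p)"
proof -
  let ?n = "Suc (degree p)"
  have "Lg (pCons 0 p) = (\<Sum>i\<le>?n. coeff (pCons 0 p) i * gmom i)"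
    by (rule Lg_le) (rule degree_pCons_le)
  also have "\<dots> = (\<Sum>i\<le>degree p. coeff p i * gmom (Suc i))"
    by (subst sum.atMost_Suc_shift) simp
  also have "\<dots> = coeff p 0 * gmom 1 + (\<Sum>i<degree p. coeff p (Suc i) * gmom (Suc (Suc i)))"
    by (subst lessThan_Suc_atMost[symmetric], subst sum.lessThan_Suc_shift) simp
  also have "\<dots> = (\<Sum>i<degree p. coeff (pderiv p) i * gmom i)"
    by (simp add: coeff_pderiv mult_ac)
  also have "\<dots> = (\<Sum>i\<le>degree p. coeff (pderiv p) i * gmom i)"
    by (intro sum.mono_neutral_left) (auto simp: coeff_pderiv coeff_eq_0)
  also have "\<dots> = Lg (pderiv p)"
    by (rule Lg_le[symmetric]) (simp add: degree_pderiv)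
  finally show ?thesis .
qed

text \<open>The monic Hermite polynomials through the raising operator x - d/dx, the adjoint of
  differentiation under \<open>Lg\<close>.\<close>

fun herm :: "nat \<Rightarrow> real poly" where
  "herm 0 = 1" | "herm (Suc n) = pCons 0 (herm n) - pderiv (herm n)"

lemma herm_degree: "degree (herm n) = n \<and> lead_coeff (herm n) = 1"
proof (induction n)
  case (Suc n)
  have h0: "herm n \<noteq> 0" using Suc by auto
  have "degree (pderiv (herm n)) < degree (pCons 0 (herm n))"
    using Suc h0 by (simp add: degree_pderiv)
  then have "degree (herm (Suc n)) = Suc n" using Suc h0
      degree_add_eq_left[of "- pderiv (herm n)" "pCons 0 (herm n)"] by simp
  moreover have "coeff (herm n) n = 1" using Suc by metis
  ultimately show ?case using Suc by (simp add: coeff_pderiv coeff_eq_0)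
qed simp

text \<open>Each raising operator moves to the other factor as a derivative. Orthogonality to lower
  degrees and the norm n! both follow from this.\<close>

lemma Lg_herm: "Lg (herm n * q) = Lg ((pderiv ^^ n) q)"
proof (induction n arbitrary: q)
  case (Suc n)
  have "herm (Suc n) * q = pCons 0 (herm n * q) - pderiv (herm n) * q"
    by (simp add: left_diff_distrib)
  then have "Lg (herm (Suc n) * q) = Lg (pderiv (herm n * q)) - Lg (pderiv (herm n) * q)"
    by (simp only: Lg.L_minus Lg_X_mult)
  also have "\<dots> = Lg (herm n * pderiv q)" by (simp add: pderiv_mult Lg.L_add mult.commute)
  also have "\<dots> = Lg ((pderiv ^^ n) (pderiv q))" by (rule Suc.IH)
  finally show ?case by (simp add: funpow_swap1)
qed simp

lemma pderiv_iter_degree: "degree ((pderiv ^^ n) (q :: real poly)) = degree q - n"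
  by (induction n) (auto simp: degree_pderiv)

lemma pderiv_iter_0: "degree (q :: real poly) < n \<Longrightarrow> (pderiv ^^ n) q = 0"
proof (induction n arbitrary: q)
  case (Suc n)
  show ?case
  proof (cases "n = 0")
    case True
    then have "degree q = 0" using Suc.prems by simp
    then show ?thesis using True by (simp add: pderiv_eq_0_iff)
  next
    case False
    then have "degree (pderiv q) < n" using Suc.prems by (simp add: degree_pderiv)
    then show ?thesis using Suc.IH[of "pderiv q"] by (simp add: funpow_swap1)
  qed
qed simp

lemma Lg_herm_orth: "degree q < n \<Longrightarrow> Lg (herm n * q) = 0"
  by (simp add: Lg_herm pderiv_iter_0 Lg.L_0)

lemma Lg_herm_self: "Lg (herm n * herm n) > 0"
proof -
  have "degree ((pderiv ^^ n) (herm n)) = 0" by (simp add: pderiv_iter_degree herm_degree)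
  then obtain c where c: "(pderiv ^^ n) (herm n) = [:c:]" by (rule degree_eq_zeroE)
  have "coeff ((pderiv ^^ n) q) 0 = fact n * coeff q n" for q :: "real poly"
  proof (induction n arbitrary: q)
    case (Suc n)
    then show ?case by (simp add: funpow_swap1 coeff_pderiv algebra_simps)
  qed simp
  moreover have "coeff (herm n) n = 1" using herm_degree[of n] by metis
  ultimately have "c = fact n" using c by (metis coeff_pCons_0 mult.right_neutral)
  then have "Lg (herm n * herm n) = fact n" unfolding Lg_herm c by (simp add: Lg_def)
  then show ?thesis by simp
qed

text \<open>Splitting off the leading Hermite component leaves a remainder of smaller degree
  orthogonal to it, so positivity follows by induction on the degree.\<close>

lemma Lg_pos: "q \<noteq> 0 \<Longrightarrow> Lg (q * q) > 0"
proof (induction "degree q" arbitrary: q rule: less_induct)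
  case less
  define n c where "n = degree q" and "c = lead_coeff q"
  define q1 where "q1 = q - smult c (herm n)"
  have c: "c \<noteq> 0" using less.prems by (simp add: c_def)
  have q: "q = smult c (herm n) + q1" by (simp add: q1_def)
  have e: "Lg (q * q) = c\<^sup>2 * Lg (herm n * herm n) + 2 * c * Lg (herm n * q1) + Lg (q1 * q1)"
  proof -
    define H where "H = herm n"
    have qH: "q = smult c H + q1" using q by (simp only: H_def)
    have "q * q = smult c (H * q) + q1 * q" by (subst (1) qH) (simp add: distrib_right)
    then have "Lg (q * q) = c * Lg (H * q) + Lg (q1 * q)" by (simp only: Lg.L_add Lg.L_smult)
    moreover have "H * q = smult c (H * H) + H * q1" by (subst qH) (simp add: distrib_left)
    then have "Lg (H * q) = c * Lg (H * H) + Lg (H * q1)" by (simp only: Lg.L_add Lg.L_smult)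
    moreover have "q1 * q = smult c (H * q1) + q1 * q1" by (subst qH) (simp add: distrib_left mult.commute)
    then have "Lg (q1 * q) = c * Lg (H * q1) + Lg (q1 * q1)" by (simp only: Lg.L_add Lg.L_smult)
    ultimately show ?thesis by (simp add: H_def power2_eq_square algebra_simps)
  qed
  have p: "c\<^sup>2 * Lg (herm n * herm n) > 0" using c Lg_herm_self[of n] by simp
  show ?case
  proof (cases "q1 = 0")
    case True
    then show ?thesis using e p by (simp add: Lg.L_0)
  next
    case False
    have "coeff q1 i = 0" if "i \<ge> n" for i
      using that herm_degree[of n] by (cases "i = n") (auto simp: q1_def n_def c_def coeff_eq_0)
    then have "degree q1 < n" using False by (metis leading_coeff_0_iff not_le)
    then have "Lg (q1 * q1) > 0" "Lg (herm n * q1) = 0"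
      using less.hyps[of q1] False by (auto simp: n_def Lg_herm_orth)
    then show ?thesis using e p by simp
  qed
qed

section \<open>Hilbert's identity\<close>

lemma sum_PiE_insert:
  assumes "finite J" "i \<notin> J"
  shows "(\<Sum>\<xi>\<in>insert i J \<rightarrow>\<^sub>E X. F \<xi>) = (\<Sum>g\<in>J \<rightarrow>\<^sub>E X. \<Sum>y\<in>X. F (g(i := y)))"
proof -
  have "(\<Sum>\<xi>\<in>insert i J \<rightarrow>\<^sub>E X. F \<xi>) = (\<Sum>(y, g)\<in>X \<times> (J \<rightarrow>\<^sub>E X). F (g(i := y)))"
    unfolding PiE_insert_eq using inj_combinator[OF assms(2), of "\<lambda>_. X"]
    by (subst sum.reindex) (auto simp: case_prod_unfold intro!: sum.cong)
  also have "\<dots> = (\<Sum>y\<in>X. \<Sum>g\<in>J \<rightarrow>\<^sub>E X. F (g(i := y)))" by (simp add: sum.cartesian_product)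
  also have "\<dots> = (\<Sum>g\<in>J \<rightarrow>\<^sub>E X. \<Sum>y\<in>X. F (g(i := y)))" by (rule sum.swap)
  finally show ?thesis .
qed

text \<open>Hilbert's identity: Gauss--Hermite nodes in each coordinate reproduce the moments of a Gaussian vector.\<close>

lemma hilbert_identity:
  "\<exists>(I :: ('n::finite \<Rightarrow> real) set) h \<xi> C. finite I \<and> (\<forall>i\<in>I. h i > 0) \<and> C > 0 \<and>
    (\<forall>x::real^'n. (\<Sum>i\<in>I. h i * (\<xi> i \<bullet> x) ^ (2 * k)) = C * norm x ^ (2 * k))"
proof -
  \<comment> \<open>With \<open>Suc k\<close> nodes the rule is exact up to degree
    \<open>2 * k + 1\<close>; \<open>k\<close> nodes would stop short of the required degree
    \<open>2 * k\<close>.\<close>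
  define X where "X = {x. poly (herm (Suc k)) x = 0}"
  have h0: "herm (Suc k) \<noteq> 0" using herm_degree[of "Suc k"] by auto
  have X: "finite X" unfolding X_def by (rule poly_roots_finite[OF h0])
  obtain w where w: "\<forall>x\<in>X. w x > 0"
    and quad: "\<forall>q. degree q < 2 * Suc k \<longrightarrow> Lg q = (\<Sum>x\<in>X. w x * poly q x)"
    using Lg.gauss_quadrature[of "herm (Suc k)" "Suc k"] herm_degree[of "Suc k"] h0 Lg_pos Lg_herm_orth
    unfolding X_def by blast
  have cX: "X \<noteq> {}"
  proof
    assume "X = {}"
    then have "Lg 1 = 0" using quad[rule_format, of 1] by simp
    then show False by (simp add: Lg_def)
  qed
  define I where "I = (UNIV :: 'n set) \<rightarrow>\<^sub>E X"
  define h where "h \<xi> = (\<Prod>i\<in>UNIV. w (\<xi> i))" for \<xi> :: "'n \<Rightarrow> real"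
  have I: "finite I" "I \<noteq> {}" using X cX by (auto simp: I_def PiE_eq_empty_iff intro!: finite_PiE)
  have hp: "h \<xi> > 0" if "\<xi> \<in> I" for \<xi>
    unfolding h_def using that w by (intro prod_pos) (auto simp: I_def PiE_def)
  define \<Psi> where "\<Psi> d x = (\<Sum>\<xi>\<in>I. h \<xi> * ((\<chi> i. \<xi> i) \<bullet> x) ^ d)" for d and x :: "real^'n"
  \<comment> \<open>Integration by parts in coordinate \<open>i\<close>, valid for the discrete rule
    because all degrees involved lie within its exactness.\<close>
  have step: "(\<Sum>\<xi>\<in>I. h \<xi> * (\<xi> i * ((\<chi> i. \<xi> i) \<bullet> x) ^ Suc d)) = real (Suc d) * x $ i * \<Psi> d x"
    if d: "Suc (Suc d) < 2 * Suc k" for i d and x :: "real^'n"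
  proof -
    define J where "J = UNIV - {i}"
    have J: "finite J" "i \<notin> J" "insert i J = UNIV" by (auto simp: J_def)
    define s where "s g = (\<Sum>j\<in>J. g j * x $ j)" for g
    define hJ where "hJ g = (\<Prod>j\<in>J. w (g j))" for g
    have upd: "h (g(i := y)) = w y * hJ g" "(\<chi> j. (g(i := y)) j) \<bullet> x = s g + x $ i * y" for g y
    proof -
      show "h (g(i := y)) = w y * hJ g"
      proof -
        have "h (g(i := y)) = (\<Prod>j\<in>insert i J. w ((g(i := y)) j))" by (simp only: h_def J(3))
        also have "\<dots> = w y * (\<Prod>j\<in>J. w ((g(i := y)) j))"
          by (simp only: prod.insert[OF J(1,2)] fun_upd_same)
        also have "(\<Prod>j\<in>J. w ((g(i := y)) j)) = hJ g"
          unfolding hJ_def using J by (intro prod.cong) auto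
        finally show ?thesis .
      qed
      have "(\<chi> j. (g(i := y)) j) \<bullet> x = (\<Sum>j\<in>insert i J. (g(i := y)) j * x $ j)"
        by (simp add: inner_vec_def J(3))
      also have "\<dots> = y * x $ i + (\<Sum>j\<in>J. (g(i := y)) j * x $ j)"
        by (simp only: sum.insert[OF J(1,2)] fun_upd_same)
      also have "(\<Sum>j\<in>J. (g(i := y)) j * x $ j) = s g"
        unfolding s_def using J by (intro sum.cong) auto
      finally show "(\<chi> j. (g(i := y)) j) \<bullet> x = s g + x $ i * y" by (simp add: mult.commute)
    qed
    have one: "(\<Sum>y\<in>X. w y * (y * (a + b * y) ^ Suc d)) = real (Suc d) * b * (\<Sum>y\<in>X. w y * (a + b * y) ^ d)" for a b
    proof -
      let ?q = "[:a, b:]"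
      have dq: "degree (?q ^ n) \<le> n" for n
        using degree_power_le[of ?q n] by (auto intro: order_trans simp: mult_le_cancel2)
      have "(\<Sum>y\<in>X. w y * (y * (a + b * y) ^ Suc d)) = (\<Sum>y\<in>X. w y * poly (pCons 0 (?q ^ Suc d)) y)"
        by (simp add: poly_power mult.commute del: power_Suc)
      also have "\<dots> = Lg (pCons 0 (?q ^ Suc d))"
        using d dq[of "Suc d"] degree_pCons_le[of 0 "?q ^ Suc d"] by (intro quad[rule_format, symmetric]) linarith
      also have "\<dots> = Lg (pderiv (?q ^ Suc d))" by (rule Lg_X_mult)
      also have "pderiv (?q ^ Suc d) = smult (real (Suc d) * b) (?q ^ d)"
        by (simp add: pderiv_power_Suc pderiv_pCons mult.commute del: power_Suc)
      also have "Lg \<dots> = real (Suc d) * b * Lg (?q ^ d)" by (rule Lg.L_smult)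
      also have "Lg (?q ^ d) = (\<Sum>y\<in>X. w y * poly (?q ^ d) y)"
        using d dq[of d] by (intro quad[rule_format]) linarith
      finally show ?thesis by (simp add: poly_power mult.commute)
    qed
    have "(\<Sum>\<xi>\<in>I. h \<xi> * (\<xi> i * ((\<chi> i. \<xi> i) \<bullet> x) ^ Suc d)) =
        (\<Sum>g\<in>J \<rightarrow>\<^sub>E X. \<Sum>y\<in>X. w y * hJ g * (y * (s g + x $ i * y) ^ Suc d))"
      unfolding I_def J(3)[symmetric] sum_PiE_insert[OF J(1,2)]
      unfolding J(3) upd by simp
    also have "\<dots> = (\<Sum>g\<in>J \<rightarrow>\<^sub>E X. hJ g * (\<Sum>y\<in>X. w y * (y * (s g + x $ i * y) ^ Suc d)))"
      by (simp only: sum_distrib_left mult.assoc mult.left_commute)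
    also have "\<dots> = real (Suc d) * x $ i * (\<Sum>g\<in>J \<rightarrow>\<^sub>E X. \<Sum>y\<in>X. w y * hJ g * (s g + x $ i * y) ^ d)"
      unfolding one by (simp only: sum_distrib_left mult.assoc mult.left_commute)
    also have "(\<Sum>g\<in>J \<rightarrow>\<^sub>E X. \<Sum>y\<in>X. w y * hJ g * (s g + x $ i * y) ^ d) = \<Psi> d x"
      unfolding \<Psi>_def I_def J(3)[symmetric] sum_PiE_insert[OF J(1,2)]
      unfolding J(3) upd by simp
    finally show ?thesis .
  qed
  \<comment> \<open>Expanding one factor of the power into coordinates and applying
    \<open>step\<close> to each yields a recursion in which only the norm of \<open>x\<close>
    occurs.\<close>
  have rec: "\<Psi> (Suc (Suc d)) x = real (Suc d) * (norm x)\<^sup>2 * \<Psi> d x" if d: "Suc (Suc d) < 2 * Suc k" for d x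
  proof -
    have "\<Psi> (Suc (Suc d)) x = (\<Sum>\<xi>\<in>I. \<Sum>i\<in>UNIV. x $ i * (h \<xi> * (\<xi> i * ((\<chi> i. \<xi> i) \<bullet> x) ^ Suc d)))"
      unfolding \<Psi>_def
    proof (intro sum.cong refl)
      fix \<xi> :: "'n \<Rightarrow> real"
      have "((\<chi> i. \<xi> i) \<bullet> x) ^ Suc (Suc d) = (\<Sum>i\<in>UNIV. \<xi> i * x $ i) * ((\<chi> i. \<xi> i) \<bullet> x) ^ Suc d"
        by (simp add: inner_vec_def)
      then show "h \<xi> * ((\<chi> i. \<xi> i) \<bullet> x) ^ Suc (Suc d) = (\<Sum>i\<in>UNIV. x $ i * (h \<xi> * (\<xi> i * ((\<chi> i. \<xi> i) \<bullet> x) ^ Suc d)))"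
        by (simp only: sum_distrib_left sum_distrib_right mult_ac)
    qed
    also have "\<dots> = (\<Sum>i\<in>UNIV. x $ i * (\<Sum>\<xi>\<in>I. h \<xi> * (\<xi> i * ((\<chi> i. \<xi> i) \<bullet> x) ^ Suc d)))"
      by (subst sum.swap) (simp only: sum_distrib_left)
    also have "\<dots> = (\<Sum>i\<in>UNIV. (x $ i)\<^sup>2) * (real (Suc d) * \<Psi> d x)"
      unfolding step[OF d] sum_distrib_right by (simp only: power2_eq_square mult_ac)
    also have "(\<Sum>i\<in>UNIV. (x $ i)\<^sup>2) = (norm x)\<^sup>2" by (simp add: norm_vec_def L2_set_def sum_nonneg)
    finally show ?thesis by (simp only: mult_ac)
  qed
  have "\<exists>C>0. \<forall>x. \<Psi> (2 * j) x = C * norm x ^ (2 * j)" if "j \<le> k" for j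
    using that
  proof (induction j)
    case 0
    have "(\<Sum>\<xi>\<in>I. h \<xi>) > 0" using I hp by (intro sum_pos) auto
    then show ?case by (auto simp: \<Psi>_def)
  next
    case (Suc j)
    then obtain C where C: "C > 0" "\<forall>x. \<Psi> (2 * j) x = C * norm x ^ (2 * j)" by auto
    have "\<Psi> (2 * Suc j) x = (real (Suc (2 * j)) * C) * norm x ^ (2 * Suc j)" for x
      using rec[of "2 * j" x] C(2) Suc.prems by (simp add: power2_eq_square mult_ac)
    then show ?case using C(1) by (intro exI[of _ "real (Suc (2 * j)) * C"]) auto
  qed
  then obtain C where "C > 0" "\<forall>x. \<Psi> (2 * k) x = C * norm x ^ (2 * k)" by blast
  then show ?thesis using I hp unfolding \<Psi>_def by blast
qed

section \<open>Zonal polynomials and Gauss--Lobatto quadrature\<close>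

text \<open>The Householder reflection along \<open>a - b\<close>. It fixes a vector
  \<open>u\<close> orthogonal to both \<open>a\<close> and \<open>b\<close>, so it also shows that
  the stabiliser of \<open>u\<close> acts transitively on vectors of equal length orthogonal to
  \<open>u\<close>.\<close>

lemma ex_reflection:
  fixes a b :: "real^'n::finite"
  assumes "norm a = norm b"
  shows "\<exists>U. orthogonal_transformation (U :: real^'n \<Rightarrow> real^'n) \<and> U a = b \<and> (\<forall>x. x \<bullet> a = x \<bullet> b \<longrightarrow> U x = x)"
proof (cases "a = b")
  case True
  then show ?thesis by (intro exI[of _ id]) (simp add: orthogonal_transformation_def linear_id)
next
  case False
  define c where "c = a - b"
  define \<kappa> where "\<kappa> = 2 / (c \<bullet> c)"
  define U where "U x = x - (\<kappa> * (x \<bullet> c)) *\<^sub>R c" for x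
  have c0: "c \<bullet> c \<noteq> 0" using False by (simp add: c_def)
  then have \<kappa>: "\<kappa> * (c \<bullet> c) = 2" by (simp add: \<kappa>_def)
  have ab: "a \<bullet> a = b \<bullet> b" using assms by (simp add: dot_square_norm)
  then have cc: "c \<bullet> c = 2 * (a \<bullet> c)"
    by (simp add: c_def inner_diff_left inner_diff_right inner_commute)
  have "linear U"
  proof (rule linearI)
    show "U (x + y) = U x + U y" for x y
      by (simp add: U_def inner_add_left distrib_left scaleR_add_left)
    show "U (r *\<^sub>R x) = r *\<^sub>R U x" for r x
      by (simp add: U_def scaleR_diff_right mult.left_commute)
  qed
  moreover have "U x \<bullet> U y = x \<bullet> y" for x y
  proof -
    have "U x \<bullet> U y = x \<bullet> y + (x \<bullet> c) * (y \<bullet> c) * \<kappa> * (\<kappa> * (c \<bullet> c) - 2)"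
      by (simp add: U_def inner_diff_left inner_diff_right inner_commute[of c y] algebra_simps)
    then show ?thesis by (simp add: \<kappa>)
  qed
  moreover have "U a = b"
  proof -
    have "\<kappa> * (a \<bullet> c) = 1" using \<kappa> cc by simp
    then show ?thesis by (simp add: U_def c_def)
  qed
  moreover have "U x = x" if "x \<bullet> a = x \<bullet> b" for x
    using that by (simp add: U_def c_def inner_diff_right)
  ultimately show ?thesis unfolding orthogonal_transformation_def by blast
qed

lemma ex_orthogonal_unit:
  fixes u :: "real^'n::finite"
  assumes "CARD('n) \<ge> 2" obtains w where "norm w = 1" "u \<bullet> w = 0"
proof -
  obtain y where y: "y \<noteq> 0" "orthogonal u y"
    using orthogonal_to_vector_exists[of u] assms by auto
  then show ?thesis by (intro that[of "sgn y"]) (auto simp: norm_sgn sgn_div_norm orthogonal_def)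
qed

section \<open>Projection along an axis and designs on a latitude\<close>

definition pr :: "real^'n::finite \<Rightarrow> real^'n \<Rightarrow> real^'n" where
  "pr u x = x - (u \<bullet> x) *\<^sub>R u"

lemma pr_inner: "norm u = 1 \<Longrightarrow> u \<bullet> pr u x = 0"
  by (simp add: pr_def inner_diff_right dot_square_norm)

lemma pr_decomp: "x = (u \<bullet> x) *\<^sub>R u + pr u x"
  by (simp add: pr_def)

lemma norm_pr:
  assumes "norm u = 1" shows "(norm (pr u x))\<^sup>2 = (norm x)\<^sup>2 - (u \<bullet> x)\<^sup>2"
proof -
  have "u \<bullet> u = 1" using assms by (simp add: dot_square_norm)
  then show ?thesis unfolding power2_norm_eq_inner pr_def
    by (simp add: inner_diff_left inner_diff_right inner_commute[of x u] power2_eq_square algebra_simps)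
qed

text \<open>For a unit vector \<open>u\<close>, the squared distance from the axis of
  \<open>u\<close> (\<open>norm_pr\<close>), written so that it is visibly a quadratic form.\<close>

definition Qf :: "real^'n::finite \<Rightarrow> real^'n \<Rightarrow> real" where
  "Qf u x = (norm x)\<^sup>2 - (u \<bullet> x)\<^sup>2"

lemma Qf_forms: "Qf u \<in> forms 2"
  unfolding Qf_def[abs_def] by (intro forms_diff norm_square_forms linear_form_power_forms)

lemma Qf_power_forms: "(\<lambda>x. Qf u x ^ j) \<in> forms (2 * j)"
  by (rule forms_power[OF Qf_forms])

lemma pd_Qf: "pd v (Qf u) x = 2 * (x \<bullet> v) - 2 * (u \<bullet> x) * (u \<bullet> v)"
proof (rule pd_eqI)
  have "Qf u (x + t *\<^sub>R v) = x \<bullet> x + 2 * t * (x \<bullet> v) + t\<^sup>2 * (v \<bullet> v) - (u \<bullet> x + t * (u \<bullet> v))\<^sup>2" for t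
    unfolding Qf_def power2_norm_eq_inner
    by (simp add: inner_add_left inner_add_right inner_commute[of v x] power2_eq_square algebra_simps)
  then show "((\<lambda>t. Qf u (x + t *\<^sub>R v)) has_field_derivative 2 * (x \<bullet> v) - 2 * (u \<bullet> x) * (u \<bullet> v)) (at 0)"
    by (auto intro!: derivative_eq_intros)
qed

lemma laplacian_Qf:
  fixes u :: "real^'n::finite"
  assumes u: "norm u = 1"
  shows "laplacian (Qf u) x = 2 * real CARD('n) - 2"
proof -
  have "pd v (pd v (Qf u)) x = 2 * (v \<bullet> v) - 2 * (u \<bullet> v)\<^sup>2" for v
  proof (rule pd_eqI)
    show "((\<lambda>t. pd v (Qf u) (x + t *\<^sub>R v)) has_field_derivative 2 * (v \<bullet> v) - 2 * (u \<bullet> v)\<^sup>2) (at 0)"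
      unfolding pd_Qf inner_add_left inner_add_right inner_scaleR_left inner_scaleR_right
      by (auto intro!: derivative_eq_intros simp: power2_eq_square)
  qed
  then have "laplacian (Qf u) x = (\<Sum>i\<in>(UNIV::'n set). 2 - 2 * (u $ i)\<^sup>2)"
    by (simp add: laplacian_eq[OF Qf_forms] inner_axis inner_axis_axis)
  also have "\<dots> = 2 * real CARD('n) - 2 * (\<Sum>i\<in>UNIV. (u $ i)\<^sup>2)"
    by (simp add: sum_subtractf sum_distrib_left)
  also have "(\<Sum>i\<in>UNIV. (u $ i)\<^sup>2) = (norm u)\<^sup>2" by (simp add: norm_vec_def L2_set_def sum_nonneg)
  finally show ?thesis using u by simp
qed

lemma pd_Qf_power: "pd v (\<lambda>x. Qf u x ^ Suc j) x = real (Suc j) * Qf u x ^ j * pd v (Qf u) x"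
  using DERIV_power[OF pd_has_derivative[OF Qf_forms[of u], of x v], of "Suc j"]
  by (intro pd_eqI) (simp add: mult_ac)

text \<open>The familiar formula for powers of r^2 in dimension n - 1, the dimension of the
  hyperplane orthogonal to \<open>u\<close>.\<close>

lemma laplacian_Qf_power:
  fixes u :: "real^'n::finite"
  assumes u: "norm u = 1"
  shows "laplacian (\<lambda>x. Qf u x ^ Suc j) x = real (Suc j) * (2 * real CARD('n) - 2 + 4 * real j) * Qf u x ^ j"
proof (induction j)
  case 0
  then show ?case by (simp add: laplacian_Qf[OF u])
next
  case (Suc j)
  have g: "(\<Sum>i\<in>UNIV. (pd (axis i 1) (Qf u) x)\<^sup>2) = 4 * Qf u x"
  proof -
    have "pd (axis i 1) (Qf u) x = 2 * pr u x $ i" for i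
      unfolding pd_Qf by (simp add: inner_axis pr_def algebra_simps)
    then have "(\<Sum>i\<in>UNIV. (pd (axis i 1) (Qf u) x)\<^sup>2) = 4 * (\<Sum>i\<in>UNIV. (pr u x $ i)\<^sup>2)"
      by (simp add: power_mult_distrib sum_distrib_left)
    also have "(\<Sum>i\<in>UNIV. (pr u x $ i)\<^sup>2) = (norm (pr u x))\<^sup>2" by (simp add: norm_vec_def L2_set_def sum_nonneg)
    finally show ?thesis unfolding norm_pr[OF u] by (simp only: Qf_def[of u x])
  qed
  have "laplacian (\<lambda>x. Qf u x ^ Suc (Suc j)) x = laplacian (\<lambda>x. Qf u x ^ Suc j * Qf u x) x"
    by (simp add: mult.commute)
  also have "\<dots> = Qf u x ^ Suc j * laplacian (Qf u) x
      + 2 * (\<Sum>i\<in>UNIV. pd (axis i 1) (\<lambda>x. Qf u x ^ Suc j) x * pd (axis i 1) (Qf u) x)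
      + laplacian (\<lambda>x. Qf u x ^ Suc j) x * Qf u x"
    by (rule laplacian_mult[OF Qf_power_forms Qf_forms])
  also have "(\<Sum>i\<in>UNIV. pd (axis i 1) (\<lambda>x. Qf u x ^ Suc j) x * pd (axis i 1) (Qf u) x) =
      real (Suc j) * Qf u x ^ j * (\<Sum>i\<in>UNIV. (pd (axis i 1) (Qf u) x)\<^sup>2)"
    unfolding pd_Qf_power sum_distrib_left by (simp only: power2_eq_square mult.assoc)
  finally show ?case unfolding g laplacian_Qf[OF u] Suc.IH by (simp add: algebra_simps)
qed

text \<open>The Hilbert identity, projected to the hyperplane orthogonal to \<open>u\<close>, gives the moment of degree \<open>2k\<close>;
  the lower ones follow by applying the Laplacian.\<close>

lemma ex_design:
  fixes u :: "real^'n::finite"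
  assumes n: "CARD('n) \<ge> 2" and u: "norm u = 1"
  shows "\<exists>(I :: ('n \<Rightarrow> real) set) \<omega> w c. finite I \<and> (\<forall>i\<in>I. \<omega> i > 0 \<and> norm (w i) = 1 \<and> u \<bullet> w i = 0) \<and>
    c 0 = (1::real) \<and> (\<forall>j\<le>k. \<forall>x. (\<Sum>i\<in>I. \<omega> i * (w i \<bullet> x) ^ (2 * j)) = c j * Qf u x ^ j)"
proof -
  obtain I0 :: "('n \<Rightarrow> real) set" and h and \<xi> :: "('n \<Rightarrow> real) \<Rightarrow> real^'n" and C where I0: "finite I0" "\<forall>i\<in>I0. h i > 0" "C > 0"
    and id: "\<forall>x. (\<Sum>i\<in>I0. h i * (\<xi> i \<bullet> x) ^ (2 * k)) = C * norm x ^ (2 * k)"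
    using hilbert_identity[of k, where 'n = 'n] by (elim exE conjE) (rule that)
  \<comment> \<open>Nodes on the axis of \<open>u\<close> project to 0 and cannot be normalised; the
    lengths of the other projections move into the weights \<open>\<eta>\<close>.\<close>
  define I where "I = {i \<in> I0. pr u (\<xi> i) \<noteq> 0}"
  define w where "w i = sgn (pr u (\<xi> i))" for i
  define \<eta> where "\<eta> i = h i * norm (pr u (\<xi> i)) ^ (2 * k)" for i
  have fin: "finite I" using I0 by (simp add: I_def)
  have w: "norm (w i) = 1" "u \<bullet> w i = 0" "\<eta> i > 0" if "i \<in> I" for i
    using that I0 pr_inner[OF u, of "\<xi> i"] by (auto simp: I_def w_def \<eta>_def norm_sgn sgn_div_norm)
  obtain z where z: "norm z = 1" "u \<bullet> z = 0" by (rule ex_orthogonal_unit[OF n])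
  define G where "G j x = (\<Sum>i\<in>I. \<eta> i * (w i \<bullet> x) ^ (2 * j))" for j and x :: "real^'n"
  show ?thesis
  proof (cases "k = 0")
    case True
    \<comment> \<open>For \<open>k = 0\<close> the discarded nodes would still count, since
      \<open>0 ^ 0 = 1\<close>; the single unit vector \<open>z\<close> serves instead.\<close>
    show ?thesis
      by (rule exI[of _ "{\<lambda>_. 0}"], rule exI[of _ "\<lambda>_. 1"], rule exI[of _ "\<lambda>_. z"], rule exI[of _ "\<lambda>_. 1"])
         (use z True in simp)
  next
    case k0: False
    have top: "G k x = C * Qf u x ^ k" for x
    proof -
      have "G k x = (\<Sum>i\<in>I. h i * (\<xi> i \<bullet> pr u x) ^ (2 * k))"
        unfolding G_def
      proof (intro sum.cong refl)
        fix i assume i: "i \<in> I"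
        have "norm (pr u (\<xi> i)) * (w i \<bullet> x) = pr u (\<xi> i) \<bullet> x"
          using i by (simp add: w_def sgn_div_norm I_def)
        also have "\<dots> = \<xi> i \<bullet> pr u x"
          by (simp add: pr_def inner_diff_left inner_diff_right inner_commute)
        finally show "\<eta> i * (w i \<bullet> x) ^ (2 * k) = h i * (\<xi> i \<bullet> pr u x) ^ (2 * k)"
          by (simp add: \<eta>_def power_mult_distrib[symmetric] mult.assoc)
      qed
      also have "\<dots> = (\<Sum>i\<in>I0. h i * (\<xi> i \<bullet> pr u x) ^ (2 * k))"
      proof (intro sum.mono_neutral_left)
        have "\<xi> i \<bullet> pr u x = 0" if "pr u (\<xi> i) = 0" for i
        proof -
          have "\<xi> i \<bullet> pr u x = pr u (\<xi> i) \<bullet> x" by (simp add: pr_def inner_diff_left inner_diff_right inner_commute)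
          then show ?thesis using that by simp
        qed
        then show "\<forall>i\<in>I0 - I. h i * (\<xi> i \<bullet> pr u x) ^ (2 * k) = 0" using k0 by (auto simp: I_def)
      qed (use I0 in \<open>auto simp: I_def\<close>)
      also have "\<dots> = C * Qf u x ^ k"
        using id norm_pr[OF u, of x] by (simp add: Qf_def power_mult)
      finally show ?thesis .
    qed
    have GF: "G j \<in> forms (2 * j)" for j
      unfolding G_def[abs_def] by (intro forms_sum forms_scale linear_form_power_forms)
    have lapG: "laplacian (G (Suc j)) x = real (2 * Suc j) * real (2 * Suc j - 1) * G j x" for j x
    proof -
      have pdG: "pd v (G (Suc j)) = (\<lambda>x. \<Sum>i\<in>I. \<eta> i * pd v (\<lambda>x. (w i \<bullet> x) ^ (2 * Suc j)) x)" for v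
      proof
        fix x
        have "pd v (G (Suc j)) x = pd v (\<lambda>x. \<Sum>i\<in>I. \<eta> i * (w i \<bullet> x) ^ (2 * Suc j)) x" by (simp only: G_def[abs_def])
        also have "\<dots> = (\<Sum>i\<in>I. pd v (\<lambda>x. \<eta> i * (w i \<bullet> x) ^ (2 * Suc j)) x)"
          by (rule pd_sum[where d = "2 * Suc j"]) (intro forms_scale linear_form_power_forms)
        finally show "pd v (G (Suc j)) x = (\<Sum>i\<in>I. \<eta> i * pd v (\<lambda>x. (w i \<bullet> x) ^ (2 * Suc j)) x)"
          by (simp only: pd_scale[OF linear_form_power_forms])
      qed
      have pp: "pd v (pd v (G (Suc j))) x = (\<Sum>i\<in>I. \<eta> i * pd v (pd v (\<lambda>x. (w i \<bullet> x) ^ (2 * Suc j))) x)" for v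
      proof -
        have "pd v (pd v (G (Suc j))) x = (\<Sum>i\<in>I. pd v (\<lambda>x. \<eta> i * pd v (\<lambda>x. (w i \<bullet> x) ^ (2 * Suc j)) x) x)"
          unfolding pdG by (rule pd_sum[where d = "2 * Suc j - 1"]) (intro forms_scale pd_forms linear_form_power_forms)
        then show ?thesis by (simp only: pd_scale[OF pd_forms[OF linear_form_power_forms]])
      qed
      have "laplacian (G (Suc j)) x = (\<Sum>i\<in>I. \<eta> i * laplacian (\<lambda>x. (w i \<bullet> x) ^ (2 * Suc j)) x)"
        unfolding laplacian_eq[OF GF] pp laplacian_eq[OF linear_form_power_forms] sum_distrib_left
        by (rule sum.swap)
      also have "\<dots> = (\<Sum>i\<in>I. real (2 * Suc j) * real (2 * Suc j - 1) * (\<eta> i * (w i \<bullet> x) ^ (2 * j)))"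
        unfolding laplacian_linear_form_power using w(1) by (intro sum.cong) (auto simp: dot_square_norm)
      finally show ?thesis by (simp add: G_def sum_distrib_left)
    qed
    have "\<exists>c. \<forall>x. G j x = c * Qf u x ^ j" if "j \<le> k" for j
      using that
    proof (induction rule: inc_induct)
      case base
      then show ?case using top by blast
    next
      case (step j)
      then obtain c where c: "\<forall>x. G (Suc j) x = c * Qf u x ^ Suc j" by blast
      define q where "q = real (2 * Suc j) * real (2 * Suc j - 1)"
      have q: "q > 0" by (simp add: q_def)
      have "q * G j x = c * (real (Suc j) * (2 * real CARD('n) - 2 + 4 * real j)) * Qf u x ^ j" for x
      proof -
        have "q * G j x = laplacian (G (Suc j)) x" by (simp only: lapG q_def)
        also have "G (Suc j) = (\<lambda>x. c * Qf u x ^ Suc j)" using c by blast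
        also have "laplacian (\<lambda>x. c * Qf u x ^ Suc j) x = c * laplacian (\<lambda>x. Qf u x ^ Suc j) x"
          by (rule laplacian_scale[OF Qf_power_forms])
        finally show ?thesis unfolding laplacian_Qf_power[OF u] by (simp only: mult.assoc)
      qed
      then have "G j x = (c * (real (Suc j) * (2 * real CARD('n) - 2 + 4 * real j)) / q) * Qf u x ^ j" for x
        using q by (simp add: field_simps)
      then show ?case by blast
    qed
    then obtain c where c: "\<And>j x. j \<le> k \<Longrightarrow> G j x = c j * Qf u x ^ j" by metis
    have "I \<noteq> {}"
    proof
      assume "I = {}"
      then have "C * Qf u z ^ k = 0" using top[of z] by (simp add: G_def)
      then show False using I0 z by (simp add: Qf_def)
    qed
    then have s: "(\<Sum>i\<in>I. \<eta> i) > 0" using fin w(3) by (intro sum_pos) auto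
    have c0: "c 0 = (\<Sum>i\<in>I. \<eta> i)" using c[of 0 z] by (simp add: G_def)
    \<comment> \<open>Dividing by the total weight \<open>c 0\<close> normalises the design to mass
      1.\<close>
    have "(\<Sum>i\<in>I. \<eta> i / c 0 * (w i \<bullet> x) ^ (2 * j)) = c j / c 0 * Qf u x ^ j" if "j \<le> k" for j x
      using c[OF that, of x] by (simp add: G_def sum_divide_distrib[symmetric] sum_distrib_left[symmetric])
    then show ?thesis using s c0 fin w
      by (intro exI[of _ I] exI[of _ "\<lambda>i. \<eta> i / c 0"] exI[of _ w] exI[of _ "\<lambda>j. c j / c 0"]) auto
  qed
qed

section \<open>The kernel as a polynomial in the height\<close>

lemma form_binary:
  fixes f :: "real^'n::finite \<Rightarrow> real"
  assumes "f \<in> forms d"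
  shows "\<exists>p. \<forall>a b. f (a *\<^sub>R u + b *\<^sub>R w) = (\<Sum>j\<le>d. p j * a ^ (d - j) * b ^ j)"
  using assms
proof (induction rule: forms_induct)
  case (const c)
  then show ?case by (intro exI[of _ "\<lambda>_. c"]) simp
next
  case (add d f g)
  then obtain p q where "\<forall>a b. f (a *\<^sub>R u + b *\<^sub>R w) = (\<Sum>j\<le>d. p j * a ^ (d - j) * b ^ j)"
    "\<forall>a b. g (a *\<^sub>R u + b *\<^sub>R w) = (\<Sum>j\<le>d. q j * a ^ (d - j) * b ^ j)" by blast
  then show ?case
    by (intro exI[of _ "\<lambda>j. p j + q j"]) (simp add: sum.distrib distrib_right)
next
  case (coord d f i)
  then obtain p where p: "\<forall>a b. f (a *\<^sub>R u + b *\<^sub>R w) = (\<Sum>j\<le>d. p j * a ^ (d - j) * b ^ j)" by blast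
  define q where "q j = (if j \<le> d then u $ i * p j else 0) + (if j = 0 then 0 else w $ i * p (j - 1))" for j
  have "(a *\<^sub>R u + b *\<^sub>R w) $ i * f (a *\<^sub>R u + b *\<^sub>R w) = (\<Sum>j\<le>Suc d. q j * a ^ (Suc d - j) * b ^ j)" for a b
  proof -
    have "(\<Sum>j\<le>Suc d. q j * a ^ (Suc d - j) * b ^ j) =
      (\<Sum>j\<le>Suc d. (if j \<le> d then u $ i * p j else 0) * a ^ (Suc d - j) * b ^ j)
      + (\<Sum>j\<le>Suc d. (if j = 0 then 0 else w $ i * p (j - 1)) * a ^ (Suc d - j) * b ^ j)"
      by (simp only: q_def distrib_right sum.distrib)
    also have "(\<Sum>j\<le>Suc d. (if j \<le> d then u $ i * p j else 0) * a ^ (Suc d - j) * b ^ j) =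
        (\<Sum>j\<le>d. a * u $ i * (p j * a ^ (d - j) * b ^ j))"
      by (subst sum.atMost_Suc) (auto intro!: sum.cong simp: Suc_diff_le mult_ac)
    also have "(\<Sum>j\<le>Suc d. (if j = 0 then 0 else w $ i * p (j - 1)) * a ^ (Suc d - j) * b ^ j) =
        (\<Sum>j\<le>d. b * w $ i * (p j * a ^ (d - j) * b ^ j))"
      by (subst sum.atMost_Suc_shift) (simp add: mult_ac)
    finally show ?thesis using p by (simp add: distrib_right sum_distrib_left[symmetric])
  qed
  then show ?case by blast
qed

text \<open>By invariance under the stabiliser of \<open>u\<close>, the reproducing kernel at \<open>u\<close> is a polynomial in the height.\<close>

lemma zkern_zonal:
  fixes u :: "real^'n::finite"
  assumes n: "CARD('n) \<ge> 2" and u: "norm u = 1"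
  obtains P where "degree P \<le> k" "\<And>x. norm x = 1 \<Longrightarrow> zkern k u x = poly P (u \<bullet> x)"
proof -
  obtain w where w: "norm w = 1" "u \<bullet> w = 0" by (rule ex_orthogonal_unit[OF n])
  obtain p where p: "\<And>a b. zkern k u (a *\<^sub>R u + b *\<^sub>R w) = (\<Sum>j\<le>k. p j * a ^ (k - j) * b ^ j)"
    using form_binary[OF zkern_forms] by metis
  have rot: "zkern k u (a *\<^sub>R u + y) = zkern k u (a *\<^sub>R u + y')" if y: "norm y = norm y'" "u \<bullet> y = 0" "u \<bullet> y' = 0" for a y y'
  proof -
    obtain U where U: "orthogonal_transformation (U :: real^'n \<Rightarrow> real^'n)" "U y = y'" "\<forall>x. x \<bullet> y = x \<bullet> y' \<longrightarrow> U x = x"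
      using ex_reflection[OF y(1)] by blast
    have "U u = u" using U(3) y by simp
    then have "U (a *\<^sub>R u + y) = a *\<^sub>R u + y'"
      using U(1,2) orthogonal_transformation_linear[OF U(1)] by (simp add: linear_add linear_scale)
    then show ?thesis using zkern_orthogonal[OF n U(1), of k u "a *\<^sub>R u + y"] \<open>U u = u\<close> by simp
  qed
  define P where "P = (\<Sum>j\<le>k. smult (if even j then p j else 0) ([:0, 1:] ^ (k - j) * [:1, 0, -1:] ^ (j div 2)))"
  have "degree P \<le> k" unfolding P_def
  proof (intro degree_sum_le)
    fix j assume "j \<in> {..k}"
    have "degree ([:0, 1::real:] ^ (k - j) * [:1, 0, -1:] ^ (j div 2)) \<le> (k - j) * 1 + (j div 2) * 2"
      by (intro order_trans[OF degree_mult_le] add_mono order_trans[OF degree_power_le]) (auto)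
    also have "\<dots> \<le> k" using \<open>j \<in> {..k}\<close> by simp
    finally show "degree (smult (if even j then p j else 0) ([:0, 1:] ^ (k - j) * [:1, 0, -1:] ^ (j div 2))) \<le> k"
      by (rule order_trans[OF degree_smult_le])
  qed simp
  moreover have "zkern k u x = poly P (u \<bullet> x)" if x: "norm x = 1" for x
  proof -
    define a b where "a = u \<bullet> x" and "b = norm (pr u x)"
    have b2: "b\<^sup>2 = 1 - a\<^sup>2" using norm_pr[OF u, of x] x by (simp add: a_def b_def)
    \<comment> \<open>Both signs give the same value; averaging them cancels the odd powers of
      \<open>b\<close>, and the even ones are polynomials in \<open>a\<close> because b^2 = 1 -
      a^2.\<close>
    have s: "zkern k u x = zkern k u (a *\<^sub>R u + c *\<^sub>R w)" if "c = b \<or> c = -b" for c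
      using rot[of "pr u x" "c *\<^sub>R w" a] that w pr_inner[OF u] pr_decomp[of x u] by (auto simp: a_def b_def)
    have "2 * zkern k u x = (\<Sum>j\<le>k. p j * a ^ (k - j) * b ^ j) + (\<Sum>j\<le>k. p j * a ^ (k - j) * (-b) ^ j)"
      using s[of b] s[of "-b"] unfolding p by simp
    also have "\<dots> = (\<Sum>j\<le>k. 2 * ((if even j then p j else 0) * (a ^ (k - j) * (1 - a\<^sup>2) ^ (j div 2))))"
      unfolding sum.distrib[symmetric]
    proof (intro sum.cong refl)
      fix j
      show "p j * a ^ (k - j) * b ^ j + p j * a ^ (k - j) * (-b) ^ j =
        2 * ((if even j then p j else 0) * (a ^ (k - j) * (1 - a\<^sup>2) ^ (j div 2)))"
        unfolding b2[symmetric] by (cases "even j") (auto simp: power_mult[symmetric])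
    qed
    also have "\<dots> = 2 * poly P a"
      unfolding P_def poly_sum sum_distrib_left[symmetric] by (simp add: poly_power power2_eq_square)
    finally show ?thesis by (simp add: a_def)
  qed
  ultimately show ?thesis by (rule that)
qed

text \<open>The weight vanishes at the poles, so the Gauss rule for this functional supplies the
  interior nodes of a Gauss--Lobatto rule for the height.\<close>

definition Ls :: "real^'n::finite \<Rightarrow> real poly \<Rightarrow> real" where
  "Ls u q = sph_int (\<lambda>v. (1 - (u \<bullet> v)\<^sup>2) * poly q (u \<bullet> v))"

lemma continuous_zonal: "continuous_on UNIV (\<lambda>v::real^'n::finite. poly q (u \<bullet> v))"
  by (intro continuous_on_compose2[OF continuous_on_poly[OF continuous_on_id]] continuous_intros) auto

lemma moment_functional_Ls: "moment_functional (Ls u)"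
proof
  show "Ls u (p + q) = Ls u p + Ls u q" for p q
    unfolding Ls_def poly_add distrib_left by (intro sph_int_add continuous_intros continuous_zonal)
  show "Ls u (smult c p) = c * Ls u p" for c p
    unfolding Ls_def sph_int_cmult[symmetric] by (simp add: mult_ac)
qed

text \<open>Finitely many roots leave a height in (-1, 1) where \<open>q\<close> is positive, and
  the sphere has a point at that height. Signs at the poles are irrelevant as the weight is 0
  there.\<close>

lemma Ls_pos:
  fixes u :: "real^'n::finite"
  assumes n: "CARD('n) \<ge> 2" and u: "norm u = 1"
    and q: "q \<noteq> 0" "\<And>t. -1 < t \<Longrightarrow> t < 1 \<Longrightarrow> poly q t \<ge> 0"
  shows "Ls u q > 0"
proof -
  obtain w where w: "norm w = 1" "u \<bullet> w = 0" by (rule ex_orthogonal_unit[OF n])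
  have "infinite {-1<..<1::real}" by (simp add: infinite_Ioo)
  then have "\<not> {-1<..<1} \<subseteq> {t. poly q t = 0}" using poly_roots_finite[OF q(1)] finite_subset by blast
  then obtain t where "t \<in> {-1<..<1}" "poly q t \<noteq> 0" by blast
  then have t: "-1 < t" "t < 1" "poly q t \<noteq> 0" by auto
  have t2: "t\<^sup>2 < 1" using t by (simp add: abs_square_less_1 abs_less_iff)
  define v where "v = t *\<^sub>R u + sqrt (1 - t\<^sup>2) *\<^sub>R w"
  have uv: "u \<bullet> v = t" using u w by (simp add: v_def inner_add_right dot_square_norm)
  have "v \<bullet> v = 1"
  proof -
    have "u \<bullet> u = 1" "w \<bullet> w = 1" using u w by (simp_all add: dot_square_norm)
    then have "v \<bullet> v = t * t + sqrt (1 - t\<^sup>2) * sqrt (1 - t\<^sup>2)"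
      using w by (simp add: v_def inner_add_left inner_add_right inner_commute[of w u])
    then show ?thesis using t2 by (simp add: power2_eq_square)
  qed
  then have v: "norm v = 1" by (simp add: norm_eq_sqrt_inner)
  show ?thesis unfolding Ls_def
  proof (rule sph_int_pos[OF _ _ v])
    show "continuous_on UNIV (\<lambda>v. (1 - (u \<bullet> v)\<^sup>2) * poly q (u \<bullet> v))"
      by (intro continuous_intros continuous_zonal)
    show "(1 - (u \<bullet> v)\<^sup>2) * poly q (u \<bullet> v) \<noteq> 0" using t t2 by (simp add: uv)
    fix x :: "real^'n" assume x: "norm x = 1"
    have le: "\<bar>u \<bullet> x\<bar> \<le> 1" using Cauchy_Schwarz_ineq2[of u x] u x by simp
    show "0 \<le> (1 - (u \<bullet> x)\<^sup>2) * poly q (u \<bullet> x)"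
    proof (cases "\<bar>u \<bullet> x\<bar> = 1")
      case True
      then have "(u \<bullet> x)\<^sup>2 = 1" by (metis power2_abs one_power2)
      then show ?thesis by simp
    next
      case False
      then have "-1 < u \<bullet> x" "u \<bullet> x < 1" "(u \<bullet> x)\<^sup>2 < 1" using le by (auto simp: abs_square_less_1)
      then show ?thesis using q(2) by (intro mult_nonneg_nonneg) auto
    qed
  qed
qed

lemma sph_int_odd:
  fixes f :: "real^'n::finite \<Rightarrow> real"
  assumes n: "CARD('n) \<ge> 2" and f: "f \<in> forms d" and d: "odd d"
  shows "sph_int f = 0"
proof -
  have U: "orthogonal_transformation (uminus :: real^'n \<Rightarrow> real^'n)"
    by (simp add: orthogonal_transformation_def linear_uminus)
  have "f (- x) = - f x" for x using forms_homogeneous[OF f, of "-1" x] d by simp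
  then have "sph_int f = sph_int (\<lambda>x. -1 * f x)" using sph_int_orthogonal[OF n f U] by simp
  then show ?thesis unfolding sph_int_cmult by simp
qed

text \<open>On the sphere the weight is \<open>Qf u\<close>, which vanishes at \<open>u\<close>.
  When the degree can be raised to \<open>k\<close> by a power of r^2, the kernel evaluates the
  resulting form at \<open>u\<close> and gives 0; otherwise the integrand is odd.\<close>

lemma zonal_orthogonal:
  fixes u :: "real^'n::finite"
  assumes n: "CARD('n) \<ge> 2" and u: "norm u = 1"
    and P: "\<And>x. norm x = 1 \<Longrightarrow> zkern k u x = poly P (u \<bullet> x)" and q: "degree q < k"
  shows "Ls u (P * q) = 0"
proof -
  interpret moment_functional "Ls u" by (rule moment_functional_Ls)
  have mono: "Ls u (P * monom 1 j) = 0" if j: "j < k" for j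
  proof -
    have gF: "(\<lambda>v. Qf u v * (u \<bullet> v) ^ j) \<in> forms (2 + j)"
      by (intro forms_mult Qf_forms linear_form_power_forms)
    have "Ls u (P * monom 1 j) = sph_int (\<lambda>v. zkern k u v * (Qf u v * (u \<bullet> v) ^ j))"
      unfolding Ls_def
      by (rule sph_int_cong[OF _ forms_continuous[OF forms_mult[OF zkern_forms gF]]])
         (auto intro!: continuous_intros continuous_zonal simp: P Qf_def poly_monom)
    also have "\<dots> = 0"
    proof (cases "even (k - j)")
      case False
      then have "odd (k + (2 + j))" using j by auto
      then show ?thesis by (rule sph_int_odd[OF n forms_mult[OF zkern_forms gF]])
    next
      case True
      then obtain s where s: "k - j = 2 * s" by (elim evenE)
      \<comment> \<open>The exponent is \<open>s - 1\<close> because \<open>Qf u\<close> already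
        contributes degree 2; \<open>j < k\<close> makes \<open>s\<close> positive.\<close>
      define g where "g = (\<lambda>v. (Qf u v * (u \<bullet> v) ^ j) * norm v ^ (2 * (s - 1)))"
      have kk: "(2 + j) + 2 * (s - 1) = k" using s j by (cases s) auto
      have "g \<in> forms ((2 + j) + 2 * (s - 1))"
        unfolding g_def by (rule forms_mult[OF gF norm_power_forms])
      then have g: "g \<in> forms k" unfolding kk .
      have "sph_int (\<lambda>v. zkern k u v * (Qf u v * (u \<bullet> v) ^ j)) = ip (zkern k u) g"
        unfolding ip_def
        by (rule sph_int_cong[OF forms_continuous[OF forms_mult[OF zkern_forms gF]] forms_continuous[OF forms_mult[OF zkern_forms g]]])
           (simp add: g_def)
      also have "\<dots> = g u" by (rule zkern_reproducing[OF g])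
      also have "\<dots> = 0" using u by (simp add: g_def Qf_def dot_square_norm)
      finally show ?thesis .
    qed
    finally show ?thesis .
  qed
  have "P * q = (\<Sum>j\<le>degree q. smult (coeff q j) (P * monom 1 j))"
    by (subst poly_as_sum_of_monoms[symmetric, of q]) (simp add: sum_distrib_left smult_monom mult_smult_right[symmetric])
  then have "Ls u (P * q) = (\<Sum>j\<le>degree q. coeff q j * Ls u (P * monom 1 j))" by (simp only: L_sum)
  also have "\<dots> = 0" using mono q by (intro sum.neutral) auto
  finally show ?thesis .
qed

text \<open>The interior nodes are the roots of the zonal polynomial; testing the rule on its square shows that both
  endpoints together carry the mass \<open>1 / D(n,k)\<close>.\<close>

lemma lobatto:
  fixes u :: "real^'n::finite"
  assumes n: "CARD('n) \<ge> 2" and k: "k \<ge> 1" and u: "norm u = 1"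
  obtains X w where "finite X" "\<And>t. t \<in> X \<Longrightarrow> t\<^sup>2 < 1" "\<And>t. t \<in> X \<Longrightarrow> w t > (0::real)"
    "\<And>f. degree f \<le> 2 * k \<Longrightarrow> poly f 1 = poly f (-1) \<Longrightarrow>
      sph_int (\<lambda>v. poly f (u \<bullet> v)) = (\<Sum>t\<in>X. w t * poly f t) + poly f 1 / real (Ddim CARD('n) k)"
proof -
  interpret moment_functional "Ls u" by (rule moment_functional_Ls)
  let ?D = "real (Ddim CARD('n) k)"
  have D: "?D \<ge> 2" using Ddim_ge_2[OF n k] by simp
  obtain P where dP: "degree P \<le> k" and P: "\<And>x. norm x = 1 \<Longrightarrow> zkern k u x = poly P (u \<bullet> x)"
    by (rule zkern_zonal[OF n u]) blast
  have P1: "poly P 1 = ?D" using P[OF u] zkern_diag[OF n u, of k] u by (simp add: dot_square_norm)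
  \<comment> \<open>Homogeneity of degree \<open>k\<close> fixes the value at the opposite pole up
    to sign, so \<open>P * P\<close> meets the symmetry condition of the rule.\<close>
  have Pm1: "(poly P (-1))\<^sup>2 = ?D\<^sup>2"
  proof -
    have "poly P (-1) = zkern k u (-1 *\<^sub>R u)" using P[of "-u"] u by (simp add: dot_square_norm)
    also have "\<dots> = (-1) ^ k * ?D"
      unfolding forms_homogeneous[OF zkern_forms] using zkern_diag[OF n u, of k] by simp
    finally show ?thesis by (simp add: power_mult_distrib power_mult[symmetric] mult.commute[of k])
  qed
  have P0: "P \<noteq> 0" using P1 D by auto
  have pos: "Ls u (q * q) > 0" if "q \<noteq> 0" for q
    using that by (intro Ls_pos[OF n u]) auto
  have orth: "Ls u (P * q) = 0" if "degree q < k" for q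
    by (rule zonal_orthogonal[OF n u P that])
  have dPk: "degree P = k"
  proof (rule ccontr)
    assume "degree P \<noteq> k"
    then have "Ls u (P * P) = 0" using dP by (intro orth) simp
    then show False using pos[OF P0] by simp
  qed
  define X where "X = {t. poly P t = 0}"
  obtain w where w: "\<forall>t\<in>X. w t > 0" and quad: "\<forall>q. degree q < 2 * k \<longrightarrow> Ls u q = (\<Sum>t\<in>X. w t * poly q t)"
    using gauss_quadrature[OF dPk P0 pos orth] unfolding X_def by blast
  have X: "finite X" unfolding X_def by (rule poly_roots_finite[OF P0])
  \<comment> \<open>A root \<open>t\<close> outside (-1, 1) would give a cofactor \<open>q\<close>
    of degree below \<open>k\<close> for which \<open>P * q\<close> is \<open>s - t\<close> times a
    square, hence of constant sign on the interval, against orthogonality.\<close>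
  have X1: "-1 < t \<and> t < 1" if "t \<in> X" for t
  proof (rule ccontr)
    assume out: "\<not> (-1 < t \<and> t < 1)"
    have "poly P t = 0" using that by (simp add: X_def)
    then obtain q where q: "P = [:-t, 1:] * q" by (auto simp: poly_eq_0_iff_dvd elim: dvdE)
    have q0: "q \<noteq> 0" using q P0 by auto
    have "degree P = Suc (degree q)" unfolding q using q0 by (subst degree_mult_eq) auto
    then have z: "Ls u (P * q) = 0" using dPk by (intro orth) simp
    have Pq0: "P * q \<noteq> 0" using P0 q0 by simp
    have e: "poly (P * q) s = (s - t) * (poly q s)\<^sup>2" for s by (simp add: q power2_eq_square algebra_simps)
    show False
    proof (cases "t \<le> -1")
      case True
      then have "Ls u (P * q) > 0"
        by (intro Ls_pos[OF n u Pq0]) (simp add: e del: poly_mult)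
      then show False using z by simp
    next
      case False
      then have "Ls u (smult (-1) (P * q)) > 0" using Pq0 out
        by (intro Ls_pos[OF n u]) (auto simp: e mult_le_0_iff simp del: poly_mult)
      then show False using z L_smult[of "-1" "P * q"] by simp
    qed
  qed
  then have X2: "t\<^sup>2 < 1" if "t \<in> X" for t using that by (simp add: abs_square_less_1 abs_less_iff)
  \<comment> \<open>Dividing by 1 - t^2 undoes the weight of \<open>Ls u\<close>; \<open>W\<close>
    is the mass that remains for the poles out of the total 1.\<close>
  define W where "W = 1 - (\<Sum>t\<in>X. w t / (1 - t\<^sup>2))"
  have main: "sph_int (\<lambda>v. poly f (u \<bullet> v)) = (\<Sum>t\<in>X. w t / (1 - t\<^sup>2) * poly f t) + poly f 1 * W"
    if f: "degree f \<le> 2 * k" "poly f 1 = poly f (-1)" for f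
  proof -
    define c where "c = poly f 1"
    \<comment> \<open>As \<open>f\<close> takes equal values at the poles, \<open>g\<close> vanishes
      at both and is divisible by t^2 - 1; the Gauss rule is applied to the quotient.\<close>
    define g where "g = [:c:] - f"
    have "[:-1, 1:] dvd g" using poly_eq_0_iff_dvd[of g 1] by (simp add: g_def c_def)
    then obtain g1 where g1: "g = [:-1, 1:] * g1" by (elim dvdE)
    have "poly g (-1) = 0" using f(2) by (simp add: g_def c_def)
    then have "poly g1 (-1) = 0" by (simp add: g1)
    then obtain g2 where g2: "g1 = [:1, 1:] * g2" using poly_eq_0_iff_dvd[of g1 "-1"] by (auto elim: dvdE)
    define q where "q = g2"
    have gq: "poly f s = c + (1 - s\<^sup>2) * poly q s" for s
    proof -
      have "poly g s = (s - 1) * ((s + 1) * poly q s)" by (simp add: g1 g2 q_def algebra_simps)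
      then show ?thesis by (simp add: g_def power2_eq_square algebra_simps)
    qed
    have dq: "degree q < 2 * k"
    proof (cases "q = 0")
      case False
      have "degree g = Suc (Suc (degree q))"
        unfolding g1 g2 q_def[symmetric] using False by (simp add: degree_mult_eq del: mult_pCons_left)
      moreover have "degree g \<le> 2 * k" unfolding g_def using f(1) by (intro degree_diff_le) auto
      ultimately show ?thesis by simp
    qed (use k in simp)
    have "sph_int (\<lambda>v. poly f (u \<bullet> v)) = c + Ls u q"
      unfolding gq Ls_def by (subst sph_int_add) (auto intro!: continuous_intros continuous_zonal)
    also have "Ls u q = (\<Sum>t\<in>X. w t / (1 - t\<^sup>2) * (poly f t - c))"
      unfolding quad[rule_format, OF dq]
    proof (intro sum.cong refl)
      fix t assume "t \<in> X"
      then have "1 - t\<^sup>2 \<noteq> 0" using X2 by force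
      then show "w t * poly q t = w t / (1 - t\<^sup>2) * (poly f t - c)" by (simp add: gq)
    qed
    also have "\<dots> = (\<Sum>t\<in>X. w t / (1 - t\<^sup>2) * poly f t) - c * (\<Sum>t\<in>X. w t / (1 - t\<^sup>2))"
      unfolding right_diff_distrib sum_subtractf sum_distrib_left by (simp only: mult.commute)
    finally show ?thesis by (simp add: W_def c_def right_diff_distrib)
  qed
  have "W = 1 / ?D"
  proof -
    have "sph_int (\<lambda>v. poly (P * P) (u \<bullet> v)) = ip (zkern k u) (zkern k u)"
      unfolding ip_def by (rule sph_int_cong[OF continuous_zonal forms_continuous[OF forms_mult[OF zkern_forms zkern_forms]]]) (simp add: P)
    also have "\<dots> = ?D" using zkern_self[of k u] zkern_diag[OF n u] by simp
    finally have "?D = (\<Sum>t\<in>X. w t / (1 - t\<^sup>2) * poly (P * P) t) + poly (P * P) 1 * W"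
      using main[of "P * P"] dPk Pm1 P1 degree_mult_le[of P P] by (simp add: power2_eq_square)
    also have "(\<Sum>t\<in>X. w t / (1 - t\<^sup>2) * poly (P * P) t) = 0" by (intro sum.neutral) (simp add: X_def)
    finally show ?thesis using D by (simp add: P1 field_simps)
  qed
  then show ?thesis using main X X2 w by (intro that[of X "\<lambda>t. w t / (1 - t\<^sup>2)"]) (auto simp: divide_pos_pos)
qed

section \<open>The coefficient of symmetry\<close>

lemma slice_moment_invariant:
  fixes u y y' :: "real^'n::finite"
  assumes n: "CARD('n) \<ge> 2" and y: "norm y = norm y'" "u \<bullet> y = 0" "u \<bullet> y' = 0"
  shows "sph_int (\<lambda>v. (u \<bullet> v) ^ a * (y \<bullet> v) ^ b) = sph_int (\<lambda>v. (u \<bullet> v) ^ a * (y' \<bullet> v) ^ b)"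
proof -
  obtain U where U: "orthogonal_transformation (U :: real^'n \<Rightarrow> real^'n)" "U y = y'" "\<forall>x. x \<bullet> y = x \<bullet> y' \<longrightarrow> U x = x"
    using ex_reflection[OF y(1)] by blast
  have Uu: "U u = u" using U(3) y by simp
  have i: "U p \<bullet> U q = p \<bullet> q" for p q using U(1) by (simp add: orthogonal_transformation_def)
  have e: "u \<bullet> U v = u \<bullet> v" "y' \<bullet> U v = y \<bullet> v" for v
    using i[of u v] i[of y v] Uu U(2) by simp_all
  have "(\<lambda>v. (u \<bullet> v) ^ a * (y' \<bullet> v) ^ b) \<in> forms (a + b)"
    by (intro forms_mult linear_form_power_forms)
  from sph_int_orthogonal[OF n this U(1)] show ?thesis unfolding e .
qed

lemma slice_moment_odd:
  fixes u y :: "real^'n::finite"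
  assumes n: "CARD('n) \<ge> 2" and y: "u \<bullet> y = 0" and b: "odd b"
  shows "sph_int (\<lambda>v. (u \<bullet> v) ^ a * (y \<bullet> v) ^ b) = 0"
proof -
  have "sph_int (\<lambda>v. (u \<bullet> v) ^ a * (y \<bullet> v) ^ b) = sph_int (\<lambda>v. (u \<bullet> v) ^ a * ((- y) \<bullet> v) ^ b)"
    by (rule slice_moment_invariant[OF n]) (use y in auto)
  also have "\<dots> = sph_int (\<lambda>v. -1 * ((u \<bullet> v) ^ a * (y \<bullet> v) ^ b))" using b by simp
  finally show ?thesis unfolding sph_int_cmult by simp
qed

text \<open>By invariance the moment for \<open>y\<close> is a multiple of the one for each
  \<open>w i\<close>, so it may be averaged over the design, whose identity then brings in
  \<open>Qf\<close>. The constant \<open>c\<close> of the design thus appears without either moment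
  being computed.\<close>

lemma slice_moment_even:
  fixes u y :: "real^'n::finite"
  assumes n: "CARD('n) \<ge> 2" and y: "u \<bullet> y = 0"
    and I: "\<forall>i\<in>I. norm (w i) = 1 \<and> u \<bullet> w i = 0" and one: "(\<Sum>i\<in>I. \<omega> i) = 1"
    and des: "\<And>x. (\<Sum>i\<in>I. \<omega> i * (w i \<bullet> x) ^ (2 * j)) = c * Qf u x ^ j"
  shows "sph_int (\<lambda>v. (u \<bullet> v) ^ a * (y \<bullet> v) ^ (2 * j)) =
    norm y ^ (2 * j) * c * sph_int (\<lambda>v. (u \<bullet> v) ^ a * (1 - (u \<bullet> v)\<^sup>2) ^ j)"
proof -
  let ?m = "\<lambda>y. sph_int (\<lambda>v. (u \<bullet> v) ^ a * (y \<bullet> v) ^ (2 * j))"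
  have "?m y = norm y ^ (2 * j) * ?m (w i)" if "i \<in> I" for i
  proof -
    have "?m y = ?m (norm y *\<^sub>R w i)"
      by (rule slice_moment_invariant[OF n]) (use y I that in auto)
    also have "\<dots> = sph_int (\<lambda>v. norm y ^ (2 * j) * ((u \<bullet> v) ^ a * (w i \<bullet> v) ^ (2 * j)))"
      by (simp add: power_mult_distrib mult_ac)
    finally show ?thesis unfolding sph_int_cmult .
  qed
  then have "(\<Sum>i\<in>I. \<omega> i * ?m y) = (\<Sum>i\<in>I. \<omega> i * (norm y ^ (2 * j) * ?m (w i)))"
    by (intro sum.cong) auto
  then have "?m y = (\<Sum>i\<in>I. \<omega> i * (norm y ^ (2 * j) * ?m (w i)))"
    unfolding sum_distrib_right[symmetric] one by simp
  also have "\<dots> = norm y ^ (2 * j) * (\<Sum>i\<in>I. \<omega> i * ?m (w i))"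
    by (simp add: sum_distrib_left mult_ac)
  also have "(\<Sum>i\<in>I. \<omega> i * ?m (w i)) = sph_int (\<lambda>v. \<Sum>i\<in>I. \<omega> i * ((u \<bullet> v) ^ a * (w i \<bullet> v) ^ (2 * j)))"
    by (rule sph_int_lincomb[symmetric, of _ _ "a + 2 * j"]) (intro forms_mult linear_form_power_forms)
  also have "(\<lambda>v. \<Sum>i\<in>I. \<omega> i * ((u \<bullet> v) ^ a * (w i \<bullet> v) ^ (2 * j))) = (\<lambda>v. c * ((u \<bullet> v) ^ a * Qf u v ^ j))"
  proof
    fix v
    have "(\<Sum>i\<in>I. \<omega> i * ((u \<bullet> v) ^ a * (w i \<bullet> v) ^ (2 * j))) = (u \<bullet> v) ^ a * (\<Sum>i\<in>I. \<omega> i * (w i \<bullet> v) ^ (2 * j))"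
      by (simp add: sum_distrib_left mult_ac)
    then show "(\<Sum>i\<in>I. \<omega> i * ((u \<bullet> v) ^ a * (w i \<bullet> v) ^ (2 * j))) = c * ((u \<bullet> v) ^ a * Qf u v ^ j)"
      unfolding des by simp
  qed
  also have "sph_int (\<lambda>v. c * ((u \<bullet> v) ^ a * Qf u v ^ j)) = c * sph_int (\<lambda>v. (u \<bullet> v) ^ a * Qf u v ^ j)"
    by (rule sph_int_cmult)
  also have "sph_int (\<lambda>v. (u \<bullet> v) ^ a * Qf u v ^ j) = sph_int (\<lambda>v. (u \<bullet> v) ^ a * (1 - (u \<bullet> v)\<^sup>2) ^ j)"
    by (rule sph_int_cong[OF forms_continuous[OF forms_mult[OF linear_form_power_forms Qf_power_forms]]])
       (auto intro!: continuous_intros simp: Qf_def)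
  finally show ?thesis by (simp only: mult.assoc)
qed

text \<open>The average of \<open>(x \<bullet> v) ^ (2 * k)\<close> over the latitude of height t,
  as a polynomial in t: \<open>a\<close> is the height of \<open>x\<close>, \<open>r\<close> its
  distance from the axis, and \<open>c\<close> holds the moments of the design.\<close>

definition slice_poly :: "nat \<Rightarrow> (nat \<Rightarrow> real) \<Rightarrow> real \<Rightarrow> real \<Rightarrow> real poly" where
  "slice_poly k c a r = (\<Sum>j\<le>2 * k. smult (if even j then real (2 * k choose j) * a ^ (2 * k - j) * c (j div 2) * r ^ j else 0)
     ([:0, 1:] ^ (2 * k - j) * [:1, 0, -1:] ^ (j div 2)))"

lemma poly_slice_poly:
  "poly (slice_poly k c a r) t = (\<Sum>j\<le>2 * k. (if even j then real (2 * k choose j) * a ^ (2 * k - j) * c (j div 2) * r ^ j else 0)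
     * (t ^ (2 * k - j) * (1 - t\<^sup>2) ^ (j div 2)))"
  by (simp add: slice_poly_def poly_sum poly_power power2_eq_square)

lemma degree_slice_poly: "degree (slice_poly k c a r) \<le> 2 * k"
  unfolding slice_poly_def
proof (intro degree_sum_le)
  fix j assume "j \<in> {..2 * k}"
  have "degree ([:0, 1::real:] ^ (2 * k - j) * [:1, 0, -1:] ^ (j div 2)) \<le> (2 * k - j) * 1 + (j div 2) * 2"
    by (intro order_trans[OF degree_mult_le] add_mono order_trans[OF degree_power_le]) auto
  also have "\<dots> \<le> 2 * k" using \<open>j \<in> {..2 * k}\<close> by simp
  finally show "degree (smult (if even j then real (2 * k choose j) * a ^ (2 * k - j) * c (j div 2) * r ^ j else 0)
      ([:0, 1:] ^ (2 * k - j) * [:1, 0, -1:] ^ (j div 2))) \<le> 2 * k"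
    by (rule order_trans[OF degree_smult_le])
qed simp

text \<open>At the poles every positive power of 1 - t^2 vanishes, leaving the term
  \<open>j = 0\<close>. Equality of the two end values is the condition in
  \<open>lobatto\<close>.\<close>

lemma slice_poly_ends:
  assumes "c 0 = 1" shows "poly (slice_poly k c a r) 1 = a ^ (2 * k)" "poly (slice_poly k c a r) (-1) = a ^ (2 * k)"
proof -
  have "poly (slice_poly k c a r) t = a ^ (2 * k)" if "t = 1 \<or> t = -1" for t
  proof -
    have t2: "t\<^sup>2 = 1" "t ^ (2 * k) = 1" using that by (auto simp: power_mult)
    have "poly (slice_poly k c a r) t = (\<Sum>j\<le>2 * k. if j = 0 then a ^ (2 * k) else 0)"
      unfolding poly_slice_poly
    proof (intro sum.cong refl)
      fix j
      show "(if even j then real (2 * k choose j) * a ^ (2 * k - j) * c (j div 2) * r ^ j else 0)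
          * (t ^ (2 * k - j) * (1 - t\<^sup>2) ^ (j div 2)) = (if j = 0 then a ^ (2 * k) else 0)"
      proof (cases "j = 0 \<or> odd j")
        case False
        then have "j div 2 \<noteq> 0" by (metis dvd_div_eq_0_iff)
        then show ?thesis using False t2 by (simp add: power_0_left)
      qed (use assms t2 in auto)
    qed
    then show ?thesis by simp
  qed
  then show "poly (slice_poly k c a r) 1 = a ^ (2 * k)" "poly (slice_poly k c a r) (-1) = a ^ (2 * k)" by blast+
qed

section \<open>Subtracting an extreme point inside the cone\<close>

lemma Lf_scale:
  assumes "f \<in> Lf k" "c \<ge> 0" "k \<ge> 1" shows "(\<lambda>x::real^'n::finite. c * f x) \<in> Lf k"
proof -
  obtain N and v :: "nat \<Rightarrow> real^'n" where f: "f = (\<lambda>x. \<Sum>i<N. (v i \<bullet> x) ^ (2 * k))"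
    using assms(1) Lf_sum_index by metis
  have "root (2 * k) c ^ (2 * k) = c" using assms by (intro real_root_pow_pos2) auto
  then have "(\<lambda>x. c * f x) = (\<lambda>x. \<Sum>i<N. ((root (2 * k) c *\<^sub>R v i) \<bullet> x) ^ (2 * k))"
    by (simp add: f sum_distrib_left power_mult_distrib)
  then show ?thesis unfolding Lf_sum_index by (intro exI[of _ N] exI[of _ "\<lambda>i. root (2 * k) c *\<^sub>R v i"])
qed

lemma Lf_zero: "(\<lambda>x. 0) \<in> Lf k"
  unfolding Lf_def by (auto intro: exI[of _ "[]"])

lemma Lf_add: "f \<in> Lf k \<Longrightarrow> g \<in> Lf k \<Longrightarrow> (\<lambda>x. f x + g x) \<in> Lf k"
proof -
  assume "f \<in> Lf k" "g \<in> Lf k"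
  then obtain vs ws where "f = (\<lambda>x. \<Sum>v\<leftarrow>vs. (v \<bullet> x) ^ (2 * k))" "g = (\<lambda>x. \<Sum>v\<leftarrow>ws. (v \<bullet> x) ^ (2 * k))"
    unfolding Lf_def by blast
  then have "(\<lambda>x. f x + g x) = (\<lambda>x. \<Sum>v\<leftarrow>vs @ ws. (v \<bullet> x) ^ (2 * k))" by simp
  then show ?thesis unfolding Lf_def by blast
qed

lemma Lf_sum: "(\<And>i. i \<in> I \<Longrightarrow> f i \<in> Lf k) \<Longrightarrow> (\<lambda>x. \<Sum>i\<in>I. f i x) \<in> Lf k"
  by (induction I rule: infinite_finite_induct) (auto intro: Lf_zero Lf_add)

lemma Lf_power: "(\<lambda>x. (v \<bullet> x) ^ (2 * k)) \<in> Lf k"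
  unfolding Lf_def by (auto intro!: exI[of _ "[v]"])

lemma binomial_split:
  fixes p q :: real
  shows "(p + q) ^ (2 * k) = (\<Sum>j\<le>2 * k. real (2 * k choose j) * q ^ (2 * k - j) * p ^ j)"
  unfolding binomial_ring by (simp add: mult_ac)

text \<open>The Gauss--Lobatto rule, applied along the latitudes of \<open>u\<close> with a spherical design on each of them.\<close>

lemma norm_minus_power_Lf:
  fixes u :: "real^'n::finite"
  assumes n: "CARD('n) \<ge> 2" and k: "k \<ge> 1" and u: "norm u = 1"
  shows "(\<lambda>x. norm x ^ (2 * k) - Rop k (zkern (2 * k) u) x / real (Ddim CARD('n) k)) \<in> Lf k"
proof -
  let ?A = "fh (real CARD('n)) 0 (2 * k)" and ?D = "real (Ddim CARD('n) k)"
  have A: "?A > 0" using n by (intro fh_pos) simp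
  obtain X h where X: "finite X" "\<And>t. t \<in> X \<Longrightarrow> t\<^sup>2 < 1" "\<And>t. t \<in> X \<Longrightarrow> h t > (0::real)"
    and lob: "\<And>f. degree f \<le> 2 * k \<Longrightarrow> poly f 1 = poly f (-1) \<Longrightarrow>
      sph_int (\<lambda>v. poly f (u \<bullet> v)) = (\<Sum>t\<in>X. h t * poly f t) + poly f 1 / ?D"
    by (rule lobatto[OF n k u]) blast
  obtain I :: "('n \<Rightarrow> real) set" and \<omega> w c where I: "finite I" "\<forall>i\<in>I. \<omega> i > 0 \<and> norm (w i) = 1 \<and> u \<bullet> w i = 0"
    and c0: "c 0 = (1::real)" and des: "\<forall>j\<le>k. \<forall>x. (\<Sum>i\<in>I. \<omega> i * (w i \<bullet> x) ^ (2 * j)) = c j * Qf u x ^ j"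
    using ex_design[OF n u, of k] by (elim exE conjE) (rule that)
  have one: "(\<Sum>i\<in>I. \<omega> i) = 1" using des[rule_format, of 0 0] c0 by simp
  define \<Phi> where "\<Phi> x = slice_poly k c (u \<bullet> x) (norm (pr u x))" for x
  \<comment> \<open>Splitting \<open>x\<close> into its axial part and \<open>pr u x\<close> and
    expanding binomially reduces the mean to slice moments, where the odd ones vanish and the even
    ones are those of the design.\<close>
  have int: "sph_int (\<lambda>v. (x \<bullet> v) ^ (2 * k)) = sph_int (\<lambda>v. poly (\<Phi> x) (u \<bullet> v))" for x
  proof -
    define a y where "a = u \<bullet> x" and "y = pr u x"
    have uy: "u \<bullet> y = 0" unfolding y_def by (rule pr_inner[OF u])
    have F: "(\<lambda>v. (u \<bullet> v) ^ (2 * k - j) * (y \<bullet> v) ^ j) \<in> forms (2 * k)" if "j \<le> 2 * k" for j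
      using forms_mult[OF linear_form_power_forms[of u "2 * k - j"] linear_form_power_forms[of y j]] that by simp
    have "(x \<bullet> v) ^ (2 * k) = (\<Sum>j\<le>2 * k. (real (2 * k choose j) * a ^ (2 * k - j)) * ((u \<bullet> v) ^ (2 * k - j) * (y \<bullet> v) ^ j))" for v
    proof -
      have e: "x \<bullet> v = y \<bullet> v + a * (u \<bullet> v)"
        using arg_cong[OF pr_decomp[of x u], of "\<lambda>z. z \<bullet> v"] by (simp add: inner_add_left a_def y_def)
      show ?thesis unfolding e binomial_split power_mult_distrib
        by (intro sum.cong refl) (simp only: mult_ac)
    qed
    then have "sph_int (\<lambda>v. (x \<bullet> v) ^ (2 * k)) =
        (\<Sum>j\<le>2 * k. (real (2 * k choose j) * a ^ (2 * k - j)) * sph_int (\<lambda>v. (u \<bullet> v) ^ (2 * k - j) * (y \<bullet> v) ^ j))"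
      by (simp only:) (rule sph_int_lincomb[of _ _ "2 * k"], rule F, simp)
    also have "\<dots> = (\<Sum>j\<le>2 * k. (if even j then real (2 * k choose j) * a ^ (2 * k - j) * c (j div 2) * norm y ^ j else 0)
        * sph_int (\<lambda>v. (u \<bullet> v) ^ (2 * k - j) * (1 - (u \<bullet> v)\<^sup>2) ^ (j div 2)))"
    proof (intro sum.cong refl)
      fix j assume j: "j \<in> {..2 * k}"
      show "real (2 * k choose j) * a ^ (2 * k - j) * sph_int (\<lambda>v. (u \<bullet> v) ^ (2 * k - j) * (y \<bullet> v) ^ j) =
        (if even j then real (2 * k choose j) * a ^ (2 * k - j) * c (j div 2) * norm y ^ j else 0)
        * sph_int (\<lambda>v. (u \<bullet> v) ^ (2 * k - j) * (1 - (u \<bullet> v)\<^sup>2) ^ (j div 2))"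
      proof (cases "even j")
        case True
        then obtain i where i: "j = 2 * i" by (elim evenE)
        have "sph_int (\<lambda>v. (u \<bullet> v) ^ (2 * k - 2 * i) * (y \<bullet> v) ^ (2 * i)) =
            norm y ^ (2 * i) * c i * sph_int (\<lambda>v. (u \<bullet> v) ^ (2 * k - 2 * i) * (1 - (u \<bullet> v)\<^sup>2) ^ i)"
          by (rule slice_moment_even[OF n uy _ one]) (use I des j i in auto)
        then show ?thesis by (simp add: i)
      next
        case False
        then show ?thesis by (simp add: slice_moment_odd[OF n uy])
      qed
    qed
    also have "\<dots> = sph_int (\<lambda>v. \<Sum>j\<le>2 * k. (if even j then real (2 * k choose j) * a ^ (2 * k - j) * c (j div 2) * norm y ^ j else 0)
        * ((u \<bullet> v) ^ (2 * k - j) * (1 - (u \<bullet> v)\<^sup>2) ^ (j div 2)))"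
      by (subst sph_int_sum) (intro continuous_intros, simp only: sph_int_cmult)
    finally show ?thesis unfolding \<Phi>_def poly_slice_poly a_def y_def .
  qed
  define s where "s t = sqrt (1 - t\<^sup>2)" for t
  \<comment> \<open>The nodes come in pairs with both signs of \<open>s t\<close>, which cancels the
    odd powers; even powers of \<open>s t\<close> are powers of 1 - t^2.\<close>
  have slice: "poly (\<Phi> x) t = (\<Sum>i\<in>I. \<omega> i / 2 * (((t *\<^sub>R u + s t *\<^sub>R w i) \<bullet> x) ^ (2 * k) + ((t *\<^sub>R u - s t *\<^sub>R w i) \<bullet> x) ^ (2 * k)))"
    if t: "t\<^sup>2 < 1" for t x
  proof -
    define a y where "a = u \<bullet> x" and "y = pr u x"
    have s2: "(s t)\<^sup>2 = 1 - t\<^sup>2" using t by (simp add: s_def)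
    have "\<omega> i / 2 * (((t *\<^sub>R u + s t *\<^sub>R w i) \<bullet> x) ^ (2 * k) + ((t *\<^sub>R u - s t *\<^sub>R w i) \<bullet> x) ^ (2 * k)) =
       (\<Sum>j\<le>2 * k. (if even j then real (2 * k choose j) * a ^ (2 * k - j) * (t ^ (2 * k - j) * (1 - t\<^sup>2) ^ (j div 2)) else 0) * (\<omega> i * (w i \<bullet> x) ^ j))" for i
    proof -
      have e: "(t *\<^sub>R u + s t *\<^sub>R w i) \<bullet> x = s t * (w i \<bullet> x) + t * a" "(t *\<^sub>R u - s t *\<^sub>R w i) \<bullet> x = - (s t * (w i \<bullet> x)) + t * a"
        by (simp_all add: inner_add_left inner_diff_left a_def)
      show ?thesis unfolding e binomial_split sum.distrib[symmetric] sum_distrib_left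
      proof (intro sum.cong refl)
        fix j
        show "\<omega> i / 2 * (real (2 * k choose j) * (t * a) ^ (2 * k - j) * (s t * (w i \<bullet> x)) ^ j +
            real (2 * k choose j) * (t * a) ^ (2 * k - j) * (- (s t * (w i \<bullet> x))) ^ j) =
          (if even j then real (2 * k choose j) * a ^ (2 * k - j) * (t ^ (2 * k - j) * (1 - t\<^sup>2) ^ (j div 2)) else 0) * (\<omega> i * (w i \<bullet> x) ^ j)"
        proof (cases "even j")
          case True
          then have "s t ^ j = (1 - t\<^sup>2) ^ (j div 2)" unfolding s2[symmetric] by (simp add: power_mult[symmetric])
          then show ?thesis using True by (simp add: power_mult_distrib mult_ac)
        qed simp
      qed
    qed
    then have "(\<Sum>i\<in>I. \<omega> i / 2 * (((t *\<^sub>R u + s t *\<^sub>R w i) \<bullet> x) ^ (2 * k) + ((t *\<^sub>R u - s t *\<^sub>R w i) \<bullet> x) ^ (2 * k))) =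
       (\<Sum>i\<in>I. \<Sum>j\<le>2 * k. (if even j then real (2 * k choose j) * a ^ (2 * k - j) * (t ^ (2 * k - j) * (1 - t\<^sup>2) ^ (j div 2)) else 0) * (\<omega> i * (w i \<bullet> x) ^ j))"
      by (simp only:)
    also have "\<dots> = (\<Sum>j\<le>2 * k. (if even j then real (2 * k choose j) * a ^ (2 * k - j) * (t ^ (2 * k - j) * (1 - t\<^sup>2) ^ (j div 2)) else 0) * (\<Sum>i\<in>I. \<omega> i * (w i \<bullet> x) ^ j))"
      by (subst sum.swap) (simp only: sum_distrib_left)
    also have "\<dots> = poly (\<Phi> x) t"
      unfolding \<Phi>_def poly_slice_poly
    proof (intro sum.cong refl)
      fix j assume j: "j \<in> {..2 * k}"
      show "(if even j then real (2 * k choose j) * a ^ (2 * k - j) * (t ^ (2 * k - j) * (1 - t\<^sup>2) ^ (j div 2)) else 0) * (\<Sum>i\<in>I. \<omega> i * (w i \<bullet> x) ^ j)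
        = (if even j then real (2 * k choose j) * (u \<bullet> x) ^ (2 * k - j) * c (j div 2) * norm (pr u x) ^ j else 0) * (t ^ (2 * k - j) * (1 - t\<^sup>2) ^ (j div 2))"
      proof (cases "even j")
        case True
        then obtain i where i: "j = 2 * i" by (elim evenE)
        have "(\<Sum>l\<in>I. \<omega> l * (w l \<bullet> x) ^ (2 * i)) = c i * norm (pr u x) ^ (2 * i)"
          using des j i norm_pr[OF u, of x] by (simp add: power_mult Qf_def)
        then show ?thesis by (simp add: i a_def)
      qed simp
    qed
    finally show ?thesis by simp
  qed
  \<comment> \<open>The poles of the rule contribute exactly the subtracted multiple of the extreme
    point; the interior latitudes give a positive combination of powers.\<close>
  have "norm x ^ (2 * k) - Rop k (zkern (2 * k) u) x / ?D =
      (\<Sum>t\<in>X. \<Sum>i\<in>I. (h t * \<omega> i / (2 * ?A)) * (((t *\<^sub>R u + s t *\<^sub>R w i) \<bullet> x) ^ (2 * k) + ((t *\<^sub>R u - s t *\<^sub>R w i) \<bullet> x) ^ (2 * k)))" for x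
  proof -
    have "norm x ^ (2 * k) = Rop k (\<lambda>x. norm x ^ (2 * k)) x" by (simp add: Rop_norm[OF n])
    also have "\<dots> = sph_int (\<lambda>v. (x \<bullet> v) ^ (2 * k)) / ?A"
      unfolding Rop_def by (intro arg_cong2[where f = "(/)"] sph_int_cong refl) (auto intro!: continuous_intros)
    also have "sph_int (\<lambda>v. (x \<bullet> v) ^ (2 * k)) = (\<Sum>t\<in>X. h t * poly (\<Phi> x) t) + (u \<bullet> x) ^ (2 * k) / ?D"
      unfolding int using lob[of "\<Phi> x"] degree_slice_poly slice_poly_ends[of c, OF c0] by (simp add: \<Phi>_def)
    finally have "norm x ^ (2 * k) - Rop k (zkern (2 * k) u) x / ?D = (\<Sum>t\<in>X. h t * poly (\<Phi> x) t) / ?A"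
      by (simp add: Rop_zkern inner_commute[of x u] add_divide_distrib)
    also have "\<dots> = (\<Sum>t\<in>X. h t * (\<Sum>i\<in>I. \<omega> i / 2 * (((t *\<^sub>R u + s t *\<^sub>R w i) \<bullet> x) ^ (2 * k) + ((t *\<^sub>R u - s t *\<^sub>R w i) \<bullet> x) ^ (2 * k)))) / ?A"
      using slice X(2) by (intro arg_cong2[where f = "(/)"] sum.cong) auto
    finally show ?thesis
      by (simp add: sum_distrib_left sum_divide_distrib mult.assoc)
  qed
  moreover have "(\<lambda>x. \<Sum>t\<in>X. \<Sum>i\<in>I. (h t * \<omega> i / (2 * ?A)) * (((t *\<^sub>R u + s t *\<^sub>R w i) \<bullet> x) ^ (2 * k) + ((t *\<^sub>R u - s t *\<^sub>R w i) \<bullet> x) ^ (2 * k))) \<in> Lf k"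
    using X(3) I(2) A k by (intro Lf_sum Lf_scale Lf_add Lf_power) (auto simp: less_imp_le)
  ultimately show ?thesis by (simp only:)
qed

text \<open>\<open>norm_minus_power_Lf\<close> settles the extreme points and linearity in
  \<open>f\<close> extends this to convex combinations; the upper bound tests a single extreme
  point.\<close>

lemma coeff_sym_Lfbar:
  assumes n: "CARD('n::finite) \<ge> 2" and k: "k \<ge> 1"
  shows "coeff_sym (Lfbar k :: (real^'n \<Rightarrow> real) set) (\<lambda>x. norm x ^ (2 * k)) = 1 / (real (Ddim CARD('n) k) - 1)"
  unfolding coeff_sym_def
proof (rule Greatest_equality)
  let ?A = "fh (real CARD('n)) 0 (2 * k)" and ?D = "real (Ddim CARD('n) k)"
  let ?r = "\<lambda>x::real^'n. norm x ^ (2 * k)"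
  interpret P: inner_fun "forms (2 * k) :: (real^'n \<Rightarrow> real) set" ip by (rule inner_fun_forms)
  have A: "?A > 0" using n by (intro fh_pos) simp
  have D: "?D \<ge> 2" using Ddim_ge_2[OF n k] by simp
  \<comment> \<open>\<open>b\<close> solves b = (1 + b) / D: scaling r^(2k) minus the share 1 / D of
    an extreme point by 1 + b gives mean 1 and coefficient -b.\<close>
  define b where "b = 1 / (?D - 1)"
  have b: "b > 0" "b = (1 + b) / ?D" using D by (auto simp: b_def field_simps)
  have "(\<lambda>x. ?r x - b * (f x - ?r x)) \<in> Lfbar k" if f: "f \<in> Lfbar k" for f
  proof -
    have fL: "f \<in> Lf k" and fM: "f \<in> Mset k" using f by (auto simp: Lfbar_def)
    obtain N and v :: "nat \<Rightarrow> real^'n" where v: "f = Rop k (\<lambda>x. \<Sum>i<N. ?A * zkern (2 * k) (v i) x)"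
      and fv: "f = (\<lambda>x. \<Sum>i<N. (v i \<bullet> x) ^ (2 * k))"
      by (rule Lf_zkern[OF n fL])
    define g where "g = (\<lambda>x. \<Sum>i<N. ?A * zkern (2 * k) (v i) x)"
    have gF: "g \<in> forms (2 * k)" unfolding g_def by (intro forms_sum forms_scale zkern_forms)
    have zk: "sph_int (zkern (2 * k) u) = norm u ^ (2 * k)" for u :: "real^'n"
      using sph_int_ip_norm[OF zkern_forms] zkern_reproducing[OF norm_power_forms] by metis
    have "sph_int g = (\<Sum>i<N. ?A * sph_int (zkern (2 * k) (v i)))"
      unfolding g_def by (rule sph_int_lincomb) (rule zkern_forms)
    then have s1: "(\<Sum>i<N. ?A * norm (v i) ^ (2 * k)) = 1"
      unfolding zk using sph_int_Rop[OF n gF] fM v by (simp add: Mset_def g_def)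
    define q where "q i = (\<lambda>x. ?r x - Rop k (zkern (2 * k) (sgn (v i))) x / ?D)" for i
    \<comment> \<open>The weights \<open>?A * norm (v i) ^ (2 * k)\<close> sum to 1, so
      \<open>f\<close> is a convex combination of extreme points in the directions
      \<open>sgn (v i)\<close>.\<close>
    have "?r x - b * (f x - ?r x) = (\<Sum>i<N. (1 + b) * (?A * norm (v i) ^ (2 * k)) * q i x)" for x
    proof -
      have "?A * norm (v i) ^ (2 * k) * q i x = ?A * norm (v i) ^ (2 * k) * ?r x - (v i \<bullet> x) ^ (2 * k) / ?D" for i
      proof -
        have "norm (v i) * (x \<bullet> sgn (v i)) = v i \<bullet> x"
          by (cases "v i = 0") (simp_all add: sgn_div_norm inner_commute)
        then have "norm (v i) ^ (2 * k) * (x \<bullet> sgn (v i)) ^ (2 * k) = (v i \<bullet> x) ^ (2 * k)"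
          by (simp only: power_mult_distrib[symmetric])
        then show ?thesis using A D by (simp add: q_def Rop_zkern right_diff_distrib)
      qed
      then have "(\<Sum>i<N. (1 + b) * (?A * norm (v i) ^ (2 * k)) * q i x) =
          (1 + b) * (\<Sum>i<N. ?A * norm (v i) ^ (2 * k) * ?r x - (v i \<bullet> x) ^ (2 * k) / ?D)"
        by (simp only: sum_distrib_left mult.assoc)
      also have "(\<Sum>i<N. ?A * norm (v i) ^ (2 * k) * ?r x - (v i \<bullet> x) ^ (2 * k) / ?D) = ?r x - f x / ?D"
        unfolding sum_subtractf sum_distrib_right[symmetric] s1 by (simp add: fv sum_divide_distrib)
      also have "(1 + b) * (?r x - f x / ?D) = (1 + b) * ?r x - ((1 + b) / ?D) * f x"
        by (simp add: right_diff_distrib)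
      finally show ?thesis unfolding b(2)[symmetric] by (simp add: algebra_simps)
    qed
    moreover have "(\<lambda>x. \<Sum>i<N. (1 + b) * (?A * norm (v i) ^ (2 * k)) * q i x) \<in> Lf k"
    proof (rule Lf_sum)
      fix i
      show "(\<lambda>x. (1 + b) * (?A * norm (v i) ^ (2 * k)) * q i x) \<in> Lf k"
      proof (cases "v i = 0")
        \<comment> \<open>\<open>norm_minus_power_Lf\<close> concerns unit vectors; a zero vector
          has weight 0 because \<open>k\<close> is positive.\<close>
        case True
        then show ?thesis using k Lf_zero by (simp add: power_0_left)
      next
        case False
        then have "q i \<in> Lf k" unfolding q_def by (intro norm_minus_power_Lf[OF n k]) (simp add: norm_sgn)
        then show ?thesis using A b k by (intro Lf_scale) auto
      qed
    qed
    ultimately have "(\<lambda>x. ?r x - b * (f x - ?r x)) \<in> Lf k" by (simp only:)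
    moreover have "(\<lambda>x. ?r x - b * (f x - ?r x)) \<in> Mset k"
    proof -
      note rF = norm_power_forms[of k, where 'n = 'n] and fF = Mset_forms[OF fM]
      have "sph_int (\<lambda>x. ?r x - b * (f x - ?r x)) = sph_int ?r - b * (sph_int f - sph_int ?r)"
        unfolding sph_int_forms_add(2)[OF rF forms_scale[OF forms_diff[OF fF rF]]] sph_int_cmult sph_int_forms_add(2)[OF fF rF] ..
      then show ?thesis using fM norm_Mset[of k, where 'n = 'n] rF fF
        by (auto simp: Mset_def intro!: forms_diff forms_scale)
    qed
    ultimately show ?thesis by (simp add: Lfbar_def)
  qed
  then show "\<forall>f\<in>Lfbar k. (\<lambda>x. ?r x - 1 / (?D - 1) * (f x - ?r x)) \<in> Lfbar k"
    unfolding b_def by blast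
  fix \<beta> assume \<beta>: "\<forall>f\<in>Lfbar k. (\<lambda>x. ?r x - \<beta> * (f x - ?r x)) \<in> Lfbar k"
  obtain u :: "real^'n" where u: "norm u = 1" using norm_axis_1 by blast
  let ?z = "zkern (2 * k) u"
  define G where "G = (\<lambda>x. (1 + \<beta>) * ?r x - \<beta> * ?z x)"
  have GF: "G \<in> forms (2 * k)" unfolding G_def by (intro forms_diff forms_scale norm_power_forms zkern_forms)
  have "(\<lambda>x. ?r x - \<beta> * (Rop k ?z x - ?r x)) \<in> Lf k"
    using bspec[OF \<beta> Rop_zkern_Lfbar[OF n k u]] by (simp add: Lfbar_def)
  moreover have "Rop k G = (\<lambda>x. ?r x - \<beta> * (Rop k ?z x - ?r x))"
    unfolding G_def Rop_diff[OF forms_scale[OF norm_power_forms] forms_scale[OF zkern_forms]] Rop_scale Rop_norm[OF n]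
    by (rule ext) (simp add: algebra_simps)
  ultimately have "Rop k G \<in> Lf k" by simp
  then obtain N and v :: "nat \<Rightarrow> real^'n" where v: "Rop k G = Rop k (\<lambda>x. \<Sum>i<N. ?A * zkern (2 * k) (v i) x)"
    by (rule Lf_zkern[OF n])
  have G: "G = (\<lambda>x. \<Sum>i<N. ?A * zkern (2 * k) (v i) x)"
    by (rule Rop_inj_on[OF n GF _ v]) (intro forms_sum forms_scale zkern_forms)
  \<comment> \<open>A nonnegative form pairs nonnegatively with the \<open>Rop\<close>-preimage of a
    cone element, which is a positive combination of kernels. This \<open>F\<close> pairs with
    r^(2k) to D and with the kernel at \<open>u\<close> to D^2.\<close>
  define F where "F x = zkern k u x * zkern k u x" for x
  have FF: "F \<in> forms (2 * k)"
    using forms_mult[OF zkern_forms[of k u] zkern_forms[of k u]] by (simp add: F_def[abs_def] mult_2)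
  have "ip G F = (\<Sum>i<N. ?A * ip (zkern (2 * k) (v i)) F)"
    unfolding G by (rule P.B_lincomb[OF FF]) (rule zkern_forms)
  also have "\<dots> = (\<Sum>i<N. ?A * F (v i))" by (simp only: zkern_reproducing[OF FF])
  finally have pos: "ip G F \<ge> 0" using A by (simp add: F_def sum_nonneg)
  have "ip G F = ip (\<lambda>x. (1 + \<beta>) * ?r x) F - ip (\<lambda>x. \<beta> * ?z x) F"
    unfolding G_def by (rule P.B_diff[OF forms_scale[OF norm_power_forms] forms_scale[OF zkern_forms] FF])
  also have "\<dots> = (1 + \<beta>) * ip ?r F - \<beta> * ip ?z F"
    by (simp only: P.B_scale[OF norm_power_forms FF] P.B_scale[OF zkern_forms FF])
  also have "ip ?r F = ?D"
    using sph_int_ip_norm[OF FF] zkern_self[of k u] zkern_diag[OF n u, of k]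
    by (simp add: ip_sym[of ?r] F_def[abs_def] ip_def)
  also have "ip ?z F = ?D * ?D"
    using zkern_reproducing[OF FF, of u] zkern_diag[OF n u, of k] by (simp add: F_def)
  finally have "?D * (1 + \<beta> - \<beta> * ?D) \<ge> 0" using pos by (simp add: algebra_simps)
  then have "1 + \<beta> - \<beta> * ?D \<ge> 0" using D by (auto simp only: zero_le_mult_iff)
  then have "\<beta> * (?D - 1) \<le> 1" by (simp add: right_diff_distrib)
  then show "\<beta> \<le> 1 / (?D - 1)" using D by (simp add: le_divide_eq)
qed

theorem theorem7p7:
  fixes k :: nat
  assumes "CARD('n::finite) \<ge> 2" and "k \<ge> 1"
  shows "is_loewner (Mset k :: (real^'n \<Rightarrow> real) set) (Ddim CARD('n) (2*k) - 1) (Lfbar k)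
           {f \<in> Mset k. (\<Sum>i=1..k.
               ((fact (k - i) * Gamma ((2*k + 2*i + CARD('n)) / 2))
                 / (fact k * Gamma ((2*k + CARD('n)) / 2)))\<^sup>2 * (fnorm (lproj k i f))\<^sup>2)
             \<le> real (Ddim CARD('n) (2*k)) - 1}
       \<and> coeff_sym (Lfbar k :: (real^'n \<Rightarrow> real) set) (\<lambda>x. norm x ^ (2*k))
           = 1 / (real (Ddim CARD('n) k) - 1)"
proof -
  let ?m = "Ddim CARD('n) (2 * k) - 1"
  have m: "real ?m + 1 = real (Ddim CARD('n) (2 * k))"
    using Ddim_ge_2[of "CARD('n)" "2 * k"] assms by (simp add: of_nat_diff)
  have lam: "(fact (k - i) * Gamma ((2*k + 2*i + CARD('n)) / 2)) / (fact k * Gamma ((2*k + CARD('n)) / 2)) = lam (real CARD('n)) k i" for i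
    by (simp add: lam_def)
  show ?thesis
    unfolding lam ellipsoid_eq_ballM[OF assms(1) m]
    using loewner_ballM[OF assms refl] coeff_sym_Lfbar[OF assms] by blast
qed

end
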